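(* Let $b=\mathrm{Diag}(\{b_i\}_{i\in\mathbb N})$ be a compact self-adjoint diagonal operator with $b_i\neq b_j$ for $i\neq j$, and let $Z\in\mathcal K(\mathcal H)^{ah}+\mathcal D(\mathcal B(\mathcal H))^{ah}$, $Z\neq 0$, be a minimal operator. Put $x=Zb-bZ$ and $\gamma(t)=e^{tZ}be^{-tZ}$. Then $\gamma(t)\in\mathcal O_b$ for every $t\in\mathbb R$, $x\in T_b\mathcal O_b$ with $\|x\|_b=\|Z\|$, and for each $t_0\in\left[-\frac{\pi}{2\|Z\|},\frac{\pi}{2\|Z\|}\right]$ the curve $\gamma$ restricted to the interval between $0$ and $t_0$ has minimal length among all piecewise smooth curves in $\mathcal O_b$ joining $b=\gamma(0)$ and $\gamma(t_0)$, i.e. $L(\gamma|_{[0,t_0]})=|t_0|\,\|Z\|=\mathrm{dist}(b,\gamma(t_0))$.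
   Context: Let $\mathcal H$ be a separable infinite-dimensional complex Hilbert space with a fixed orthonormal basis $\{e_i\}_{i\in\mathbb N}$; operators are identified with their matrices $A_{ij}=\langle Ae_j,e_i\rangle$ and $c_j(A)=Ae_j$ denotes the $j$-th column. $\mathcal B(\mathcal H)$, $\mathcal K(\mathcal H)$ denote the bounded and compact operators; superscript $ah$ means anti-Hermitian ($X^*=-X$), $h$ means Hermitian. $\mathcal D(\mathcal B(\mathcal H))$ is the set of bounded diagonal operators (w.r.t. $\{e_i\}$) and $\mathrm{Diag}(X)$ the diagonal part of $X$. $\mathcal K+\mathbb C=\{K+\lambda I:K\in\mathcal K(\mathcal H),\lambda\in\mathbb C\}$ with the operator norm, and $\mathcal U_{\mathcal K+\mathbb C}$ is its unitary group. For the diagonal compact self-adjoint $b$ with pairwise distinct diagonal entries, $\mathcal O_b=\{ubu^*:u\in\mathcal U_{\mathcal K+\mathbb C}\}$. For $c\in\mathcal O_b$ the tangent space is $T_c\mathcal O_b=\{Yc-cY:Y\in(\mathcal K+\mathbb C)^{ah}\}$ with Finsler norm $\|z\|_c=\inf\{\|Y\|:Y\in(\mathcal K+\mathbb C)^{ah},\ Yc-cY=z\}$. For a piecewise smooth curve $\beta:[a,a']\to\mathcal O_b$, $L(\beta)=\int_a^{a'}\|\beta'(t)\|_{\beta(t)}dt$, and $\mathrm{dist}(c_1,c_2)=\inf\{L(\beta)\}$ over piecewise smooth curves in $\mathcal O_b$ joining $c_1$ and $c_2$. An operator $Z\in\mathcal B(\mathcal H)^{ah}$ is called minimal if $\|Z\|\le\|Z+D\|$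 for all $D\in\mathcal D(\mathcal B(\mathcal H))^{ah}$. *)

theory Defs
  imports "HOL-Analysis.Analysis" "HOL-Library.Function_Algebras"
begin

text \<open>Operators on H = l2(N) are represented by their matrices w.r.t. the fixed
orthonormal basis: A i j = <A e_j, e_i>.  Addition, subtraction and negation of
matrices are pointwise (Function_Algebras); the operator product is mat_mult.\<close>

type_synonym mat = "nat \<Rightarrow> nat \<Rightarrow> complex"

definition msmult :: "complex \<Rightarrow> mat \<Rightarrow> mat" where
  "msmult c A = (\<lambda>i j. c * A i j)"

definition mat_id :: mat where
  "mat_id = (\<lambda>i j. if i = j then 1 else 0)"

definition mat_adj :: "mat \<Rightarrow> mat" where
  "mat_adj A = (\<lambda>i j. cnj (A j i))"

definition mat_mult :: "mat \<Rightarrow> mat \<Rightarrow> mat" where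
  "mat_mult A B = (\<lambda>i j. \<Sum>k. A i k * B k j)"

primrec mat_pow :: "mat \<Rightarrow> nat \<Rightarrow> mat" where
  "mat_pow A 0 = mat_id"
| "mat_pow A (Suc n) = mat_mult A (mat_pow A n)"

text \<open>Exponential series (entrywise limit = entries of the norm-convergent series).\<close>
definition mat_exp :: "mat \<Rightarrow> mat" where
  "mat_exp A = (\<lambda>i j. \<Sum>n. mat_pow A n i j / of_nat (fact n))"

definition op_bound :: "mat \<Rightarrow> real \<Rightarrow> bool" where
  "op_bound A C \<longleftrightarrow> (\<forall>S T :: nat set. \<forall>x :: nat \<Rightarrow> complex. finite S \<longrightarrow> finite T \<longrightarrow>
      (\<Sum>i\<in>T. (cmod (\<Sum>j\<in>S. A i j * x j))\<^sup>2) \<le> C\<^sup>2 * (\<Sum>j\<in>S. (cmod (x j))\<^sup>2))"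

definition bounded_op :: "mat \<Rightarrow> bool" where
  "bounded_op A \<longleftrightarrow> (\<exists>C. op_bound A C)"

definition opnorm :: "mat \<Rightarrow> real" where
  "opnorm A = Inf {C. 0 \<le> C \<and> op_bound A C}"

definition finite_rank :: "mat \<Rightarrow> bool" where
  "finite_rank A \<longleftrightarrow> (\<exists>F :: (nat \<Rightarrow> complex) set. finite F \<and>
      (\<forall>j. \<exists>c :: (nat \<Rightarrow> complex) \<Rightarrow> complex. (\<lambda>i. A i j) = (\<lambda>i. \<Sum>v\<in>F. c v * v i)))"

definition compact_op :: "mat \<Rightarrow> bool" where
  "compact_op A \<longleftrightarrow> bounded_op A \<and>
      (\<forall>e>0. \<exists>F. bounded_op F \<and> finite_rank F \<and> opnorm (A - F) < e)"

definition is_diag :: "mat \<Rightarrow> bool" where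
  "is_diag A \<longleftrightarrow> (\<forall>i j. i \<noteq> j \<longrightarrow> A i j = 0)"

definition anti_herm :: "mat \<Rightarrow> bool" where
  "anti_herm A \<longleftrightarrow> mat_adj A = - A"

definition in_KC :: "mat \<Rightarrow> bool" where
  "in_KC A \<longleftrightarrow> (\<exists>K c. compact_op K \<and> A = K + msmult c mat_id)"

definition unitary_KC :: "mat \<Rightarrow> bool" where
  "unitary_KC u \<longleftrightarrow> in_KC u \<and> mat_mult u (mat_adj u) = mat_id \<and> mat_mult (mat_adj u) u = mat_id"

definition orbit :: "mat \<Rightarrow> mat set" where
  "orbit b = {mat_mult (mat_mult u b) (mat_adj u) | u. unitary_KC u}"

definition tangent_space :: "mat \<Rightarrow> mat set" where
  "tangent_space c = {mat_mult Y c - mat_mult c Y | Y. in_KC Y \<and> anti_herm Y}"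

definition finsler :: "mat \<Rightarrow> mat \<Rightarrow> real" where
  "finsler c z = Inf {opnorm Y | Y. in_KC Y \<and> anti_herm Y \<and> mat_mult Y c - mat_mult c Y = z}"

definition op_has_deriv :: "(real \<Rightarrow> mat) \<Rightarrow> mat \<Rightarrow> real \<Rightarrow> real set \<Rightarrow> bool" where
  "op_has_deriv \<beta> D t S \<longleftrightarrow>
     ((\<lambda>s. opnorm (msmult (of_real (1 / (s - t))) (\<beta> s - \<beta> t) - D)) \<longlongrightarrow> 0) (at t within S)"

definition op_continuous_on :: "real set \<Rightarrow> (real \<Rightarrow> mat) \<Rightarrow> bool" where
  "op_continuous_on S f \<longleftrightarrow> (\<forall>t\<in>S. ((\<lambda>s. opnorm (f s - f t)) \<longlongrightarrow> 0) (at t within S))"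

definition curve_length :: "mat \<Rightarrow> (real \<Rightarrow> mat) \<Rightarrow> real \<Rightarrow> real \<Rightarrow> real \<Rightarrow> bool" where
  "curve_length b \<beta> a a' l \<longleftrightarrow> a \<le> a' \<and> (\<forall>t\<in>{a..a'}. \<beta> t \<in> orbit b) \<and>
     (\<exists>(n::nat) (s::nat \<Rightarrow> real) (D::nat \<Rightarrow> real \<Rightarrow> mat) (ls::nat \<Rightarrow> real).
        s 0 = a \<and> s n = a' \<and> (\<forall>k<n. s k < s (Suc k)) \<and> l = (\<Sum>k<n. ls k) \<and>
        (\<forall>k<n. (\<forall>t\<in>{s k..s (Suc k)}. op_has_deriv \<beta> (D k t) t {s k..s (Suc k)}
                                      \<and> D k t \<in> tangent_space (\<beta> t))
              \<and> op_continuous_on {s k..s (Suc k)} (D k)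
              \<and> ((\<lambda>t. finsler (\<beta> t) (D k t)) has_integral ls k) {s k..s (Suc k)}))"

definition orbit_dist :: "mat \<Rightarrow> mat \<Rightarrow> mat \<Rightarrow> real" where
  "orbit_dist b c1 c2 = Inf {l. \<exists>\<beta> a a'. curve_length b \<beta> a a' l \<and> \<beta> a = c1 \<and> \<beta> a' = c2}"

definition minimal_op :: "mat \<Rightarrow> bool" where
  "minimal_op Z \<longleftrightarrow> bounded_op Z \<and> anti_herm Z \<and>
     (\<forall>D. bounded_op D \<and> is_diag D \<and> anti_herm D \<longrightarrow> opnorm Z \<le> opnorm (Z + D))"

end

theory Submission
  imports Defs
begin

text \<open>
  Let \<open>X = - \<i> Z\<close>. By minimality and the compactness of the off-diagonal part of \<open>Z\<close> there are, up to an arbitrarily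
  small error, finitely many finitely supported vectors \<open>v k\<close> and signs \<open>s k\<close> such that the \<open>v k\<close> have total norm one,
  \<open>X v k = s k \<parallel>Z\<parallel> v k\<close>, and \<open>\<Sum> s k v k (v k)\<^sup>*\<close> has zero diagonal. (One maximises the corresponding
  linear functional with a quadratic penalty on the diagonal; the first-order condition produces a
  diagonal perturbation of \<open>Z\<close>, to which minimality applies.)

  Let \<open>S\<close> be the span of the vectors \<open>(d v k)\<close>, \<open>d\<close> diagonal, in a finite direct sum of copies of the
  Hilbert space, with projection \<open>p\<close>. The vector \<open>v = (v k)\<close> lies in \<open>S\<close>, while \<open>(s k v k)\<close> is orthogonal to \<open>S\<close>, so
  \<open>exp (t Z) v\<close> makes the angle \<open>t \<parallel>Z\<parallel>\<close> with \<open>S\<close>. Since \<open>p\<close> commutes with diagonal unitaries, \<open>u b u\<^sup>* \<mapsto> u p u\<^sup>*\<close> is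
  well defined on the orbit, and along a curve \<open>c\<close> with \<open>c' = Y c - c Y\<close> this projection \<open>q\<close> satisfies
  \<open>q' = Y q - q Y\<close>. Hence the angle between a fixed vector and the range of \<open>q\<close> changes at rate at most \<open>\<parallel>Y\<parallel>\<close>,
  and a curve from \<open>b\<close> to \<open>exp (t Z) b exp (- t Z)\<close> has length at least \<open>\<bar>t\<bar> \<parallel>Z\<parallel>\<close> as long as this is at most \<open>\<pi> / 2\<close>.
  Conversely \<open>Z\<close> is approximated by compact lifts of norm at most \<open>\<parallel>Z\<parallel> + \<epsilon>\<close>, obtained by truncating its diagonal part.
\<close>

section \<open>Square-summable sequences\<close>

text \<open>A zero-diagonal functional norming \<open>Z\<close> would classically come from
  Hahn-Banach and weak-star compactness. Here it is replaced by finitely supported near-maximisers,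
  so every dual statement carries an error, which is sent to zero only after the cosine of the
  length of a fixed curve has been bounded. Several copies of the space are unavoidable: a single
  rank one operator built from a nonzero vector never has zero diagonal.

  Two features of the orbit shape the geometry. The entries of \<open>b\<close> are distinct, so
  only diagonal unitaries fix \<open>b\<close>; anything that commutes with them can be transported
  along the orbit. The entries also tend to 0, so gaps between eigenvalues shrink and only finitely
  many spectral projections, at nonzero eigenvalues, can be differentiated with uniform bounds.

  On the other side, \<open>D\<close> is merely bounded, so neither \<open>Z\<close> nor its
  exponential need be compact plus scalar. Membership in the orbit and the value of the Finsler norm
  both require correcting \<open>Z\<close> by a diagonal part that commutes with \<open>b\<close>.

  The limit \<pi> / 2 is the largest angle that a vector can make with a subspace.\<close>

typedef ell2 = "{x :: nat \<Rightarrow> complex. summable (\<lambda>i. (cmod (x i))\<^sup>2)}" morphisms coord Abs_ell2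
  by (rule exI[of _ "\<lambda>_. 0"]) simp

setup_lifting type_definition_ell2

lemma coord_inject_ext: "(\<And>i. coord x i = coord y i) \<Longrightarrow> x = y"
  by (simp add: coord_inject[symmetric] fun_eq_iff)

lemma summable_coord_sq: "summable (\<lambda>i. (cmod (coord x i))\<^sup>2)"
  using coord[of x] by simp

lemma square_add_le: "(cmod (a + b))\<^sup>2 \<le> 2 * (cmod a)\<^sup>2 + 2 * (cmod b)\<^sup>2"
proof -
  have "(cmod (a + b))\<^sup>2 \<le> (cmod a + cmod b)\<^sup>2"
    by (simp add: norm_triangle_ineq power_mono)
  also have "\<dots> \<le> 2 * (cmod a)\<^sup>2 + 2 * (cmod b)\<^sup>2"
    using sum_squares_bound[of "cmod a" "cmod b"] by (simp add: power2_sum)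
  finally show ?thesis .
qed

lemma summable_sq_add:
  assumes "summable (\<lambda>i::nat. (cmod (x i))\<^sup>2)" "summable (\<lambda>i. (cmod (y i))\<^sup>2)"
  shows "summable (\<lambda>i. (cmod (x i + y i))\<^sup>2)"
proof (rule summable_comparison_test')
  show "summable (\<lambda>i. 2 * (cmod (x i))\<^sup>2 + 2 * (cmod (y i))\<^sup>2)"
    by (intro summable_add summable_mult assms)
qed (simp add: square_add_le)

lemma summable_sq_mult:
  assumes "summable (\<lambda>i::nat. (cmod (x i))\<^sup>2)"
  shows "summable (\<lambda>i. (cmod (c * x i))\<^sup>2)"
  using summable_mult[OF assms, of "(cmod c)\<^sup>2"] by (simp add: norm_mult power_mult_distrib)

lemma summable_abs_mult_ell2:
  assumes "summable (\<lambda>i::nat. (cmod (x i))\<^sup>2)" "summable (\<lambda>i. (cmod (y i))\<^sup>2)"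
  shows "summable (\<lambda>i. cmod (x i) * cmod (y i))"
proof (rule summable_comparison_test')
  show "summable (\<lambda>i. (cmod (x i))\<^sup>2 + (cmod (y i))\<^sup>2)"
    by (intro summable_add assms)
  show "norm (cmod (x i) * cmod (y i)) \<le> (cmod (x i))\<^sup>2 + (cmod (y i))\<^sup>2" for i
    using sum_squares_bound[of "cmod (x i)" "cmod (y i)"]
      mult_nonneg_nonneg[OF norm_ge_zero[of "x i"] norm_ge_zero[of "y i"]]
    by (simp only: norm_mult real_norm_def abs_norm_cancel)
qed

instantiation ell2 :: real_vector
begin

lift_definition zero_ell2 :: ell2 is "\<lambda>_. 0" by simp
lift_definition plus_ell2 :: "ell2 \<Rightarrow> ell2 \<Rightarrow> ell2" is "\<lambda>x y i. x i + y i"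
  by (rule summable_sq_add)
lift_definition uminus_ell2 :: "ell2 \<Rightarrow> ell2" is "\<lambda>x i. - x i" by simp
lift_definition minus_ell2 :: "ell2 \<Rightarrow> ell2 \<Rightarrow> ell2" is "\<lambda>x y i. x i - y i"
  subgoal for x y using summable_sq_add[of x "\<lambda>i. - y i"] by simp
  done
lift_definition scaleR_ell2 :: "real \<Rightarrow> ell2 \<Rightarrow> ell2" is "\<lambda>r x i. of_real r * x i"
  by (rule summable_sq_mult)

instance
  by standard (transfer; simp add: fun_eq_iff algebra_simps)+

end

lemma coord_simps [simp]:
  "coord 0 i = 0" "coord (x + y) i = coord x i + coord y i" "coord (- x) i = - coord x i"
  "coord (x - y) i = coord x i - coord y i" "coord (r *\<^sub>R x) i = of_real r * coord x i"
  by (transfer, simp)+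

lemma summable_inner_coord: "summable (\<lambda>i. coord x i \<bullet> coord y i)"
proof (rule summable_comparison_test')
  show "summable (\<lambda>i. cmod (coord x i) * cmod (coord y i))"
    by (intro summable_abs_mult_ell2 summable_coord_sq)
qed (simp add: Cauchy_Schwarz_ineq2)

instantiation ell2 :: real_inner
begin

text \<open>The real part of the usual complex inner product. The space is treated as a real inner
  product space, and its complex structure is carried separately by \<open>cmul\<close>.\<close>

definition inner_ell2 :: "ell2 \<Rightarrow> ell2 \<Rightarrow> real" where
  "inner_ell2 x y = (\<Sum>i. coord x i \<bullet> coord y i)"
definition norm_ell2 :: "ell2 \<Rightarrow> real" where
  "norm_ell2 x = sqrt (x \<bullet> x)"
definition sgn_ell2 :: "ell2 \<Rightarrow> ell2" where
  "sgn_ell2 x = inverse (norm x) *\<^sub>R x"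
definition dist_ell2 :: "ell2 \<Rightarrow> ell2 \<Rightarrow> real" where
  "dist_ell2 x y = norm (x - y)"
definition uniformity_ell2 :: "(ell2 \<times> ell2) filter" where
  "uniformity_ell2 = (INF e\<in>{0<..}. principal {(x, y). dist x y < e})"
definition open_ell2 :: "ell2 set \<Rightarrow> bool" where
  "open_ell2 U \<longleftrightarrow> (\<forall>x\<in>U. \<forall>\<^sub>F (x', y) in uniformity. x' = x \<longrightarrow> y \<in> U)"

instance
proof
  fix x y z :: ell2 and r :: real
  show "x \<bullet> y = y \<bullet> x" by (simp add: inner_ell2_def inner_commute)
  show "(x + y) \<bullet> z = x \<bullet> z + y \<bullet> z"
    by (simp add: inner_ell2_def inner_add_left suminf_add summable_inner_coord)
  show "(r *\<^sub>R x) \<bullet> y = r * (x \<bullet> y)"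
    unfolding inner_ell2_def
    by (subst suminf_mult[OF summable_inner_coord, symmetric])
       (simp add: scaleR_conv_of_real[symmetric])
  show "0 \<le> x \<bullet> x"
    unfolding inner_ell2_def by (intro suminf_nonneg summable_inner_coord) simp
  show "(x \<bullet> x = 0) = (x = 0)"
  proof
    assume "x \<bullet> x = 0"
    then have "\<forall>i. coord x i \<bullet> coord x i = 0"
      unfolding inner_ell2_def by (subst (asm) suminf_eq_zero_iff[OF summable_inner_coord]) auto
    then show "x = 0" by (intro coord_inject_ext) simp
  qed (simp add: inner_ell2_def)
qed (simp_all add: norm_ell2_def sgn_ell2_def dist_ell2_def uniformity_ell2_def open_ell2_def)

end

lemma norm_ell2_sq: "(norm x)\<^sup>2 = (\<Sum>i. (cmod (coord x i))\<^sup>2)"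
  by (simp add: power2_norm_eq_inner[of x] inner_ell2_def dot_square_norm)

lemma sum_coord_sq_le: "finite T \<Longrightarrow> (\<Sum>i\<in>T. (cmod (coord x i))\<^sup>2) \<le> (norm x)\<^sup>2"
  unfolding norm_ell2_sq by (intro sum_le_suminf summable_coord_sq) auto

lemma cmod_coord_le: "cmod (coord x i) \<le> norm x"
  using sum_coord_sq_le[of "{i}" x] by (simp add: power2_le_iff_abs_le)

lemma bounded_linear_coord [simp]: "bounded_linear (\<lambda>x. coord x i)"
  by (rule bounded_linear_intro[of _ 1]) (auto simp: scaleR_conv_of_real cmod_coord_le)

lemmas tendsto_coord [tendsto_intros] = bounded_linear.tendsto[OF bounded_linear_coord]

lemma Abs_ell2_bounded:
  assumes C: "0 \<le> C" and le: "\<And>n. (\<Sum>i<n. (cmod (x i))\<^sup>2) \<le> C\<^sup>2"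
  shows "coord (Abs_ell2 x) = x" and "norm (Abs_ell2 x) \<le> C"
proof -
  have *: "summable (\<lambda>i. (cmod (x i))\<^sup>2)"
    by (rule summableI_nonneg_bounded[OF _ le]) auto
  then show eq: "coord (Abs_ell2 x) = x" by (simp add: Abs_ell2_inverse)
  have "(norm (Abs_ell2 x))\<^sup>2 \<le> C\<^sup>2"
    unfolding norm_ell2_sq eq by (intro suminf_le_const * le)
  then show "norm (Abs_ell2 x) \<le> C"
    using C power2_le_imp_le by blast
qed

instance ell2 :: complete_space
proof
  fix X :: "nat \<Rightarrow> ell2"
  assume X: "Cauchy X"
  define y where "y = (\<lambda>i. lim (\<lambda>n. coord (X n) i))"
  have y: "(\<lambda>n. coord (X n) i) \<longlonglongrightarrow> y i" for i
    unfolding y_def using bounded_linear.Cauchy[OF bounded_linear_coord X]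
    by (simp add: Cauchy_convergent convergent_LIMSEQ_iff[symmetric])
  have tail: "(\<Sum>i<m. (cmod (coord (X k) i - y i))\<^sup>2) \<le> e\<^sup>2"
    if "\<forall>n\<ge>N. norm (X k - X n) < e" for k m N e
  proof (rule LIMSEQ_le_const2)
    show "(\<lambda>n. \<Sum>i<m. (cmod (coord (X k) i - coord (X n) i))\<^sup>2)
        \<longlonglongrightarrow> (\<Sum>i<m. (cmod (coord (X k) i - y i))\<^sup>2)"
      by (intro tendsto_intros y)
    show "\<exists>N. \<forall>n\<ge>N. (\<Sum>i<m. (cmod (coord (X k) i - coord (X n) i))\<^sup>2) \<le> e\<^sup>2"
    proof (intro exI[of _ N] allI impI)
      fix n assume "N \<le> n"
      with that have "norm (X k - X n) \<le> e" by (auto intro: less_imp_le)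
      then have "(norm (X k - X n))\<^sup>2 \<le> e\<^sup>2" by (simp add: power_mono)
      then show "(\<Sum>i<m. (cmod (coord (X k) i - coord (X n) i))\<^sup>2) \<le> e\<^sup>2"
        using sum_coord_sq_le[of "{..<m}" "X k - X n"] by simp
    qed
  qed
  obtain N where "\<forall>m\<ge>N. \<forall>n\<ge>N. norm (X m - X n) < 1"
    using CauchyD[OF X, of 1] by auto
  \<comment> \<open>With error 1 the tail bound makes \<open>X N - y\<close> square summable, so the
    coordinatewise limit \<open>y\<close> is square summable too: it is \<open>X N\<close> minus
    this element.\<close>
  then have "coord (Abs_ell2 (\<lambda>i. coord (X N) i - y i)) = (\<lambda>i. coord (X N) i - y i)"
    by (intro Abs_ell2_bounded(1)[of 1] tail[where N = N]) auto
  then have cy: "coord (X N - Abs_ell2 (\<lambda>i. coord (X N) i - y i)) i = y i" for i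
    by simp
  define Y where "Y = X N - Abs_ell2 (\<lambda>i. coord (X N) i - y i)"
  have "X \<longlonglongrightarrow> Y"
  proof (rule LIMSEQ_I)
    fix r :: real assume r: "r > 0"
    then obtain M where M: "\<forall>m\<ge>M. \<forall>n\<ge>M. norm (X m - X n) < r / 2"
      using CauchyD[OF X, of "r / 2"] by auto
    have "norm (X n - Y) < r" if "n \<ge> M" for n
    proof -
      have *: "(\<Sum>i<m. (cmod (coord (X n) i - y i))\<^sup>2) \<le> (r / 2)\<^sup>2" for m
        using M that by (intro tail[where N = M]) auto
      have "X n - Y = Abs_ell2 (\<lambda>i. coord (X n) i - y i)"
        using cy Abs_ell2_bounded(1)[OF _ *] r
        by (intro coord_inject_ext) (simp add: Y_def del: coord_simps(4), simp)
      also have "norm \<dots> \<le> r / 2" using r by (intro Abs_ell2_bounded(2) *) auto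
      finally show ?thesis using r by simp
    qed
    then show "\<exists>M. \<forall>n\<ge>M. norm (X n - Y) < r" by blast
  qed
  then show "convergent X" by (auto simp: convergent_def)
qed

instance ell2 :: banach ..

lift_definition cmul :: "complex \<Rightarrow> ell2 \<Rightarrow> ell2" is "\<lambda>c x i. c * x i"
  by (rule summable_sq_mult)

lift_definition unit_vec :: "nat \<Rightarrow> ell2" is "\<lambda>j i. if i = j then 1 else 0"
  subgoal for j
    by (rule summable_finite[of "{j}"]) auto
  done

lemma coord_cmul [simp]: "coord (cmul c x) i = c * coord x i"
  by transfer simp

lemma coord_unit_vec [simp]: "coord (unit_vec j) i = (if i = j then 1 else 0)"
  by transfer simp

lemma coord_sum [simp]: "coord (\<Sum>k\<in>A. f k) i = (\<Sum>k\<in>A. coord (f k) i)"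
  by (induction A rule: infinite_finite_induct) auto

lemma norm_cmul [simp]: "norm (cmul c x) = cmod c * norm x"
proof -
  have "(norm (cmul c x))\<^sup>2 = (cmod c * norm x)\<^sup>2"
    unfolding norm_ell2_sq power_mult_distrib
    by (simp add: suminf_mult[OF summable_coord_sq, symmetric] norm_mult power_mult_distrib)
  then show ?thesis by (simp add: power2_eq_iff_nonneg)
qed

lemma cmul_algebra [simp]:
  "cmul c (x + y) = cmul c x + cmul c y" "cmul c (x - y) = cmul c x - cmul c y"
  "cmul c (cmul d x) = cmul (c * d) x" "cmul c (r *\<^sub>R x) = r *\<^sub>R cmul c x" "cmul 1 x = x"
  "cmul (of_real r) x = r *\<^sub>R x" "cmul c 0 = 0" "cmul 0 x = 0"
  by (rule coord_inject_ext, simp add: algebra_simps)+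

lemma cmul_add_left: "cmul (c + d) x = cmul c x + cmul d x"
  by (rule coord_inject_ext) (simp add: algebra_simps)

lemma inner_cmul_left: "cmul c x \<bullet> y = x \<bullet> cmul (cnj c) y"
  unfolding inner_ell2_def
  by (rule arg_cong[where f = suminf]) (auto simp: fun_eq_iff inner_complex_def algebra_simps)

lemma bounded_linear_cmul [simp]: "bounded_linear (cmul c)"
  by (rule bounded_linear_intro[of _ "cmod c"]) (auto simp: mult.commute)

lemma inner_unit_vec: "unit_vec i \<bullet> x = Re (coord x i)"
proof -
  have "(\<lambda>j. coord (unit_vec i) j \<bullet> coord x j) sums (\<Sum>j\<in>{i}. coord (unit_vec i) j \<bullet> coord x j)"
    by (rule sums_finite) auto
  then show ?thesis by (simp add: inner_ell2_def sums_iff inner_complex_def)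
qed

lemma norm_unit_vec [simp]: "norm (unit_vec i) = 1"
  by (simp add: norm_eq_sqrt_inner inner_unit_vec)

lemma unit_vec_expansion: "(\<lambda>n. \<Sum>j<n. cmul (coord x j) (unit_vec j)) \<longlonglongrightarrow> x"
proof -
  define S where "S = (\<lambda>n. \<Sum>j<n. cmul (coord x j) (unit_vec j))"
  have cS: "coord (S n) i = (if i < n then coord x i else 0)" for n i
    by (simp add: S_def if_distrib[of "(*) _"] cong: if_cong)
  have eq: "(norm (x - S n))\<^sup>2 = (\<Sum>i. (cmod (coord x i))\<^sup>2) - (\<Sum>i<n. (cmod (coord x i))\<^sup>2)" for n
  proof -
    have "(norm (x - S n))\<^sup>2 = (\<Sum>i. (cmod (coord (x - S n) (i + n)))\<^sup>2)
        + (\<Sum>i<n. (cmod (coord (x - S n) i))\<^sup>2)"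
      unfolding norm_ell2_sq by (rule suminf_split_initial_segment[OF summable_coord_sq])
    then show ?thesis
      by (simp add: cS suminf_minus_initial_segment[OF summable_coord_sq])
  qed
  have "(\<lambda>n. (norm (x - S n))\<^sup>2) \<longlonglongrightarrow> (\<Sum>i. (cmod (coord x i))\<^sup>2) - (\<Sum>i. (cmod (coord x i))\<^sup>2)"
    unfolding eq by (intro tendsto_diff tendsto_const summable_LIMSEQ summable_coord_sq)
  from tendsto_real_sqrt[OF this] have "(\<lambda>n. norm (S n - x)) \<longlonglongrightarrow> 0"
    by (simp add: norm_minus_commute[of x])
  then show ?thesis unfolding S_def[symmetric] by (simp add: tendsto_norm_zero_iff LIM_zero_iff)
qed

text \<open>Linearity is over the reals only, which is why agreement is asked for on all complex
  multiples of the basis vectors.\<close>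

lemma bounded_linear_eq_on_unit_vecs:
  fixes f g :: "ell2 \<Rightarrow> 'a::real_normed_vector"
  assumes "bounded_linear f" "bounded_linear g"
    and eq: "\<And>c j. f (cmul c (unit_vec j)) = g (cmul c (unit_vec j))"
  shows "f x = g x"
proof -
  have "(\<lambda>n. f (\<Sum>j<n. cmul (coord x j) (unit_vec j))) \<longlonglongrightarrow> f x"
    "(\<lambda>n. g (\<Sum>j<n. cmul (coord x j) (unit_vec j))) \<longlonglongrightarrow> g x"
    by (rule bounded_linear.tendsto[OF assms(1) unit_vec_expansion],
        rule bounded_linear.tendsto[OF assms(2) unit_vec_expansion])
  moreover have "f (\<Sum>j<n. cmul (coord x j) (unit_vec j)) = g (\<Sum>j<n. cmul (coord x j) (unit_vec j))" for n
    using assms by (simp add: linear_sum[OF bounded_linear.linear] )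
  ultimately show ?thesis using LIMSEQ_unique by auto
qed

section \<open>Bounded complex-linear operators and their matrices\<close>

text \<open>Complex linearity is imposed on real bounded operators as commutation with every
  \<open>cmul c\<close>. The resulting closed subalgebra is a Banach algebra, so \<open>exp\<close>
  and its differential calculus apply to it directly.\<close>

typedef cop = "{T :: ell2 \<Rightarrow>\<^sub>L ell2. \<forall>c x. blinfun_apply T (cmul c x) = cmul c (blinfun_apply T x)}"
  morphisms blin Abs_cop
  by (rule exI[of _ 0]) simp

lifting_forget ell2.lifting
setup_lifting type_definition_cop

lift_definition app :: "cop \<Rightarrow> ell2 \<Rightarrow> ell2" is blinfun_apply .

lemma app_cmul [simp]: "app T (cmul c x) = cmul c (app T x)"
  by transfer simp

instantiation cop :: real_vector
begin

lift_definition zero_cop :: cop is 0 by simp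
lift_definition plus_cop :: "cop \<Rightarrow> cop \<Rightarrow> cop" is "(+)" by (simp add: blinfun.add_left)
lift_definition uminus_cop :: "cop \<Rightarrow> cop" is uminus
  by (simp add: blinfun.minus_left coord_inject_ext)
lift_definition minus_cop :: "cop \<Rightarrow> cop \<Rightarrow> cop" is "(-)" by (simp add: blinfun.diff_left)
lift_definition scaleR_cop :: "real \<Rightarrow> cop \<Rightarrow> cop" is scaleR by (simp add: blinfun.scaleR_left)

instance
  by standard (transfer; simp add: algebra_simps)+

end

instantiation cop :: real_normed_algebra_1
begin

lift_definition one_cop :: cop is id_blinfun by simp
lift_definition times_cop :: "cop \<Rightarrow> cop \<Rightarrow> cop" is blinfun_compose by simp
lift_definition norm_cop :: "cop \<Rightarrow> real" is norm .
definition sgn_cop :: "cop \<Rightarrow> cop" where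
  "sgn_cop T = inverse (norm T) *\<^sub>R T"
definition dist_cop :: "cop \<Rightarrow> cop \<Rightarrow> real" where
  "dist_cop S T = norm (S - T)"
definition uniformity_cop :: "(cop \<times> cop) filter" where
  "uniformity_cop = (INF e\<in>{0<..}. principal {(x, y). dist x y < e})"
definition open_cop :: "cop set \<Rightarrow> bool" where
  "open_cop U \<longleftrightarrow> (\<forall>x\<in>U. \<forall>\<^sub>F (x', y) in uniformity. x' = x \<longrightarrow> y \<in> U)"

instance
proof
  fix R S T :: cop and r :: real
  show "R * S * T = R * (S * T)" by transfer (rule blinfun_eqI, simp)
  show "(R + S) * T = R * T + S * T" by transfer (rule blinfun_eqI, simp add: blinfun.add_left)
  show "R * (S + T) = R * S + R * T"
    by transfer (rule blinfun_eqI, simp add: blinfun.add_left blinfun.add_right)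
  show "r *\<^sub>R S * T = r *\<^sub>R (S * T)" by transfer (rule blinfun_eqI, simp add: blinfun.scaleR_left)
  show "S * r *\<^sub>R T = r *\<^sub>R (S * T)"
    by transfer (rule blinfun_eqI, simp add: blinfun.scaleR_left blinfun.scaleR_right)
  show "1 * T = T" "T * 1 = T" by (transfer, rule blinfun_eqI, simp)+
  show "norm (S * T) \<le> norm S * norm T" by transfer (rule norm_blinfun_compose)
  show "norm (S + T) \<le> norm S + norm T" by transfer (rule norm_triangle_ineq)
  show "norm (r *\<^sub>R T) = \<bar>r\<bar> * norm T" by transfer simp
  show "(norm T = 0) = (T = 0)" by transfer simp
  show n1: "norm (1 :: cop) = 1"
  proof transfer
    have "norm (id_blinfun :: ell2 \<Rightarrow>\<^sub>L ell2) \<le> 1" by (rule norm_blinfun_bound) auto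
    moreover have "norm (unit_vec 0) \<le> norm (id_blinfun :: ell2 \<Rightarrow>\<^sub>L ell2) * norm (unit_vec 0)"
      using norm_blinfun[of id_blinfun "unit_vec 0"] by simp
    ultimately show "norm (id_blinfun :: ell2 \<Rightarrow>\<^sub>L ell2) = 1" by simp
  qed
  show "(0::cop) \<noteq> 1"
  proof
    assume "(0::cop) = 1"
    moreover have "norm (0::cop) = 0" by transfer simp
    ultimately show False using n1 by simp
  qed
qed (simp_all add: sgn_cop_def dist_cop_def uniformity_cop_def open_cop_def)

end

lemma app_simps [simp]:
  "app 0 x = 0" "app (S + T) x = app S x + app T x" "app (- T) x = - app T x"
  "app (S - T) x = app S x - app T x" "app (r *\<^sub>R T) x = r *\<^sub>R app T x"
  "app 1 x = x" "app (S * T) x = app S (app T x)"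
  by (transfer, simp add: blinfun.bilinear_simps)+

lemma app_right_simps [simp]:
  "app T 0 = 0" "app T (x + y) = app T x + app T y" "app T (- x) = - app T x"
  "app T (x - y) = app T x - app T y" "app T (r *\<^sub>R x) = r *\<^sub>R app T x"
  by (transfer, simp add: blinfun.bilinear_simps)+

lemma app_sum_right: "app T (\<Sum>k\<in>A. f k) = (\<Sum>k\<in>A. app T (f k))"
  by (induction A rule: infinite_finite_induct) auto

lemma app_sum_left: "app (\<Sum>k\<in>A. f k) x = (\<Sum>k\<in>A. app (f k) x)"
  by (induction A rule: infinite_finite_induct) auto

lemma norm_app_le: "norm (app T x) \<le> norm T * norm x"
  by transfer (rule norm_blinfun)

lemma norm_cop_le: "0 \<le> C \<Longrightarrow> (\<And>x. norm (app T x) \<le> C * norm x) \<Longrightarrow> norm T \<le> C"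
  by transfer (rule norm_blinfun_bound)

lemma cop_eqI: "(\<And>x. app S x = app T x) \<Longrightarrow> S = T"
  by transfer (rule blinfun_eqI)

lemma bounded_linear_app [simp]: "bounded_linear (app T)"
  by transfer (rule blinfun.bounded_linear_right)

lemma bounded_linear_app_left [simp]: "bounded_linear (\<lambda>T. app T x)"
  by (rule bounded_linear_intro[of _ "norm x"]) (auto simp: norm_app_le)

lemmas tendsto_app = bounded_linear.tendsto[OF bounded_linear_app]

instance cop :: banach
proof
  fix X :: "nat \<Rightarrow> cop"
  assume X: "Cauchy X"
  have "Cauchy (\<lambda>n. blin (X n))"
  proof (rule CauchyI)
    fix e :: real assume "0 < e"
    then obtain M where "\<forall>m\<ge>M. \<forall>n\<ge>M. norm (X m - X n) < e" using CauchyD[OF X, of e] by blast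
    then show "\<exists>M. \<forall>m\<ge>M. \<forall>n\<ge>M. norm (blin (X m) - blin (X n)) < e"
      unfolding norm_cop.rep_eq minus_cop.rep_eq by blast
  qed
  then obtain L where L: "(\<lambda>n. blin (X n)) \<longlonglongrightarrow> L"
    by (auto dest!: Cauchy_convergent simp: convergent_def)
  then have pointwise: "(\<lambda>n. app (X n) x) \<longlonglongrightarrow> blinfun_apply L x" for x
    unfolding app.rep_eq by (intro blinfun.tendsto tendsto_const)
  have "blinfun_apply L (cmul c x) = cmul c (blinfun_apply L x)" for c x
    using pointwise[of "cmul c x"] bounded_linear.tendsto[OF bounded_linear_cmul pointwise[of x], of c]
      LIMSEQ_unique by simp
  then have "blin (Abs_cop L) = L" by (simp add: Abs_cop_inverse)
  then have "(\<lambda>n. norm (X n - Abs_cop L)) = (\<lambda>n. norm (blin (X n) - L))"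
    by (simp add: norm_cop.rep_eq minus_cop.rep_eq)
  moreover have "(\<lambda>n. norm (blin (X n) - L)) \<longlonglongrightarrow> 0"
    using L by (intro tendsto_norm_zero LIM_zero)
  ultimately have "X \<longlonglongrightarrow> Abs_cop L"
    using LIM_zero_cancel tendsto_norm_zero_cancel by metis
  then show "convergent X" by (auto simp: convergent_def)
qed

section \<open>Correspondence between operators and bounded matrices\<close>

definition mat_of :: "cop \<Rightarrow> mat" where
  "mat_of T = (\<lambda>i j. coord (app T (unit_vec j)) i)"

lemma cop_eq_on_unit_vecs: "(\<And>j. app S (unit_vec j) = app T (unit_vec j)) \<Longrightarrow> S = T"
  by (rule cop_eqI, rule bounded_linear_eq_on_unit_vecs) auto

lemma mat_of_inject [simp]: "mat_of S = mat_of T \<longleftrightarrow> S = T"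
proof
  assume "mat_of S = mat_of T"
  then show "S = T"
    by (intro cop_eq_on_unit_vecs coord_inject_ext) (simp add: mat_of_def fun_eq_iff)
qed simp

lemma coord_app_sums: "(\<lambda>j. mat_of T i j * coord x j) sums coord (app T x) i"
proof -
  have "(\<lambda>n. coord (app T (\<Sum>j<n. cmul (coord x j) (unit_vec j))) i) \<longlonglongrightarrow> coord (app T x) i"
    by (rule tendsto_coord[OF tendsto_app[OF unit_vec_expansion]])
  then show ?thesis
    by (simp add: sums_def app_sum_right mat_of_def mult.commute)
qed

lemma mat_of_op_bound: "norm T \<le> C \<Longrightarrow> op_bound (mat_of T) C"
  unfolding op_bound_def
proof (intro allI impI)
  fix S U :: "nat set" and x :: "nat \<Rightarrow> complex"
  assume fin: "finite S" "finite U" and C: "norm T \<le> C"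
  define v where "v = (\<Sum>j\<in>S. cmul (x j) (unit_vec j))"
  have cv: "coord v i = (if i \<in> S then x i else 0)" for i
    using fin by (simp add: v_def if_distrib[of "(*) _"] cong: if_cong)
  have "(\<lambda>i. (cmod (coord v i))\<^sup>2) sums (\<Sum>i\<in>S. (cmod (coord v i))\<^sup>2)"
    using fin by (intro sums_finite) (auto simp: cv)
  then have nv: "(norm v)\<^sup>2 = (\<Sum>j\<in>S. (cmod (x j))\<^sup>2)"
    by (simp add: norm_ell2_sq sums_iff cv)
  have "coord (app T v) i = (\<Sum>j\<in>S. mat_of T i j * x j)" for i
    by (simp add: v_def app_sum_right mat_of_def mult.commute)
  then have "(\<Sum>i\<in>U. (cmod (\<Sum>j\<in>S. mat_of T i j * x j))\<^sup>2) \<le> (norm (app T v))\<^sup>2"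
    using sum_coord_sq_le[OF fin(2), of "app T v"] by simp
  also have "\<dots> \<le> (norm T * norm v)\<^sup>2" by (simp add: norm_app_le power_mono)
  also have "\<dots> \<le> (C * norm v)\<^sup>2"
    using C by (intro power_mono mult_right_mono) auto
  finally show "(\<Sum>i\<in>U. (cmod (\<Sum>j\<in>S. mat_of T i j * x j))\<^sup>2) \<le> C\<^sup>2 * (\<Sum>j\<in>S. (cmod (x j))\<^sup>2)"
    by (simp add: power_mult_distrib nv)
qed

lemma op_boundD:
  "op_bound A C \<Longrightarrow> finite S \<Longrightarrow> finite T \<Longrightarrow>
    (\<Sum>i\<in>T. (cmod (\<Sum>j\<in>S. A i j * x j))\<^sup>2) \<le> C\<^sup>2 * (\<Sum>j\<in>S. (cmod (x j))\<^sup>2)"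
  by (simp add: op_bound_def)

text \<open>Testing the bound on the conjugate of the truncated row gives
  \<open>r\<^sup>2 \<le> C\<^sup>2 * r\<close> for each partial sum \<open>r\<close>, and
  \<open>r\<close> cancels.\<close>

lemma op_bound_row:
  assumes "op_bound A C"
  shows "summable (\<lambda>j. (cmod (A i j))\<^sup>2)"
proof (rule summableI_nonneg_bounded)
  fix n
  define r where "r = (\<Sum>j<n. (cmod (A i j))\<^sup>2)"
  have "(cmod (\<Sum>j<n. A i j * cnj (A i j)))\<^sup>2 \<le> C\<^sup>2 * r"
    using op_boundD[OF assms, of "{..<n}" "{i}" "\<lambda>j. cnj (A i j)"] by (simp add: r_def)
  moreover have "(\<Sum>j<n. A i j * cnj (A i j)) = of_real r"
    by (simp add: r_def complex_norm_square[symmetric])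
  ultimately have "r\<^sup>2 \<le> C\<^sup>2 * r" by (simp only: norm_of_real power2_abs)
  then have "r * r \<le> C\<^sup>2 * r" by (simp add: power2_eq_square)
  moreover have "0 \<le> r" unfolding r_def by (intro sum_nonneg) auto
  ultimately show "(\<Sum>j<n. (cmod (A i j))\<^sup>2) \<le> C\<^sup>2"
    unfolding r_def[symmetric] by (cases "r = 0") auto
qed simp

text \<open>Square summable rows make the series for each coordinate of the image converge; the
  bound, known for finite sections only, then passes to the limit.\<close>

lemma op_bound_imp_mat_of:
  assumes A: "op_bound A C" and C: "0 \<le> C"
  obtains T where "A = mat_of T" and "norm T \<le> C"
proof -
  define f where "f x = (\<lambda>i. \<Sum>j. A i j * coord x j)" for x
  have sm: "summable (\<lambda>j. A i j * coord x j)" for i x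
  proof (rule summable_norm_cancel)
    show "summable (\<lambda>j. cmod (A i j * coord x j))"
      using summable_abs_mult_ell2[OF op_bound_row[OF A] summable_coord_sq, of i x]
      by (simp add: norm_mult)
  qed
  have bd: "(\<Sum>i<m. (cmod (f x i))\<^sup>2) \<le> (C * norm x)\<^sup>2" for m x
  proof (rule LIMSEQ_le_const2)
    show "(\<lambda>n. \<Sum>i<m. (cmod (\<Sum>j<n. A i j * coord x j))\<^sup>2) \<longlonglongrightarrow> (\<Sum>i<m. (cmod (f x i))\<^sup>2)"
      unfolding f_def by (intro tendsto_intros summable_LIMSEQ sm)
    have "(\<Sum>i<m. (cmod (\<Sum>j<n. A i j * coord x j))\<^sup>2) \<le> (C * norm x)\<^sup>2" for n
    proof -
      have "(\<Sum>i<m. (cmod (\<Sum>j<n. A i j * coord x j))\<^sup>2) \<le> C\<^sup>2 * (\<Sum>j<n. (cmod (coord x j))\<^sup>2)"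
        by (rule op_boundD[OF A]) auto
      also have "\<dots> \<le> C\<^sup>2 * (norm x)\<^sup>2" by (intro mult_left_mono sum_coord_sq_le) auto
      finally show ?thesis by (simp add: power_mult_distrib)
    qed
    then show "\<exists>N. \<forall>n\<ge>N. (\<Sum>i<m. (cmod (\<Sum>j<n. A i j * coord x j))\<^sup>2) \<le> (C * norm x)\<^sup>2" by blast
  qed
  define g where "g x = Abs_ell2 (f x)" for x
  have cg: "coord (g x) i = f x i" and ng: "norm (g x) \<le> C * norm x" for x i
    unfolding g_def using Abs_ell2_bounded[of "C * norm x" "f x"] bd C by auto
  have "g (x + y) = g x + g y" for x y
    by (rule coord_inject_ext) (simp add: cg f_def suminf_add[OF sm sm] algebra_simps)
  moreover have cl: "g (cmul c x) = cmul c (g x)" for c x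
    by (rule coord_inject_ext) (simp add: cg f_def suminf_mult[OF sm, symmetric] algebra_simps)
  ultimately have "bounded_linear g"
    using cl[of "of_real r" for r] ng by (intro bounded_linear_intro[of _ C]) (auto simp: mult.commute)
  then have bg: "blinfun_apply (Blinfun g) = g" by (simp add: bounded_linear_Blinfun_apply)
  then have ag: "app (Abs_cop (Blinfun g)) = g"
    by (simp add: app.rep_eq Abs_cop_inverse cl)
  have "A i j = f (unit_vec j) i" for i j
  proof -
    have "(\<lambda>k. A i k * coord (unit_vec j) k) sums (\<Sum>k\<in>{j}. A i k * coord (unit_vec j) k)"
      by (rule sums_finite) auto
    then show ?thesis by (simp add: f_def sums_iff)
  qed
  then have "A = mat_of (Abs_cop (Blinfun g))"
    by (simp add: mat_of_def ag cg fun_eq_iff)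
  moreover have "norm (Abs_cop (Blinfun g)) \<le> C"
    using C ng by (intro norm_cop_le) (auto simp: ag)
  ultimately show thesis using that by blast
qed

lemma op_bound_mat_of_iff: "0 \<le> C \<Longrightarrow> op_bound (mat_of T) C \<longleftrightarrow> norm T \<le> C"
  using mat_of_op_bound op_bound_imp_mat_of mat_of_inject by metis

lemma opnorm_mat_of [simp]: "opnorm (mat_of T) = norm T"
proof -
  have "{C. 0 \<le> C \<and> op_bound (mat_of T) C} = {norm T..}"
    using op_bound_mat_of_iff[of _ T] order_trans[OF norm_ge_zero[of T]] by auto
  then show ?thesis by (simp add: opnorm_def)
qed

lemma bounded_op_iff: "bounded_op A \<longleftrightarrow> (\<exists>T. A = mat_of T)"
proof
  assume "bounded_op A"
  then obtain C where "op_bound A C" by (auto simp: bounded_op_def)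
  then have "op_bound A \<bar>C\<bar>" by (simp add: op_bound_def)
  then show "\<exists>T. A = mat_of T" using op_bound_imp_mat_of by (metis abs_ge_zero)
qed (auto simp: bounded_op_def intro: mat_of_op_bound)

lemma bounded_op_mat_of [simp]: "bounded_op (mat_of T)"
  by (auto simp: bounded_op_iff)

lemma mat_mult_mat_of [simp]: "mat_mult (mat_of S) (mat_of T) = mat_of (S * T)"
proof (intro ext)
  fix i j
  show "mat_mult (mat_of S) (mat_of T) i j = mat_of (S * T) i j"
    using sums_unique[OF coord_app_sums[of S i "app T (unit_vec j)"]]
    by (simp add: mat_mult_def mat_of_def)
qed

lemma mat_of_add [simp]: "mat_of S + mat_of T = mat_of (S + T)"
  and mat_of_diff [simp]: "mat_of S - mat_of T = mat_of (S - T)"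
  and mat_of_minus [simp]: "- mat_of T = mat_of (- T)"
  and mat_of_zero: "0 = mat_of 0"
  and mat_of_one: "mat_id = mat_of 1"
  by (auto simp: mat_of_def fun_eq_iff mat_id_def)

lift_definition scal :: "complex \<Rightarrow> cop" is "\<lambda>c. Blinfun (cmul c)"
  by (simp add: bounded_linear_Blinfun_apply mult.commute)

lemma app_scal [simp]: "app (scal c) x = cmul c x"
  by transfer (simp add: bounded_linear_Blinfun_apply)

lemma scal_algebra [simp]: "scal (of_real r) = r *\<^sub>R 1" "scal 1 = 1" "scal c * scal d = scal (c * d)"
  by (rule cop_eqI, simp add: mult.commute)+

lemma scal_commute: "T * scal c = scal c * T"
  by (rule cop_eqI) simp

lemma scal_commute_left: "T * (scal c * S) = scal c * (T * S)"
  by (rule cop_eqI) simp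

lemma msmult_mat_of [simp]: "msmult c (mat_of T) = mat_of (scal c * T)"
  by (simp add: msmult_def mat_of_def fun_eq_iff)

lemma norm_scal [simp]: "norm (scal c * T) = cmod c * norm T"
proof (rule antisym)
  show "norm (scal c * T) \<le> cmod c * norm T"
    by (rule norm_cop_le) (auto simp: mult.assoc intro!: mult_left_mono norm_app_le)
  show "cmod c * norm T \<le> norm (scal c * T)"
  proof (cases "c = 0")
    case False
    have "norm (app T x) \<le> norm (scal c * T) / cmod c * norm x" for x
      using norm_app_le[of "scal c * T" x] False by (simp add: field_simps)
    then have "norm T \<le> norm (scal c * T) / cmod c" by (intro norm_cop_le) auto
    then show ?thesis using False by (simp add: field_simps)
  qed simp
qed

section \<open>Adjoints\<close>

lemma op_bound_adj:
  assumes "op_bound A C" shows "op_bound (mat_adj A) C"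
  unfolding op_bound_def
proof (intro allI impI)
  fix S U :: "nat set" and x :: "nat \<Rightarrow> complex"
  assume fin: "finite S" "finite U"
  \<comment> \<open>The squared norm \<open>Y\<close> of \<open>y\<close> is the pairing of
    \<open>z\<close> with \<open>x\<close>. Cauchy-Schwarz and the bound for \<open>A\<close>
    applied to \<open>y\<close> yield \<open>Y * Y \<le> C\<^sup>2 * Y\<close> times the squared
    norm of \<open>x\<close>, and \<open>Y\<close> cancels.\<close>
  define y where "y i = (\<Sum>j\<in>S. mat_adj A i j * x j)" for i
  define z where "z j = (\<Sum>i\<in>U. A j i * y i)" for j
  define Y where "Y = (\<Sum>i\<in>U. (cmod (y i))\<^sup>2)"
  have Y0: "0 \<le> Y" unfolding Y_def by (intro sum_nonneg) auto
  have "complex_of_real Y = (\<Sum>i\<in>U. y i * cnj (y i))"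
    by (simp add: Y_def flip: complex_norm_square)
  also have "\<dots> = (\<Sum>i\<in>U. \<Sum>j\<in>S. cnj (y i) * (cnj (A j i) * x j))"
    by (subst mult.commute) (simp add: y_def[of i for i] sum_distrib_left mat_adj_def)
  also have "\<dots> = (\<Sum>j\<in>S. \<Sum>i\<in>U. cnj (y i) * (cnj (A j i) * x j))" by (rule sum.swap)
  also have "\<dots> = (\<Sum>j\<in>S. cnj (z j) * x j)"
    by (simp add: z_def sum_distrib_left sum_distrib_right mult_ac)
  finally have "Y = cmod (\<Sum>j\<in>S. cnj (z j) * x j)"
    using Y0 by (metis norm_of_real abs_of_nonneg)
  also have "\<dots> \<le> (\<Sum>j\<in>S. \<bar>cmod (z j)\<bar> * \<bar>cmod (x j)\<bar>)"
    by (rule order_trans[OF norm_sum]) (simp add: norm_mult)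
  also have "\<dots> \<le> L2_set (\<lambda>j. cmod (z j)) S * L2_set (\<lambda>j. cmod (x j)) S"
    by (rule L2_set_mult_ineq)
  finally have "Y\<^sup>2 \<le> (L2_set (\<lambda>j. cmod (z j)) S * L2_set (\<lambda>j. cmod (x j)) S)\<^sup>2"
    using Y0 by (intro power_mono)
  also have "\<dots> = (\<Sum>j\<in>S. (cmod (z j))\<^sup>2) * (\<Sum>j\<in>S. (cmod (x j))\<^sup>2)"
    by (simp add: power_mult_distrib L2_set_def sum_nonneg)
  also have "\<dots> \<le> (C\<^sup>2 * Y) * (\<Sum>j\<in>S. (cmod (x j))\<^sup>2)"
    unfolding z_def Y_def using fin
    by (intro mult_right_mono op_boundD[OF assms]) (auto intro: sum_nonneg)
  finally have "Y * Y \<le> (C\<^sup>2 * (\<Sum>j\<in>S. (cmod (x j))\<^sup>2)) * Y"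
    by (simp add: power2_eq_square mult_ac)
  then have "Y \<le> C\<^sup>2 * (\<Sum>j\<in>S. (cmod (x j))\<^sup>2)"
    using Y0 by (cases "Y = 0") (auto intro!: mult_nonneg_nonneg sum_nonneg)
  then show "(\<Sum>i\<in>U. (cmod (\<Sum>j\<in>S. mat_adj A i j * x j))\<^sup>2) \<le> C\<^sup>2 * (\<Sum>j\<in>S. (cmod (x j))\<^sup>2)"
    by (simp add: Y_def y_def)
qed

definition adj :: "cop \<Rightarrow> cop" where
  "adj T = (THE S. mat_of S = mat_adj (mat_of T))"

lemma mat_of_adj: "mat_of (adj T) = mat_adj (mat_of T)"
proof -
  obtain S where S: "mat_of S = mat_adj (mat_of T)"
    using op_bound_imp_mat_of[OF op_bound_adj[OF mat_of_op_bound[OF order_refl, of T]]] by (metis norm_ge_zero)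
  then have "adj T = S" unfolding adj_def by (intro the_equality) (simp_all flip: S)
  with S show ?thesis by simp
qed

lemma mat_adj_mat_of [simp]: "mat_adj (mat_of T) = mat_of (adj T)"
  by (simp add: mat_of_adj)

lemma inner_app_adj: "app T x \<bullet> y = x \<bullet> app (adj T) y"
proof -
  have blL: "bounded_linear (\<lambda>u. app T u \<bullet> y)" "bounded_linear (\<lambda>u. u \<bullet> z)" for y z
    using bounded_linear_compose[OF bounded_linear_inner_left bounded_linear_app]
      bounded_linear_inner_left by auto
  have blR: "bounded_linear (\<lambda>u. z \<bullet> u)" "bounded_linear (\<lambda>u. z \<bullet> app S u)" for z S
    using bounded_linear_compose[OF bounded_linear_inner_right bounded_linear_app]
      bounded_linear_inner_right by auto
  have base: "app T (cmul c (unit_vec j)) \<bullet> cmul d (unit_vec i) =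
      cmul c (unit_vec j) \<bullet> app (adj T) (cmul d (unit_vec i))" for c d i j
  proof -
    have "coord (app (adj T) (unit_vec i)) j = cnj (coord (app T (unit_vec j)) i)"
      using mat_of_adj[of T] by (simp add: mat_of_def mat_adj_def fun_eq_iff)
    then show ?thesis
      by (subst inner_commute) (simp add: inner_cmul_left inner_unit_vec algebra_simps)
  qed
  have "app T x \<bullet> cmul d (unit_vec i) = x \<bullet> app (adj T) (cmul d (unit_vec i))" for d i
    by (rule bounded_linear_eq_on_unit_vecs[OF blL base])
  then show ?thesis
    by (rule bounded_linear_eq_on_unit_vecs[OF blR])
qed

lemma inner_adj_app: "app (adj T) x \<bullet> y = x \<bullet> app T y"
  using inner_app_adj[of T y x] by (simp add: inner_commute)

lemma adj_unique: "(\<And>x y. app T x \<bullet> y = x \<bullet> app S y) \<Longrightarrow> adj T = S"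
proof (rule cop_eqI)
  fix y assume "\<And>x y. app T x \<bullet> y = x \<bullet> app S y"
  then have "x \<bullet> (app (adj T) y - app S y) = 0" for x
    by (simp add: inner_app_adj inner_diff_right)
  then show "app (adj T) y = app S y" by (metis inner_eq_zero_iff eq_iff_diff_eq_0)
qed

lemma adj_adj [simp]: "adj (adj T) = T"
  by (rule adj_unique) (simp add: inner_adj_app)

lemma adj_simps [simp]:
  "adj (S * T) = adj T * adj S" "adj (S + T) = adj S + adj T"
  "adj (S - T) = adj S - adj T" "adj (- T) = - adj T" "adj (r *\<^sub>R T) = r *\<^sub>R adj T"
  "adj 1 = 1" "adj 0 = 0" "adj (scal c) = scal (cnj c)"
  by (rule adj_unique, simp add: inner_app_adj inner_adj_app inner_cmul_left
      inner_add_left inner_add_right inner_diff_left inner_diff_right)+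

lemma norm_adj [simp]: "norm (adj T) = norm T"
proof -
  have "norm (adj T) \<le> norm T" for T
    using op_bound_adj[OF mat_of_op_bound[OF order_refl, of T]] by (simp add: op_bound_mat_of_iff)
  from this[of T] this[of "adj T"] show ?thesis by simp
qed

lemma anti_herm_mat_of [simp]: "anti_herm (mat_of T) \<longleftrightarrow> adj T = - T"
  by (simp add: anti_herm_def)

lemma mat_pow_mat_of [simp]: "mat_pow (mat_of T) n = mat_of (T ^ n)"
  by (induction n) (simp_all add: mat_of_one)

lemma mat_exp_mat_of [simp]: "mat_exp (mat_of T) = mat_of (exp T)"
proof -
  have "(\<lambda>n. coord (app (T ^ n /\<^sub>R fact n) (unit_vec j)) i) sums coord (app (exp T) (unit_vec j)) i" for i j
    by (rule bounded_linear.sums[OF bounded_linear_coord])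
       (rule bounded_linear.sums[OF bounded_linear_app_left exp_converges])
  then show ?thesis
    unfolding mat_exp_def mat_pow_mat_of
    by (simp add: mat_of_def fun_eq_iff sums_iff divide_simps)
qed

section \<open>Diagonal and compact operators\<close>

lemma coord_app_diag:
  assumes "is_diag (mat_of T)"
  shows "coord (app T x) i = mat_of T i i * coord x i"
proof -
  have "(\<lambda>j. mat_of T i j * coord x j) sums (\<Sum>j\<in>{i}. mat_of T i j * coord x j)"
    using assms by (intro sums_finite) (auto simp: is_diag_def)
  then show ?thesis using coord_app_sums[of T i x] sums_unique2 by fastforce
qed

lemma diag_commute:
  assumes "is_diag (mat_of S)" "is_diag (mat_of T)" shows "S * T = T * S"
  using assms by (intro cop_eqI coord_inject_ext) (simp add: coord_app_diag)

text \<open>Meaningful for bounded \<open>d\<close> only; every fact about it therefore carries a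
  bound \<open>C\<close>.\<close>

definition diag_op :: "(nat \<Rightarrow> complex) \<Rightarrow> cop" where
  "diag_op d = (THE T. mat_of T = (\<lambda>i j. if i = j then d i else 0))"

lemma diag_op_bounded:
  assumes C: "\<And>i. cmod (d i) \<le> C"
  shows mat_of_diag_op: "mat_of (diag_op d) = (\<lambda>i j. if i = j then d i else 0)"
    and norm_diag_op_le: "norm (diag_op d) \<le> C"
    and coord_diag_op: "coord (app (diag_op d) x) i = d i * coord x i"
proof -
  have C0: "0 \<le> C" using order_trans[OF norm_ge_zero C] .
  have "op_bound (\<lambda>i j. if i = j then d i else 0) C"
    unfolding op_bound_def
  proof (intro allI impI)
    fix S T :: "nat set" and x :: "nat \<Rightarrow> complex"
    assume fin: "finite S" "finite T"
    have "(\<Sum>i\<in>T. (cmod (\<Sum>j\<in>S. (if i = j then d i else 0) * x j))\<^sup>2)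
        = (\<Sum>i\<in>T. if i \<in> S then (cmod (d i * x i))\<^sup>2 else 0)"
      using fin by (intro sum.cong) (auto simp: if_distrib[of "\<lambda>y. y * _"] cong: if_cong)
    also have "\<dots> = (\<Sum>i\<in>T \<inter> S. (cmod (d i * x i))\<^sup>2)"
      using fin by (simp add: sum.inter_restrict)
    also have "\<dots> \<le> (\<Sum>i\<in>T \<inter> S. C\<^sup>2 * (cmod (x i))\<^sup>2)"
      using C C0 by (intro sum_mono) (auto simp: norm_mult power_mult_distrib intro!: mult_right_mono power_mono)
    also have "\<dots> \<le> (\<Sum>i\<in>S. C\<^sup>2 * (cmod (x i))\<^sup>2)"
      using fin by (intro sum_mono2) auto
    finally show "(\<Sum>i\<in>T. (cmod (\<Sum>j\<in>S. (if i = j then d i else 0) * x j))\<^sup>2)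
        \<le> C\<^sup>2 * (\<Sum>j\<in>S. (cmod (x j))\<^sup>2)"
      by (simp add: sum_distrib_left)
  qed
  then obtain T where T': "(\<lambda>i j. if i = j then d i else 0) = mat_of T" "norm T \<le> C"
    by (rule op_bound_imp_mat_of[OF _ C0])
  note T = T'(1)[symmetric] T'(2)
  then have "diag_op d = T"
    unfolding diag_op_def by (intro the_equality) (simp_all flip: T(1))
  with T show 1: "mat_of (diag_op d) = (\<lambda>i j. if i = j then d i else 0)" and "norm (diag_op d) \<le> C"
    by auto
  have "is_diag (mat_of (diag_op d))" by (simp add: 1 is_diag_def)
  from coord_app_diag[OF this] show "coord (app (diag_op d) x) i = d i * coord x i"
    by (simp add: 1)
qed

lemma is_diag_diag_op: "(\<And>i. cmod (d i) \<le> C) \<Longrightarrow> is_diag (mat_of (diag_op d))"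
  using mat_of_diag_op[of d C] by (simp add: is_diag_def)

lemma adj_diag_op:
  assumes C: "\<And>i. cmod (d i) \<le> C"
  shows "adj (diag_op d) = diag_op (\<lambda>i. cnj (d i))"
proof -
  have "mat_of (adj (diag_op d)) = mat_of (diag_op (\<lambda>i. cnj (d i)))"
    using mat_of_diag_op[of d C] mat_of_diag_op[of "\<lambda>i. cnj (d i)" C] C
    by (auto simp: mat_of_adj mat_adj_def fun_eq_iff)
  then show ?thesis by simp
qed

section \<open>Coordinate truncations and coordinate projections\<close>

definition trunc :: "nat \<Rightarrow> cop" where
  "trunc n = diag_op (\<lambda>i. if i < n then 1 else 0)"

definition proj :: "nat \<Rightarrow> cop" where
  "proj k = diag_op (\<lambda>i. if i = k then 1 else 0)"

lemma coord_trunc [simp]: "coord (app (trunc n) x) i = (if i < n then coord x i else 0)"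
  unfolding trunc_def by (subst coord_diag_op[of _ 1]) auto

lemma coord_proj [simp]: "coord (app (proj k) x) i = (if i = k then coord x i else 0)"
  unfolding proj_def by (subst coord_diag_op[of _ 1]) auto

lemma norm_trunc_le: "norm (trunc n) \<le> 1"
  unfolding trunc_def by (rule norm_diag_op_le) auto

lemma norm_trunc_mult_le: "norm (trunc n * T) \<le> norm T"
  using norm_mult_ineq[of "trunc n" T] mult_right_mono[OF norm_trunc_le[of n] norm_ge_zero[of T]] by linarith

lemma norm_mult_trunc_le: "norm (T * trunc n) \<le> norm T"
  using norm_mult_ineq[of T "trunc n"] mult_left_mono[OF norm_trunc_le[of n] norm_ge_zero[of T]] by linarith

lemma is_diag_trunc: "is_diag (mat_of (trunc n))" and is_diag_proj: "is_diag (mat_of (proj n))"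
  unfolding trunc_def proj_def by (rule is_diag_diag_op[where C = 1]; simp)+

lemma adj_trunc [simp]: "adj (trunc n) = trunc n" and adj_proj [simp]: "adj (proj k) = proj k"
  unfolding trunc_def proj_def by (subst adj_diag_op[where C = 1]; simp add: if_distrib cong: if_cong)+

lemma proj_proj: "proj i * proj j = (if i = j then proj i else 0)"
  by (intro cop_eqI coord_inject_ext) auto

text \<open>Turns diagonality into commutation relations, which pass to differences, products and
  exponentials.\<close>

lemma is_diag_iff_commute_proj: "is_diag (mat_of T) \<longleftrightarrow> (\<forall>k. T * proj k = proj k * T)"
proof
  assume "\<forall>k. T * proj k = proj k * T"
  then have "coord (app (T * proj k) (unit_vec j)) i = coord (app (proj k * T) (unit_vec j)) i" for i j k
    by simp
  moreover have "app (proj j) (unit_vec j) = unit_vec j" for j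
    by (rule coord_inject_ext) auto
  ultimately have "coord (app T (unit_vec j)) i = coord (app (proj j * T) (unit_vec j)) i" for i j
    by (metis app_simps(7))
  then have "coord (app T (unit_vec j)) i = 0" if "i \<noteq> j" for i j
    using that by (metis app_simps(7) coord_proj)
  then show "is_diag (mat_of T)" by (simp add: is_diag_def mat_of_def)
qed (auto intro: diag_commute is_diag_proj)

lemma is_diag_simps:
  assumes "is_diag (mat_of S)" "is_diag (mat_of T)"
  shows is_diag_diff: "is_diag (mat_of (S - T))"
    and is_diag_mult: "is_diag (mat_of (S * T))"
  using assms unfolding is_diag_iff_commute_proj
  by (auto simp: algebra_simps) (metis mult.assoc)

lemma is_diag_scaleR: "is_diag (mat_of T) \<Longrightarrow> is_diag (mat_of (r *\<^sub>R T))"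
  by (auto simp: is_diag_iff_commute_proj)

text \<open>Compactness as norm convergence of the truncations from the left. Stability under right
  multiplication is then immediate, while left multiplication is controlled only for diagonal
  factors, which commute with \<open>trunc n\<close>.\<close>

definition cpt :: "cop \<Rightarrow> bool" where
  "cpt T \<longleftrightarrow> (\<lambda>n. trunc n * T) \<longlonglongrightarrow> T"

lemma cpt_simps:
  "cpt 0" "cpt S \<Longrightarrow> cpt T \<Longrightarrow> cpt (S + T)" "cpt S \<Longrightarrow> cpt T \<Longrightarrow> cpt (S - T)"
  "cpt T \<Longrightarrow> cpt (r *\<^sub>R T)" "cpt T \<Longrightarrow> cpt (T * S)"
  unfolding cpt_def
  by (simp_all add: distrib_left right_diff_distrib tendsto_add tendsto_diff tendsto_scaleR
      tendsto_mult mult.assoc[symmetric])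

lemma cpt_diag_mult:
  assumes "is_diag (mat_of D)" "cpt T" shows "cpt (D * T)"
proof -
  have "trunc n * (D * T) = D * (trunc n * T)" for n
    using diag_commute[OF assms(1) is_diag_trunc, of n] by (simp add: mult.assoc[symmetric])
  then show ?thesis using assms(2) unfolding cpt_def by (auto intro: tendsto_mult)
qed

lemma cpt_limit:
  assumes T: "\<And>m. cpt (T m)" and lim: "T \<longlonglongrightarrow> L" shows "cpt L"
  unfolding cpt_def
proof (rule LIMSEQ_I)
  fix r :: real assume r: "0 < r"
  obtain m where m: "norm (T m - L) < r / 3"
    using LIMSEQ_D[OF lim, of "r / 3"] r by auto
  obtain N where N: "\<forall>n\<ge>N. norm (trunc n * T m - T m) < r / 3"
    using LIMSEQ_D[OF T[of m, unfolded cpt_def], of "r / 3"] r by auto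
  have "norm (trunc n * L - L) < r" if "n \<ge> N" for n
  proof -
    have "trunc n * L - L = (trunc n * T m - T m) - trunc n * (T m - L) + (T m - L)"
      by (simp add: algebra_simps)
    also have "norm \<dots> \<le> norm (trunc n * T m - T m) + norm (trunc n * (T m - L)) + norm (T m - L)"
      by (intro order_trans[OF norm_triangle_ineq] add_right_mono norm_triangle_ineq4)
    also have "\<dots> < r" using m N that norm_trunc_mult_le[of n "T m - L"] by force
    finally show ?thesis .
  qed
  then show "\<exists>N. \<forall>n\<ge>N. norm (trunc n * L - L) < r" by blast
qed

lemma cpt_trunc_mult: "cpt (trunc n * T)"
  unfolding cpt_def
proof (rule tendsto_eventually, rule eventually_sequentiallyI[of n])
  fix m assume "n \<le> m"
  then show "trunc m * (trunc n * T) = trunc n * T"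
    by (intro cop_eqI coord_inject_ext) auto
qed

lemma app_trunc_tendsto: "(\<lambda>n. app (trunc n) x) \<longlonglongrightarrow> x"
proof -
  have "app (trunc n) x = (\<Sum>j<n. cmul (coord x j) (unit_vec j))" for n
    by (rule coord_inject_ext) (simp add: if_distrib[of "(*) _"] cong: if_cong)
  then show ?thesis using unit_vec_expansion[of x] by simp
qed

text \<open>Rank one operators built from a coordinate functional; they split off one dimension at a
  time from an operator of finite rank.\<close>

lemma cpt_column_op:
  "\<exists>T. cpt T \<and> (\<forall>x. app T x = cmul (coord x i) g)"
proof -
  have bl: "bounded_linear (\<lambda>x. cmul (coord x i) g)"
  proof (rule bounded_linear_intro)
    fix x y :: ell2 and r :: real
    show "cmul (coord (x + y) i) g = cmul (coord x i) g + cmul (coord y i) g"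
      by (simp add: cmul_add_left)
    show "cmul (coord (r *\<^sub>R x) i) g = r *\<^sub>R cmul (coord x i) g"
      by (rule coord_inject_ext) simp
    show "norm (cmul (coord x i) g) \<le> norm x * norm g"
      by (simp add: mult_right_mono cmod_coord_le)
  qed
  define T where "T = Abs_cop (Blinfun (\<lambda>x. cmul (coord x i) g))"
  have T: "app T x = cmul (coord x i) g" for x
    unfolding T_def app.rep_eq using bl
    by (subst Abs_cop_inverse) (auto simp: bounded_linear_Blinfun_apply)
  have le: "norm (trunc n * T - T) \<le> norm (app (trunc n) g - g)" for n
  proof (rule norm_cop_le)
    fix x
    have "app (trunc n * T - T) x = cmul (coord x i) (app (trunc n) g - g)" by (simp add: T)
    then show "norm (app (trunc n * T - T) x) \<le> norm (app (trunc n) g - g) * norm x"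
      by (simp only: norm_cmul mult.commute[of _ "norm x"]) (intro mult_right_mono cmod_coord_le norm_ge_zero)
  qed simp
  have "(\<lambda>n. norm (app (trunc n) g - g)) \<longlonglongrightarrow> 0"
    by (intro tendsto_norm_zero LIM_zero app_trunc_tendsto)
  then have "(\<lambda>n. trunc n * T - T) \<longlonglongrightarrow> 0"
    by (rule Lim_null_comparison[OF always_eventually[OF allI[OF le]]])
  then have "cpt T" unfolding cpt_def by (rule LIM_zero_cancel)
  with T show ?thesis by blast
qed

text \<open>The spanning functions need not be square summable, so they cannot be used as vectors.
  Instead a nonzero column \<open>g\<close> of \<open>T\<close>, which is a genuine vector, spans
  the range of a rank one idempotent \<open>R\<close>; then \<open>R * T\<close> is compact and the
  columns of \<open>T - R * T\<close> need one spanning function fewer.\<close>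

lemma finite_column_span_imp_cpt:
  fixes f :: "'a \<Rightarrow> nat \<Rightarrow> complex"
  assumes "finite A"
    and "\<And>j. \<exists>c. \<forall>i. coord (app T (unit_vec j)) i = (\<Sum>a\<in>A. c a * f a i)"
  shows "cpt T"
  using assms
proof (induction "card A" arbitrary: A f T)
  case 0
  then have "app T (unit_vec j) = app 0 (unit_vec j)" for j
    by (intro coord_inject_ext) auto
  then have "T = 0" by (rule cop_eq_on_unit_vecs)
  then show ?case by (simp add: cpt_simps)
next
  case (Suc n)
  note span = Suc.prems(2)
  show ?case
  proof (cases "T = 0")
    case False
    then obtain j0 where "app T (unit_vec j0) \<noteq> 0"
      using cop_eq_on_unit_vecs[of T 0] by auto
    define g where "g = app T (unit_vec j0)"
    then obtain i0 where i0: "coord g i0 \<noteq> 0"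
      using \<open>app T (unit_vec j0) \<noteq> 0\<close> coord_inject_ext[of g 0] by auto
    obtain c0 where c0: "\<And>i. coord g i = (\<Sum>a\<in>A. c0 a * f a i)"
      using span[of j0] g_def by auto
    have "\<exists>a\<in>A. c0 a \<noteq> 0"
    proof (rule ccontr)
      assume "\<not> (\<exists>a\<in>A. c0 a \<noteq> 0)"
      then have "coord g i0 = 0" by (simp add: c0)
      with i0 show False by simp
    qed
    then obtain a0 where a0: "a0 \<in> A" "c0 a0 \<noteq> 0" by blast
    obtain R where R: "cpt R" "\<And>x. app R x = cmul (coord x i0) (cmul (1 / coord g i0) g)"
      using cpt_column_op[of i0 "cmul (1 / coord g i0) g"] by auto
    \<comment> \<open>Formally \<open>1 - R\<close> applied to \<open>f a\<close>: it removes the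
      coordinate \<open>i0\<close> by subtracting a multiple of \<open>g\<close>.\<close>
    define f' where "f' a i = f a i - f a i0 / coord g i0 * coord g i" for a i
    have "cpt (T - R * T)"
    proof (rule Suc.hyps(1)[of "A - {a0}" _ f'])
      show "n = card (A - {a0})" using Suc.hyps(2) a0 Suc.prems(1) by simp
      show "finite (A - {a0})" using Suc.prems(1) by simp
      fix j
      obtain c where c: "\<And>i. coord (app T (unit_vec j)) i = (\<Sum>a\<in>A. c a * f a i)"
        using span[of j] by auto
      \<comment> \<open>Subtracting this multiple of the expansion of \<open>g\<close> cancels the
        coefficient at \<open>a0\<close>, and \<open>1 - R\<close> kills the subtracted multiple of
        \<open>g\<close>.\<close>
      define d where "d a = c a - c a0 / c0 a0 * c0 a" for a
      have x: "coord (app T (unit_vec j)) i = c a0 / c0 a0 * coord g i + (\<Sum>a\<in>A - {a0}. d a * f a i)" for i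
      proof -
        have "(\<Sum>a\<in>A. d a * f a i) = coord (app T (unit_vec j)) i - c a0 / c0 a0 * coord g i"
          by (simp add: d_def c c0 left_diff_distrib sum_subtractf sum_distrib_left mult.assoc)
        moreover have "(\<Sum>a\<in>A. d a * f a i) = (\<Sum>a\<in>A - {a0}. d a * f a i)"
          using a0 Suc.prems(1) by (simp add: sum.remove[of A a0] d_def)
        ultimately show ?thesis by (simp add: algebra_simps)
      qed
      have "coord (app (T - R * T) (unit_vec j)) i = (\<Sum>a\<in>A - {a0}. d a * f' a i)" for i
      proof -
        have "(\<Sum>a\<in>A - {a0}. d a * f' a i) = (\<Sum>a\<in>A - {a0}. d a * f a i)
            - (\<Sum>a\<in>A - {a0}. d a * f a i0) / coord g i0 * coord g i"
          by (simp add: f'_def right_diff_distrib sum_subtractf sum_distrib_right sum_divide_distrib mult.assoc)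
        then show ?thesis
          using i0 by (simp add: R x[of i0] x[of i]) (simp add: field_simps)
      qed
      then show "\<exists>c. \<forall>i. coord (app (T - R * T) (unit_vec j)) i = (\<Sum>a\<in>A - {a0}. c a * f' a i)"
        by blast
    qed
    then have "cpt ((T - R * T) + R * T)" by (rule cpt_simps(2)[OF _ cpt_simps(5)[OF R(1)]])
    then show ?thesis by simp
  qed (simp add: cpt_simps)
qed

lemma compact_op_mat_of [simp]: "compact_op (mat_of T) \<longleftrightarrow> cpt T"
proof
  assume T: "compact_op (mat_of T)"
  have "\<exists>F. cpt F \<and> norm (T - F) < e" if "e > 0" for e
  proof -
    have "\<exists>A. bounded_op A \<and> finite_rank A \<and> opnorm (mat_of T - A) < e"
      using T that by (simp add: compact_op_def)
    then obtain A where "bounded_op A \<and> finite_rank A \<and> opnorm (mat_of T - A) < e" ..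
    then have A: "bounded_op A" "finite_rank A" "opnorm (mat_of T - A) < e" by simp_all
    then obtain F where F: "A = mat_of F" by (auto simp: bounded_op_iff)
    obtain B :: "(nat \<Rightarrow> complex) set" where "finite B"
      "\<forall>j. \<exists>c. (\<lambda>i. A i j) = (\<lambda>i. \<Sum>v\<in>B. c v * v i)"
      using A(2) by (auto simp: finite_rank_def)
    then have "cpt F"
      by (intro finite_column_span_imp_cpt[of B F "\<lambda>v. v"]) (simp_all add: F mat_of_def fun_eq_iff)
    then show ?thesis using A(3) F by auto
  qed
  then have "\<exists>F. cpt F \<and> norm (T - F) < inverse (real (Suc n))" for n by simp
  then obtain F where F: "\<And>n. cpt (F n)" "\<And>n. norm (T - F n) < inverse (real (Suc n))" by metis
  have "(\<lambda>n. F n - T) \<longlonglongrightarrow> 0"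
    by (rule Lim_null_comparison[OF _ LIMSEQ_inverse_real_of_nat])
       (auto simp: norm_minus_commute intro!: always_eventually less_imp_le F(2)[simplified])
  then have "F \<longlonglongrightarrow> T" by (rule LIM_zero_cancel)
  then show "cpt T" using cpt_limit F(1) by blast
next
  assume T: "cpt T"
  have fr: "finite_rank (mat_of (trunc n * T))" for n
    unfolding finite_rank_def
  proof (intro exI conjI allI)
    \<comment> \<open>\<open>finite_rank\<close> indexes coefficients by the spanning vectors
      themselves, so the basis index is recovered through the inverse of the injective
      \<open>e\<close>.\<close>
    define e where "e k = coord (unit_vec k)" for k
    have "inj e"
    proof (rule injI)
      fix k l assume "e k = e l"
      then have "e k k = e l k" by simp
      then show "k = l" by (simp add: e_def split: if_splits)
    qed
    show "finite (e ` {..<n})" by simp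
    fix j
    show "(\<lambda>i. mat_of (trunc n * T) i j) =
        (\<lambda>i. \<Sum>v\<in>e ` {..<n}. coord (app T (unit_vec j)) (inv e v) * v i)"
    proof
      fix i
      have "(\<Sum>v\<in>e ` {..<n}. coord (app T (unit_vec j)) (inv e v) * v i)
          = (\<Sum>k<n. coord (app T (unit_vec j)) k * e k i)"
        using \<open>inj e\<close> by (subst sum.reindex) (auto simp: inj_on_def)
      then show "mat_of (trunc n * T) i j = (\<Sum>v\<in>e ` {..<n}. coord (app T (unit_vec j)) (inv e v) * v i)"
        by (simp add: mat_of_def e_def if_distrib[of "(*) _"] cong: if_cong)
    qed
  qed
  have "\<exists>F. bounded_op F \<and> finite_rank F \<and> opnorm (mat_of T - F) < e" if "e > 0" for e
  proof -
    obtain n where "norm (trunc n * T - T) < e"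
      using LIMSEQ_D[OF T[unfolded cpt_def] \<open>e > 0\<close>] by blast
    then show ?thesis
      using fr[of n] by (intro exI[of _ "mat_of (trunc n * T)"]) (simp add: norm_minus_commute)
  qed
  then show "compact_op (mat_of T)" by (simp add: compact_op_def)
qed

lemma in_KC_iff: "in_KC A \<longleftrightarrow> (\<exists>K c. cpt K \<and> A = mat_of (K + scal c))"
proof
  assume "in_KC A"
  then obtain B c where B: "compact_op B" "A = B + msmult c mat_id" by (auto simp: in_KC_def)
  then obtain K where "B = mat_of K" by (auto simp: compact_op_def bounded_op_iff)
  with B have "cpt K" "A = mat_of (K + scal c)" by (simp_all add: mat_of_one)
  then show "\<exists>K c. cpt K \<and> A = mat_of (K + scal c)" by blast
next
  assume "\<exists>K c. cpt K \<and> A = mat_of (K + scal c)"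
  then obtain K c where "cpt K" "A = mat_of K + msmult c mat_id" by (auto simp: mat_of_one)
  then show "in_KC A" unfolding in_KC_def using compact_op_mat_of by blast
qed

text \<open>Skew-adjointness turns the left truncation error into the right one by taking adjoints,
  so both tend to 0 at the same rate.\<close>

lemma cpt_truncate_both:
  assumes "cpt K" "adj K = - K"
  shows "(\<lambda>n. trunc n * K * trunc n) \<longlonglongrightarrow> K"
proof (rule LIM_zero_cancel, rule Lim_null_comparison)
  have *: "norm (K * trunc n - K) = norm (trunc n * K - K)" for n
    using norm_adj[of "trunc n * K - K"] assms(2) by (simp add: norm_minus_commute)
  have "norm (trunc n * K * trunc n - K) \<le> norm (trunc n * K - K) + norm (trunc n * K - K)" for n
  proof -
    have "trunc n * K * trunc n - K = trunc n * (K * trunc n - K) + (trunc n * K - K)"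
      by (simp add: algebra_simps)
    also have "norm \<dots> \<le> norm (trunc n * (K * trunc n - K)) + norm (trunc n * K - K)"
      by (rule norm_triangle_ineq)
    finally show ?thesis
      using norm_trunc_mult_le[of n "K * trunc n - K"] unfolding * by linarith
  qed
  then show "\<forall>\<^sub>F n in sequentially. norm (trunc n * K * trunc n - K)
      \<le> norm (trunc n * K - K) + norm (trunc n * K - K)" by simp
  have "(\<lambda>n. norm (trunc n * K - K)) \<longlonglongrightarrow> 0"
    using assms(1) unfolding cpt_def by (intro tendsto_norm_zero LIM_zero)
  from tendsto_add[OF this this] show "(\<lambda>n. norm (trunc n * K - K) + norm (trunc n * K - K)) \<longlonglongrightarrow> 0"
    by simp
qed

text \<open>\<open>trunc i\<close> keeps the coordinates strictly below \<open>i\<close>, so entry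
  \<open>i\<close> of \<open>trunc i * T - T\<close> is exactly minus the diagonal entry of
  \<open>T\<close>.\<close>

lemma cpt_diag_entries_tendsto_0:
  assumes "cpt T" "is_diag (mat_of T)"
  shows "(\<lambda>i. mat_of T i i) \<longlonglongrightarrow> 0"
proof (rule Lim_null_comparison)
  have "cmod (mat_of T i i) \<le> norm (trunc i * T - T)" for i
  proof -
    have "cmod (coord (app (trunc i * T - T) (unit_vec i)) i) \<le> norm (trunc i * T - T) * norm (unit_vec i)"
      by (rule order_trans[OF cmod_coord_le norm_app_le])
    then show ?thesis by (simp add: mat_of_def)
  qed
  then show "\<forall>\<^sub>F i in sequentially. cmod (mat_of T i i) \<le> norm (trunc i * T - T)" by simp
  show "(\<lambda>i. norm (trunc i * T - T)) \<longlonglongrightarrow> 0"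
    using assms(1) unfolding cpt_def by (intro tendsto_norm_zero LIM_zero)
qed

section \<open>Exponentials, isometries and numerical radius\<close>

lemma commute_exp:
  fixes A B :: "'a::{real_normed_algebra_1,banach}"
  assumes "A * B = B * A" shows "A * exp B = exp B * A"
proof -
  have "(\<lambda>n. A * (B ^ n /\<^sub>R fact n)) sums (A * exp B)"
    "(\<lambda>n. (B ^ n /\<^sub>R fact n) * A) sums (exp B * A)"
    using exp_converges by (rule sums_mult, rule sums_mult2)
  moreover have "A * (B ^ n /\<^sub>R fact n) = (B ^ n /\<^sub>R fact n) * A" for n
    using power_commuting_commutes[of B A n] assms by simp
  ultimately show ?thesis using sums_unique2 by auto
qed

lemma is_diag_exp: "is_diag (mat_of D) \<Longrightarrow> is_diag (mat_of (exp D))"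
  unfolding is_diag_iff_commute_proj using commute_exp[of "proj k" D for k] by metis

lemma adj_exp: "adj (exp T) = exp (adj T)"
proof -
  have "bounded_linear adj" by (rule bounded_linear_intro[of _ 1]) auto
  from bounded_linear.sums[OF this exp_converges[of T]]
  have "(\<lambda>n. adj (T ^ n /\<^sub>R fact n)) sums adj (exp T)" .
  moreover have "adj (T ^ n) = adj T ^ n" for n
    by (induction n) (simp_all add: power_commutes)
  ultimately show ?thesis using exp_converges[of "adj T"] sums_unique2 by auto
qed

lemma adj_exp_anti:
  assumes "adj Z = - Z"
  shows "adj (exp Z) * exp Z = 1" and "exp Z * adj (exp Z) = 1"
  using exp_minus_inverse[of Z] exp_minus_inverse[of "- Z"] assms by (simp_all add: adj_exp)

text \<open>Modulo compact operators \<open>K + D\<close> and \<open>D\<close> have the same powers,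
  hence the same exponential. This is how \<open>exp (t Z)\<close> is later corrected into compact
  plus scalar.\<close>

lemma cpt_exp_diff:
  assumes K: "cpt K" and D: "is_diag (mat_of D)"
  shows "cpt (exp (K + D) - exp D)"
proof (rule cpt_limit)
  have "cpt ((K + D) ^ n - D ^ n)" for n
  proof (induction n)
    case (Suc n)
    have "(K + D) ^ Suc n - D ^ Suc n = K * ((K + D) ^ n - D ^ n) + D * ((K + D) ^ n - D ^ n) + K * D ^ n"
      by (simp add: algebra_simps)
    then show ?case using Suc K D by (simp add: cpt_simps cpt_diag_mult)
  qed (simp add: cpt_simps)
  then have "cpt (((K + D) ^ n /\<^sub>R fact n) - (D ^ n /\<^sub>R fact n))" for n
    using cpt_simps(4) by (metis scaleR_diff_right)
  then show "cpt (\<Sum>k<n. ((K + D) ^ k /\<^sub>R fact k) - (D ^ k /\<^sub>R fact k))" for n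
    by (induction n) (simp_all add: cpt_simps)
  show "(\<lambda>n. \<Sum>k<n. ((K + D) ^ k /\<^sub>R fact k) - (D ^ k /\<^sub>R fact k)) \<longlonglongrightarrow> exp (K + D) - exp D"
    using sums_diff[OF exp_converges exp_converges] unfolding sums_def .
qed

lemma norm_app_isometry:
  assumes "adj U * U = 1" shows "norm (app U x) = norm x"
proof -
  have "app U x \<bullet> app U x = x \<bullet> app (adj U * U) x" by (simp add: inner_app_adj)
  then show ?thesis using assms by (simp add: norm_eq_sqrt_inner)
qed

lemma norm_isometry_le: "adj U * U = 1 \<Longrightarrow> norm U \<le> 1"
  by (rule norm_cop_le) (auto simp: norm_app_isometry)

lemma norm_conjugate_le:
  assumes "adj U * U = 1" shows "norm (U * T * adj U) \<le> norm T" and "norm (adj U * T * U) \<le> norm T"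
proof -
  have n: "norm U \<le> 1" using assms by (rule norm_isometry_le)
  have "norm (A * T * B) \<le> norm T" if "norm A \<le> 1" "norm B \<le> 1" for A B
  proof -
    have "norm (A * T * B) \<le> norm A * norm T * norm B"
      by (rule order_trans[OF norm_mult_ineq mult_right_mono[OF norm_mult_ineq norm_ge_zero]])
    also have "\<dots> \<le> 1 * norm T * 1" using that by (intro mult_mono) auto
    finally show ?thesis by simp
  qed
  then show "norm (U * T * adj U) \<le> norm T" "norm (adj U * T * U) \<le> norm T" using n by auto
qed

text \<open>Polarisation: for self-adjoint \<open>X\<close> the bilinear form is a difference of two
  values of the quadratic form, and the parallelogram law adds up their bounds.\<close>

lemma norm_self_adjoint_le:
  assumes X: "adj X = X" and C: "0 \<le> C" and le: "\<And>v. \<bar>v \<bullet> app X v\<bar> \<le> C * (norm v)\<^sup>2"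
  shows "norm X \<le> C"
proof -
  have pol: "4 * (x \<bullet> app X y) \<le> 2 * C * ((norm x)\<^sup>2 + (norm y)\<^sup>2)" for x y
  proof -
    have sym: "y \<bullet> app X x = x \<bullet> app X y"
      using inner_app_adj[of X x y] X by (simp add: inner_commute)
    have "4 * (x \<bullet> app X y) = (x + y) \<bullet> app X (x + y) - (x - y) \<bullet> app X (x - y)"
      by (simp add: inner_add_left inner_add_right inner_diff_left inner_diff_right sym)
    also have "\<dots> \<le> C * (norm (x + y))\<^sup>2 + C * (norm (x - y))\<^sup>2"
      using le[of "x + y"] le[of "x - y"] by (simp only: abs_le_iff) linarith
    also have "\<dots> = 2 * C * ((norm x)\<^sup>2 + (norm y)\<^sup>2)"
      by (simp add: power2_norm_eq_inner inner_add_left inner_add_right inner_diff_left inner_diff_right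
          algebra_simps)
    finally show ?thesis .
  qed
  have "norm (app X y) \<le> C * norm y" for y
  proof (cases "app X y = 0 \<or> y = 0")
    case False
    \<comment> \<open>The direction of \<open>app X y\<close> at the length of \<open>y\<close>,
      which makes the polarised inequality sharp.\<close>
    define x where "x = (norm y / norm (app X y)) *\<^sub>R app X y"
    have "norm x = norm y" using False by (simp add: x_def)
    moreover have "x \<bullet> app X y = norm y * norm (app X y)"
      using False by (simp add: x_def dot_square_norm power2_eq_square)
    ultimately have "4 * (norm y * norm (app X y)) \<le> 4 * (norm y * (C * norm y))"
      using pol[of x y] by (simp add: power2_eq_square algebra_simps)
    then show ?thesis using False by simp
  qed (use C in auto)
  then show ?thesis using C by (intro norm_cop_le)
qed

section \<open>Duality for minimal operators\<close>

lemma coord_beyond_trunc: "app (trunc n) v = v \<Longrightarrow> n \<le> i \<Longrightarrow> coord v i = 0"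
  by (metis coord_trunc not_le)

lemma inner_diag_supported:
  assumes D: "is_diag (mat_of D)" and v: "app (trunc n) v = v"
  shows "v \<bullet> app D v = (\<Sum>i<n. Re (mat_of D i i) * (cmod (coord v i))\<^sup>2)"
proof -
  have "(\<lambda>i. coord v i \<bullet> coord (app D v) i) sums (\<Sum>i<n. coord v i \<bullet> coord (app D v) i)"
    using coord_beyond_trunc[OF v] by (intro sums_finite) auto
  then have "v \<bullet> app D v = (\<Sum>i<n. coord v i \<bullet> coord (app D v) i)"
    by (simp add: inner_ell2_def sums_iff)
  also have "\<dots> = (\<Sum>i<n. Re (mat_of D i i) * (cmod (coord v i))\<^sup>2)"
    by (intro sum.cong refl)
       (simp add: coord_app_diag[OF D] inner_complex_def cmod_power2, simp add: power2_eq_square algebra_simps)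
  finally show ?thesis .
qed

lemma norm_sq_supported:
  assumes "app (trunc n) v = v"
  shows "(norm v)\<^sup>2 = (\<Sum>i<n. (cmod (coord v i))\<^sup>2)"
proof -
  have "(\<lambda>i. (cmod (coord v i))\<^sup>2) sums (\<Sum>i<n. (cmod (coord v i))\<^sup>2)"
    using coord_beyond_trunc[OF assms] by (intro sums_finite) auto
  then show ?thesis by (simp add: norm_ell2_sq sums_iff)
qed

text \<open>A list of signs and vectors \<open>(s, v)\<close> encodes the trace class operator \<open>\<Sum> s v v\<^sup>*\<close>;
  \<open>mix u\<close> implements the convex combination \<open>(1 - u) \<phi>\<^sub>0 + u \<phi>\<^sub>1\<close> of two of these.\<close>

definition mix :: "real \<Rightarrow> (real \<times> ell2) list \<Rightarrow> (real \<times> ell2) list \<Rightarrow> (real \<times> ell2) list" where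
  "mix u L0 L1 = map (\<lambda>(s, v). (s, sqrt (1 - u) *\<^sub>R v)) L0 @ map (\<lambda>(s, v). (s, sqrt u *\<^sub>R v)) L1"

lemma sum_list_mix:
  fixes \<phi> :: "real \<times> ell2 \<Rightarrow> real"
  assumes hom: "\<And>s v r. \<phi> (s, r *\<^sub>R v) = r\<^sup>2 * \<phi> (s, v)" and u: "0 \<le> u" "u \<le> 1"
  shows "sum_list (map \<phi> (mix u L0 L1)) = (1 - u) * sum_list (map \<phi> L0) + u * sum_list (map \<phi> L1)"
proof -
  have "sum_list (map \<phi> (map (\<lambda>(s, v). (s, sqrt r *\<^sub>R v)) L)) = r * sum_list (map \<phi> L)"
    if "0 \<le> r" for r and L :: "(real \<times> ell2) list"
    using that by (induction L) (auto simp: hom algebra_simps)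
  from this[of "1 - u" L0] this[of u L1] show ?thesis using u by (simp add: mix_def)
qed

text \<open>The encoded operators have trace norm at most one and live on the first \<open>n\<close>
  coordinates. The vectors need not be orthogonal, which keeps the set closed under
  \<open>mix\<close>. For self-adjoint \<open>X\<close>, \<open>form_sum X\<close> is the trace
  pairing with \<open>X\<close>, and \<open>diag_sum\<close> is the diagonal of the encoded
  operator.\<close>

definition signed_family :: "nat \<Rightarrow> (real \<times> ell2) list \<Rightarrow> bool" where
  "signed_family n L \<longleftrightarrow> (\<forall>(s, v)\<in>set L. (s = 1 \<or> s = -1) \<and> app (trunc n) v = v)
     \<and> (\<Sum>(s, v)\<leftarrow>L. (norm v)\<^sup>2) = 1"

definition form_sum :: "cop \<Rightarrow> (real \<times> ell2) list \<Rightarrow> real" where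
  "form_sum X L = (\<Sum>(s, v)\<leftarrow>L. s * (v \<bullet> app X v))"

definition diag_sum :: "(real \<times> ell2) list \<Rightarrow> nat \<Rightarrow> real" where
  "diag_sum L i = (\<Sum>(s, v)\<leftarrow>L. s * (cmod (coord v i))\<^sup>2)"

lemma form_sum_mix: "0 \<le> u \<Longrightarrow> u \<le> 1 \<Longrightarrow> form_sum X (mix u L0 L1) = (1 - u) * form_sum X L0 + u * form_sum X L1"
  unfolding form_sum_def by (rule sum_list_mix) (auto simp: power2_eq_square)

lemma diag_sum_mix: "0 \<le> u \<Longrightarrow> u \<le> 1 \<Longrightarrow> diag_sum (mix u L0 L1) i = (1 - u) * diag_sum L0 i + u * diag_sum L1 i"
  unfolding diag_sum_def by (rule sum_list_mix) (auto simp: norm_mult power_mult_distrib)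

lemma signed_family_mix:
  assumes "0 \<le> u" "u \<le> 1" "signed_family n L0" "signed_family n L1"
  shows "signed_family n (mix u L0 L1)"
proof -
  have "(\<Sum>(s, v)\<leftarrow>mix u L0 L1. (norm v)\<^sup>2) =
      (1 - u) * (\<Sum>(s, v)\<leftarrow>L0. (norm v)\<^sup>2) + u * (\<Sum>(s, v)\<leftarrow>L1. (norm v)\<^sup>2)"
    using assms by (intro sum_list_mix) (auto simp: power_mult_distrib)
  then show ?thesis using assms by (fastforce simp: signed_family_def mix_def)
qed

lemma abs_signed_sum_le:
  assumes L: "signed_family n L" and \<phi>: "\<And>v. \<bar>\<phi> v\<bar> \<le> C * (norm v)\<^sup>2"
  shows "\<bar>\<Sum>(s, v)\<leftarrow>L. s * \<phi> v\<bar> \<le> C"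
proof -
  have "\<bar>\<Sum>(s, v)\<leftarrow>L. s * \<phi> v\<bar> \<le> (\<Sum>(s, v)\<leftarrow>L. \<bar>s * \<phi> v\<bar>)"
    using sum_list_abs[of "map (\<lambda>(s, v). s * \<phi> v) L"] by (simp add: comp_def case_prod_unfold)
  also have "\<dots> \<le> (\<Sum>(s, v)\<leftarrow>L. C * (norm v)\<^sup>2)"
    using L \<phi> by (intro sum_list_mono) (auto simp: signed_family_def abs_mult)
  also have "\<dots> = C * (\<Sum>(s, v)\<leftarrow>L. (norm v)\<^sup>2)"
    by (simp add: sum_list_const_mult case_prod_unfold)
  finally show ?thesis using L by (simp add: signed_family_def)
qed

lemma abs_form_sum_le: "signed_family n L \<Longrightarrow> \<bar>form_sum X L\<bar> \<le> norm X"
  unfolding form_sum_def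
proof (erule abs_signed_sum_le)
  fix v
  have "\<bar>v \<bullet> app X v\<bar> \<le> norm v * norm (app X v)" by (rule Cauchy_Schwarz_ineq2)
  also have "\<dots> \<le> norm v * (norm X * norm v)" by (intro mult_left_mono norm_app_le) simp
  finally show "\<bar>v \<bullet> app X v\<bar> \<le> norm X * (norm v)\<^sup>2" by (simp add: power2_eq_square mult_ac)
qed

lemma abs_diag_sum_le: "signed_family n L \<Longrightarrow> \<bar>diag_sum L i\<bar> \<le> 1"
  unfolding diag_sum_def
  by (erule abs_signed_sum_le) (simp add: cmod_coord_le power_mono)

lemma form_sum_add: "form_sum (X + Y) L = form_sum X L + form_sum Y L"
  by (induction L) (auto simp: form_sum_def inner_add_right algebra_simps)

lemma form_sum_diag:
  assumes D: "is_diag (mat_of D)" and L: "signed_family n L"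
  shows "form_sum D L = (\<Sum>i<n. Re (mat_of D i i) * diag_sum L i)"
proof -
  have "\<forall>(s, v)\<in>set L. app (trunc n) v = v" using L by (auto simp: signed_family_def)
  then show ?thesis
    by (induction L)
       (auto simp: form_sum_def diag_sum_def inner_diag_supported[OF D] sum.distrib algebra_simps
         sum_distrib_left)
qed

text \<open>First-order condition for the concave functional \<open>G\<close>, the pairing with
  \<open>X\<close> minus \<open>M\<close> times the squared length of the diagonal. Since only a
  near-maximiser is available, it is compared with a mixture at a fixed small parameter
  \<open>u\<close> instead of differentiating at 0.\<close>

lemma near_maximal_signed_family:
  assumes n: "0 < n" and M: "0 \<le> M" and \<epsilon>: "0 < \<epsilon>"
  obtains L0 where "signed_family n L0"
    and "\<And>L. signed_family n L \<Longrightarrow> form_sum X L - 2 * M * (\<Sum>i<n. diag_sum L0 i * diag_sum L i)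
           \<le> form_sum X L0 - 2 * M * (\<Sum>i<n. (diag_sum L0 i)\<^sup>2) + \<epsilon>"
proof -
  define G where "G L = form_sum X L - M * (\<Sum>i<n. (diag_sum L i)\<^sup>2)" for L
  define B where "B = {L. signed_family n L}"
  have "app (trunc n) (unit_vec 0) = unit_vec 0" using n by (intro coord_inject_ext) auto
  then have "[(1, unit_vec 0)] \<in> B" by (simp add: B_def signed_family_def)
  then have ne: "B \<noteq> {}" by blast
  have "G L \<le> norm X" if "L \<in> B" for L
  proof -
    have "0 \<le> M * (\<Sum>i<n. (diag_sum L i)\<^sup>2)" using M by (intro mult_nonneg_nonneg sum_nonneg) auto
    moreover have "form_sum X L \<le> norm X"
      using that abs_form_sum_le[of n L X] by (auto simp: B_def)
    ultimately show ?thesis unfolding G_def by linarith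
  qed
  then have bdd: "bdd_above (G ` B)" by (auto intro!: bdd_aboveI2)
  \<comment> \<open>The diagonals differ by at most 2 in each of \<open>n\<close> places, so the
    quadratic term is at most \<open>4 n M u\<close> times \<open>u\<close>. This \<open>u\<close>
    makes it at most \<open>u * \<epsilon> / 2\<close>; the slack of near-maximality is the other
    half, and division by \<open>u\<close> leaves \<epsilon>.\<close>
  define u where "u = \<epsilon> / (8 * real n * M + \<epsilon>)"
  have den: "0 < 8 * real n * M + \<epsilon>" using M \<epsilon> by (simp add: add_nonneg_pos)
  have u: "0 < u" "u \<le> 1" using den \<epsilon> M by (auto simp: u_def)
  have uM: "4 * real n * M * u \<le> \<epsilon> / 2"
    using den \<epsilon> M by (simp add: u_def field_simps)
  have "(SUP L\<in>B. G L) - u * \<epsilon> / 2 < (SUP L\<in>B. G L)" using u \<epsilon> by simp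
  then obtain L0 where L0: "L0 \<in> B" "(SUP L\<in>B. G L) - u * \<epsilon> / 2 < G L0"
    by (subst (asm) less_cSUP_iff[OF ne bdd]) auto
  have "form_sum X L - 2 * M * (\<Sum>i<n. diag_sum L0 i * diag_sum L i)
           \<le> form_sum X L0 - 2 * M * (\<Sum>i<n. (diag_sum L0 i)\<^sup>2) + \<epsilon>" if L: "signed_family n L" for L
  proof -
    define c0 where "c0 = diag_sum L0"
    define c where "c = diag_sum L"
    have "mix u L0 L \<in> B"
      using L0(1) L u by (simp add: B_def signed_family_mix)
    then have "G (mix u L0 L) \<le> (SUP L\<in>B. G L)" using bdd by (intro cSUP_upper)
    then have le: "G (mix u L0 L) \<le> G L0 + u * \<epsilon> / 2" using L0(2) by linarith
    have "(\<Sum>i<n. (diag_sum (mix u L0 L) i)\<^sup>2) = (\<Sum>i<n. (c0 i)\<^sup>2 + 2 * u * (c0 i * c i - (c0 i)\<^sup>2) + u\<^sup>2 * (c i - c0 i)\<^sup>2)"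
      using u by (intro sum.cong refl) (simp add: diag_sum_mix c_def c0_def power2_eq_square algebra_simps)
    also have "\<dots> = (\<Sum>i<n. (c0 i)\<^sup>2) + 2 * u * ((\<Sum>i<n. c0 i * c i) - (\<Sum>i<n. (c0 i)\<^sup>2)) + u\<^sup>2 * (\<Sum>i<n. (c i - c0 i)\<^sup>2)"
      by (simp add: sum.distrib sum_distrib_left[symmetric] sum_subtractf)
    finally have Q: "(\<Sum>i<n. (diag_sum (mix u L0 L) i)\<^sup>2) = \<dots>" .
    have "(\<Sum>i<n. (c i - c0 i)\<^sup>2) \<le> (\<Sum>i<n. 2\<^sup>2)"
    proof (rule sum_mono)
      fix i
      have "\<bar>c i - c0 i\<bar> \<le> 2"
        using abs_diag_sum_le[of n L i] abs_diag_sum_le[of n L0 i] L L0(1) by (simp add: B_def c_def c0_def)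
      then show "(c i - c0 i)\<^sup>2 \<le> 2\<^sup>2" using abs_le_square_iff[of "c i - c0 i" 2] by simp
    qed
    then have "M * u\<^sup>2 * (\<Sum>i<n. (c i - c0 i)\<^sup>2) \<le> M * u\<^sup>2 * (4 * real n)"
      using M by (intro mult_left_mono) auto
    also have "\<dots> = u * (4 * real n * M * u)" by (simp add: power2_eq_square)
    also have "\<dots> \<le> u * (\<epsilon> / 2)" using uM u by (intro mult_left_mono) auto
    finally have quad: "M * u\<^sup>2 * (\<Sum>i<n. (c i - c0 i)\<^sup>2) \<le> u * (\<epsilon> / 2)" .
    have "u * (form_sum X L - form_sum X L0 - 2 * M * ((\<Sum>i<n. c0 i * c i) - (\<Sum>i<n. (c0 i)\<^sup>2)))
        = G (mix u L0 L) - G L0 + M * u\<^sup>2 * (\<Sum>i<n. (c i - c0 i)\<^sup>2)"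
      unfolding G_def Q using u by (simp add: form_sum_mix c0_def algebra_simps)
    also have "\<dots> \<le> u * \<epsilon>" using le quad by simp
    finally have "form_sum X L - form_sum X L0 - 2 * M * ((\<Sum>i<n. c0 i * c i) - (\<Sum>i<n. (c0 i)\<^sup>2)) \<le> \<epsilon>"
      using u by simp
    then show ?thesis by (simp add: c_def c0_def algebra_simps)
  qed
  then show thesis using that L0(1) by (simp add: B_def)
qed

lemma sum_abs_le_of_sum_squares:
  fixes c :: "nat \<Rightarrow> real"
  assumes "real n * (\<Sum>i<n. (c i)\<^sup>2) \<le> e\<^sup>2" "0 \<le> e"
  shows "(\<Sum>i<n. \<bar>c i\<bar>) \<le> e"
proof -
  have "(\<Sum>i<n. \<bar>1\<bar> * \<bar>c i\<bar>) \<le> L2_set (\<lambda>_. 1) {..<n} * L2_set c {..<n}"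
    by (rule L2_set_mult_ineq)
  also have "\<dots> = sqrt (real n * (\<Sum>i<n. (c i)\<^sup>2))"
    by (simp add: L2_set_def real_sqrt_mult)
  also have "\<dots> \<le> e" using assms real_le_lsqrt sum_nonneg by (metis real_sqrt_le_mono real_sqrt_abs abs_of_nonneg)
  finally show ?thesis by simp
qed

text \<open>Approximate duality for the distance \<open>d\<close> from \<open>X\<close> to the
  self-adjoint diagonal operators. The optimality condition bounds the norm of the compression of
  \<open>X + D\<close> for an explicit diagonal \<open>D\<close>, minimality bounds this norm below
  by \<open>d\<close> up to \<epsilon>, and together they force both a large pairing and a small
  diagonal.\<close>

lemma ex_dual_family:
  assumes X: "adj X = X" and lim: "(\<lambda>n. trunc n * X * trunc n) \<longlonglongrightarrow> X"
    and min: "\<And>D. is_diag (mat_of D) \<Longrightarrow> adj D = D \<Longrightarrow> d \<le> norm (X + D)" and e: "0 < e"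
  shows "\<exists>n L. signed_family n L \<and> d - e \<le> form_sum X L \<and> (\<Sum>i<n. \<bar>diag_sum L i\<bar>) \<le> e"
proof -
  define \<epsilon> where "\<epsilon> = e / 3"
  have \<epsilon>: "0 < \<epsilon>" using e by (simp add: \<epsilon>_def)
  obtain n0 where n0: "\<forall>n\<ge>n0. norm (trunc n * X * trunc n - X) < \<epsilon>"
    using LIMSEQ_D[OF lim \<epsilon>] by blast
  define n where "n = Suc n0"
  have n: "0 < n" "norm (trunc n * X * trunc n - X) < \<epsilon>" using n0 by (auto simp: n_def)
  define H where "H = norm X + \<bar>d\<bar> + 2 * \<epsilon>"
  \<comment> \<open>The final estimate is \<open>2 * M * Q \<le> H\<close>. This weight turns it
    into \<open>n * Q \<le> e\<^sup>2\<close>, which by Cauchy-Schwarz bounds the sum of the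
    absolute diagonal entries by \<open>e\<close>.\<close>
  define M where "M = real n * H / (2 * e\<^sup>2) + 1"
  have H: "0 < H" using \<epsilon> by (simp add: H_def add_nonneg_pos)
  have M: "0 < M" using H e by (simp add: M_def add_nonneg_pos)
  obtain L0 where L0: "signed_family n L0"
    and opt: "\<And>L. signed_family n L \<Longrightarrow> form_sum X L - 2 * M * (\<Sum>i<n. diag_sum L0 i * diag_sum L i)
           \<le> form_sum X L0 - 2 * M * (\<Sum>i<n. (diag_sum L0 i)\<^sup>2) + \<epsilon>"
    using near_maximal_signed_family[OF n(1) less_imp_le[OF M] \<epsilon>] by blast
  define Q where "Q = (\<Sum>i<n. (diag_sum L0 i)\<^sup>2)"
  define C where "C = form_sum X L0 - 2 * M * Q + \<epsilon>"
  \<comment> \<open>Minus the gradient of the penalty at \<open>L0\<close>: pairing with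
    \<open>X + D\<close> is the linear part of the penalised functional there.\<close>
  define g where "g i = (if i < n then complex_of_real (- 2 * M * diag_sum L0 i) else 0)" for i
  define D where "D = diag_op g"
  have gb: "cmod (g i) \<le> 2 * M" for i
    using abs_diag_sum_le[OF L0, of i] M by (auto simp: g_def norm_mult)
  have "cnj (g i) = g i" for i by (simp add: g_def)
  then have D: "is_diag (mat_of D)" "adj D = D"
    unfolding D_def using is_diag_diag_op[of g, OF gb] adj_diag_op[of g, OF gb]
    by simp_all
  \<comment> \<open>Families consisting of one unit vector with either sign already give the
    two-sided bound on the quadratic form.\<close>
  have form: "\<bar>w \<bullet> app (X + D) w\<bar> \<le> C * (norm w)\<^sup>2" if w: "app (trunc n) w = w" for w
  proof (cases "w = 0")
    case False
    define v where "v = (1 / norm w) *\<^sub>R w"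
    have "norm v = 1" "app (trunc n) v = v" using False w by (simp_all add: v_def)
    then have fam: "signed_family n [(s, v)]" if "s = 1 \<or> s = -1" for s
      using that by (simp add: signed_family_def)
    have "s * (v \<bullet> app (X + D) v) \<le> C" if s: "s = 1 \<or> s = -1" for s
    proof -
      have "s * (v \<bullet> app (X + D) v) = form_sum X [(s, v)] + form_sum D [(s, v)]"
        by (simp add: form_sum_def inner_add_right algebra_simps)
      also have "form_sum D [(s, v)] = - 2 * M * (\<Sum>i<n. diag_sum L0 i * diag_sum [(s, v)] i)"
        unfolding form_sum_diag[OF D(1) fam[OF s]] sum_distrib_left
        using mat_of_diag_op[of g, OF gb] by (intro sum.cong) (auto simp: D_def g_def)
      finally show ?thesis using opt[OF fam[OF s]] unfolding C_def Q_def by simp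
    qed
    from this[of 1] this[of "-1"] have "\<bar>v \<bullet> app (X + D) v\<bar> \<le> C" by simp
    moreover have "w = norm w *\<^sub>R v" using False by (simp add: v_def)
    then have "w \<bullet> app (X + D) w = (norm w)\<^sup>2 * (v \<bullet> app (X + D) v)"
      by (metis app_right_simps(5) inner_scaleR_left inner_scaleR_right mult.assoc power2_eq_square)
    ultimately show ?thesis by (simp only: abs_mult abs_power2 mult.commute[of C] mult_left_mono zero_le_power2)
  qed simp
  have "app (trunc n) (unit_vec 0) = unit_vec 0" using n by (intro coord_inject_ext) auto
  from form[OF this] have C0: "0 \<le> C" by simp
  have "norm (trunc n * (X + D) * trunc n) \<le> C"
  proof (rule norm_self_adjoint_le)
    show "adj (trunc n * (X + D) * trunc n) = trunc n * (X + D) * trunc n"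
      using X D by (simp add: mult.assoc)
    fix v
    define w where "w = app (trunc n) v"
    have "app (trunc n) w = w" by (rule coord_inject_ext) (simp add: w_def)
    moreover have "v \<bullet> app (trunc n * (X + D) * trunc n) v = w \<bullet> app (X + D) w"
      using inner_app_adj[of "trunc n" v] by (simp add: w_def)
    moreover have "norm w \<le> 1 * norm v"
      unfolding w_def by (rule order_trans[OF norm_app_le mult_right_mono[OF norm_trunc_le]]) simp
    then have "C * (norm w)\<^sup>2 \<le> C * (norm v)\<^sup>2" using C0 by (intro mult_left_mono power_mono) auto
    ultimately show "\<bar>v \<bullet> app (trunc n * (X + D) * trunc n) v\<bar> \<le> C * (norm v)\<^sup>2"
      using form[of w] by simp
  qed fact
  moreover have "trunc n * D * trunc n = D"
    using coord_diag_op[of g, OF gb] by (intro cop_eqI coord_inject_ext) (auto simp: D_def g_def)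
  ultimately have "norm (trunc n * X * trunc n + D) \<le> C" by (simp add: algebra_simps)
  moreover have "norm (X + D) \<le> norm (trunc n * X * trunc n + D) + norm (trunc n * X * trunc n - X)"
    using norm_triangle_ineq4[of "trunc n * X * trunc n + D" "trunc n * X * trunc n - X"] by (simp add: add.commute)
  ultimately have "d \<le> C + \<epsilon>" using min[OF D] n(2) by linarith
  then have key: "d + 2 * M * Q \<le> form_sum X L0 + 2 * \<epsilon>" by (simp add: C_def)
  have Q0: "0 \<le> Q" unfolding Q_def by (intro sum_nonneg) auto
  then have "0 \<le> 2 * M * Q" using M by simp
  then have 1: "d - e \<le> form_sum X L0" using key e by (simp add: \<epsilon>_def)
  have "2 * M * Q \<le> H"
    using key abs_form_sum_le[OF L0, of X] abs_ge_minus_self[of d] unfolding H_def by linarith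
  then have "real n * (2 * M * Q) \<le> real n * H" by (intro mult_left_mono) auto
  also have "\<dots> \<le> 2 * M * e\<^sup>2" using e by (simp add: M_def field_simps)
  finally have "real n * Q \<le> e\<^sup>2" using M by (simp add: mult.assoc mult.left_commute)
  then have "(\<Sum>i<n. \<bar>diag_sum L0 i\<bar>) \<le> e"
    using e unfolding Q_def by (intro sum_abs_le_of_sum_squares) auto
  with 1 L0 show ?thesis by blast
qed

text \<open>The truncations of \<open>D\<close> need not converge in norm, so the duality is applied
  to \<open>K\<close> alone, which has the same distance to the diagonal operators. The pairing with
  \<open>D\<close> is then harmless, because it only sees the small diagonal of the family. The
  factor \<open>- \<i>\<close> turns skew into self-adjoint.\<close>

lemma ex_dual_family_minimal:
  assumes K: "cpt K" "adj K = - K" and D: "is_diag (mat_of D)" "adj D = - D"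
    and min: "\<And>D'. is_diag (mat_of D') \<Longrightarrow> adj D' = - D' \<Longrightarrow> norm (K + D) \<le> norm (K + D + D')"
    and e: "0 < e"
  shows "\<exists>n L. signed_family n L \<and> norm (K + D) - e \<le> form_sum (scal (- \<i>) * (K + D)) L
      \<and> (\<Sum>i<n. \<bar>diag_sum L i\<bar>) \<le> e"
proof -
  \<comment> \<open>The error is spent once on the pairing with \<open>K\<close> and
    \<open>norm D\<close> times on the pairing with \<open>D\<close>.\<close>
  define e' where "e' = e / (1 + norm D)"
  have pos: "0 < 1 + norm D" by (simp add: add_pos_nonneg)
  have "e' * (1 + norm D) = e" using pos by (simp add: e'_def)
  then have e'3: "e' + norm D * e' = e" by (simp add: algebra_simps)
  have e'1: "0 < e'" using e pos by (simp add: e'_def)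
  then have "0 \<le> norm D * e'" by simp
  note e' = e'1 this e'3
  have sa: "adj (scal (- \<i>) * A) = scal (- \<i>) * A" if "adj A = - A" for A
    using that by (simp add: scal_commute) (intro cop_eqI coord_inject_ext, simp)
  have diag_scal: "is_diag (mat_of (scal c * A))" if "is_diag (mat_of A)" for c A
    using that by (simp add: is_diag_def mat_of_def)
  have "(\<lambda>n. scal (- \<i>) * (trunc n * K * trunc n)) \<longlonglongrightarrow> scal (- \<i>) * K"
    by (intro tendsto_mult tendsto_const cpt_truncate_both K)
  then have lim: "(\<lambda>n. trunc n * (scal (- \<i>) * K) * trunc n) \<longlonglongrightarrow> scal (- \<i>) * K"
    by (simp add: scal_commute_left mult.assoc)
  have "norm (K + D) \<le> norm (scal (- \<i>) * K + E)" if E: "is_diag (mat_of E)" "adj E = E" for E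
  proof -
    have "adj (scal \<i> * E - D) = - (scal \<i> * E - D)"
      using E D by (simp add: scal_commute) (intro cop_eqI coord_inject_ext, simp)
    then have "norm (K + D) \<le> norm (K + D + (scal \<i> * E - D))"
      using E D by (intro min is_diag_diff diag_scal)
    also have "K + D + (scal \<i> * E - D) = scal \<i> * (scal (- \<i>) * K + E)"
      by (simp add: distrib_left mult.assoc[symmetric])
    finally show ?thesis by simp
  qed
  from ex_dual_family[OF sa[OF K(2)] lim this e'(1)]
  obtain n L where L: "signed_family n L" "norm (K + D) - e' \<le> form_sum (scal (- \<i>) * K) L"
    "(\<Sum>i<n. \<bar>diag_sum L i\<bar>) \<le> e'" by blast
  have "\<bar>form_sum (scal (- \<i>) * D) L\<bar> \<le> (\<Sum>i<n. norm D * \<bar>diag_sum L i\<bar>)"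
    unfolding form_sum_diag[OF diag_scal[OF D(1)] L(1)]
  proof (intro order_trans[OF sum_abs] sum_mono)
    fix i
    have "\<bar>Re (mat_of (scal (- \<i>) * D) i i)\<bar> \<le> cmod (coord (app D (unit_vec i)) i)"
      by (simp add: mat_of_def abs_Im_le_cmod)
    also have "\<dots> \<le> norm D" using order_trans[OF cmod_coord_le norm_app_le, of D "unit_vec i"] by simp
    finally show "\<bar>Re (mat_of (scal (- \<i>) * D) i i) * diag_sum L i\<bar> \<le> norm D * \<bar>diag_sum L i\<bar>"
      by (simp add: abs_mult mult_right_mono)
  qed
  also have "\<dots> \<le> norm D * e'" using L(3) by (simp add: sum_distrib_left[symmetric] mult_left_mono)
  finally have "norm (K + D) - e \<le> form_sum (scal (- \<i>) * (K + D)) L"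
    using L(2) e' unfolding distrib_left form_sum_add by (simp add: abs_le_iff)
  moreover have "(\<Sum>i<n. \<bar>diag_sum L i\<bar>) \<le> e" using L(3) e' by linarith
  ultimately show ?thesis using L(1) by blast
qed

section \<open>Spectral projections along the orbit\<close>

definition unitary :: "cop \<Rightarrow> bool" where
  "unitary u \<longleftrightarrow> adj u * u = 1 \<and> u * adj u = 1"

lemma unitary_cancel:
  assumes "unitary u"
  shows "adj u * u = 1" "u * adj u = 1" "adj u * (u * x) = x" "u * (adj u * x) = x"
  using assms by (simp_all add: unitary_def mult.assoc[symmetric])

lemma norm_unitary_conj_le: "unitary u \<Longrightarrow> norm (u * T * adj u) \<le> norm T"
  by (rule norm_conjugate_le) (simp add: unitary_def)

text \<open>\<open>R\<close> and \<open>R'\<close> play the role of reduced resolvents at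
  \<open>l\<close>. The first identity gives Lipschitz continuity. The second is arranged for
  differentiation: its linear terms contain only the fixed \<open>R\<close>, and the varying
  \<open>R'\<close>, of which only a bound will be known, occurs in the quadratic term
  alone.\<close>

lemma idempotent_difference_resolvent:
  fixes P P' c c' R R' l :: "'a::ring_1"
  assumes P: "P * P = P" "(c - l) * P = 0" and P': "P' * P' = P'" "P' * (c' - l) = 0" "(c' - l) * P' = 0"
    and R: "R * (c - l) = 1 - P" "(c - l) * R = 1 - P"
    and R': "R' * (c' - l) = 1 - P'" "(c' - l) * R' = 1 - P'" and P2: "P * (c - l) = 0"
  shows "P' - P = P' * (c - c') * R - R' * (c' - c) * P"
    and "P' - P = P' * (c - c') * R + R * (c - c') * P' * P - P * (c' - c) * R' * R' * (c' - c) * P"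
proof -
  have "P' * (c - c') * R = P' * ((c - l) * R) - (P' * (c' - l)) * R"
    by (simp add: algebra_simps)
  then have 1: "P' * (c - c') * R = P' * (1 - P)" by (simp add: R P')
  have "R * (c - c') * P' = R * (c - l) * P' - R * ((c' - l) * P')"
    by (simp add: algebra_simps)
  then have 2: "R * (c - c') * P' = (1 - P) * P'" by (simp add: R P')
  have "R' * (c' - c) * P = R' * (c' - l) * P - R' * ((c - l) * P)"
    by (simp add: algebra_simps)
  then have 3: "R' * (c' - c) * P = (1 - P') * P" by (simp add: R' P)
  have "P * (c' - c) * R' = P * ((c' - l) * R') - (P * (c - l)) * R'"
    by (simp add: algebra_simps)
  then have 4: "P * (c' - c) * R' = P * (1 - P')" by (simp add: R' P2)
  show "P' - P = P' * (c - c') * R - R' * (c' - c) * P"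
    unfolding 1 3 by (simp add: algebra_simps)
  have "P * (c' - c) * R' * R' * (c' - c) * P = (P * (c' - c) * R') * (R' * (c' - c) * P)"
    by (simp add: mult.assoc)
  also have "\<dots> = P * ((1 - P') * (1 - P')) * P" unfolding 3 4 by (simp add: mult.assoc)
  also have "(1 - P') * (1 - P') = 1 - P'" using P' by (simp add: algebra_simps)
  finally have 5: "P * (c' - c) * R' * R' * (c' - c) * P = P * (1 - P') * P" .
  show "P' - P = P' * (c - c') * R + R * (c - c') * P' * P - P * (c' - c) * R' * R' * (c' - c) * P"
    unfolding 1 2 5 using P by (simp add: algebra_simps)
qed

locale simple_compact_diag =
  fixes b :: cop
  assumes diag_b: "is_diag (mat_of b)" and cpt_b: "cpt b"
    and distinct_b: "\<And>i j. i \<noteq> j \<Longrightarrow> mat_of b i i \<noteq> mat_of b j j"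
begin

abbreviation eig :: "nat \<Rightarrow> complex" where
  "eig i \<equiv> mat_of b i i"

text \<open>Entry (i, j) of the commutator with \<open>b\<close> is a multiple of
  \<open>V i j\<close> by the difference of two distinct entries of \<open>b\<close>.\<close>

lemma commute_imp_diag:
  assumes "V * b = b * V" shows "is_diag (mat_of V)"
  unfolding is_diag_def
proof (intro allI impI)
  fix i j :: nat assume "i \<noteq> j"
  have "app b (unit_vec j) = cmul (eig j) (unit_vec j)"
    by (rule coord_inject_ext) (simp add: coord_app_diag[OF diag_b])
  then have "coord (app (V * b) (unit_vec j)) i = eig j * mat_of V i j"
    by (simp add: mat_of_def[of V])
  moreover have "coord (app (b * V) (unit_vec j)) i = eig i * mat_of V i j"
    by (simp add: coord_app_diag[OF diag_b]) (simp add: mat_of_def[of V])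
  ultimately show "mat_of V i j = 0" using assms distinct_b[OF \<open>i \<noteq> j\<close>] by simp
qed

text \<open>For \<open>c\<close> in the unitary orbit this is the eigenprojection of
  \<open>c\<close> at \<open>eig i\<close>; the conjugating unitary is chosen arbitrarily.\<close>

definition spec_proj :: "cop \<Rightarrow> nat \<Rightarrow> cop" where
  "spec_proj c i = (let u = SOME u. unitary u \<and> c = u * b * adj u in u * proj i * adj u)"

text \<open>Two unitaries that give the same conjugate of \<open>b\<close> differ by one commuting
  with \<open>b\<close>. It is diagonal, hence commutes with \<open>proj i\<close>, and the choice
  does not matter.\<close>

lemma spec_proj_unitary_conj:
  assumes u: "unitary u" shows "spec_proj (u * b * adj u) i = u * proj i * adj u"
proof -
  define u' where "u' = (SOME v. unitary v \<and> u * b * adj u = v * b * adj v)"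
  have "\<exists>v. unitary v \<and> u * b * adj u = v * b * adj v" using u by blast
  then have u': "unitary u'" "u * b * adj u = u' * b * adj u'"
    unfolding u'_def by (rule someI2_ex; simp)+
  have "(adj u' * u) * b = adj u' * (u * b * adj u) * u"
    using u by (simp add: mult.assoc unitary_cancel)
  also have "\<dots> = b * (adj u' * u)"
    unfolding u'(2) using u' by (simp add: mult.assoc unitary_cancel)
  finally have "(adj u' * u) * proj i = proj i * (adj u' * u)"
    using commute_imp_diag is_diag_iff_commute_proj by blast
  then have "u' * ((adj u' * u) * proj i) * adj u = u' * (proj i * (adj u' * u)) * adj u" by simp
  then have "u * proj i * adj u = u' * proj i * adj u'"
    using u u'(1) by (simp add: mult.assoc unitary_cancel)
  then show ?thesis by (simp add: spec_proj_def u'_def[symmetric])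
qed

text \<open>Since the eigenvalues tend to 0, only finitely many can come closer to
  \<open>eig i\<close> than half its modulus.\<close>

lemma eig_gap:
  assumes "eig i \<noteq> 0"
  obtains g where "0 < g" "\<And>j. j \<noteq> i \<Longrightarrow> g \<le> cmod (eig j - eig i)"
proof -
  obtain N where N: "\<forall>j\<ge>N. norm (eig j - 0) < cmod (eig i) / 2"
    using LIMSEQ_D[OF cpt_diag_entries_tendsto_0[OF cpt_b diag_b], of "cmod (eig i) / 2"] assms by auto
  define g where "g = Min (insert (cmod (eig i) / 2) ((\<lambda>j. cmod (eig j - eig i)) ` ({..<N} - {i})))"
  have "0 < g" using assms distinct_b by (auto simp: g_def)
  moreover have "g \<le> cmod (eig j - eig i)" if "j \<noteq> i" for j
  proof (cases "j < N")
    case True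
    then show ?thesis unfolding g_def using that by (intro Min_le) auto
  next
    case False
    then have "cmod (eig j) < cmod (eig i) / 2" using N by auto
    then have "cmod (eig i) / 2 \<le> cmod (eig j - eig i)"
      using norm_triangle_ineq2[of "eig i" "eig j"] by (simp add: norm_minus_commute)
    then show ?thesis unfolding g_def by (intro Min_le_iff[THEN iffD2]) auto
  qed
  ultimately show thesis using that by blast
qed

text \<open>The reduced resolvent at a nonzero (hence isolated) eigenvalue is bounded by the same constant
  at every point of the orbit.\<close>

lemma reduced_resolvent:
  assumes "eig i \<noteq> 0"
  obtains C where "0 \<le> C"
    "\<And>u. unitary u \<Longrightarrow> \<exists>R. norm R \<le> C \<and>
      R * (u * b * adj u - scal (eig i)) = 1 - spec_proj (u * b * adj u) i \<and>
      (u * b * adj u - scal (eig i)) * R = 1 - spec_proj (u * b * adj u) i"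
proof -
  obtain g where g: "0 < g" "\<And>j. j \<noteq> i \<Longrightarrow> g \<le> cmod (eig j - eig i)"
    using eig_gap[OF assms] by blast
  define r where "r j = (if j = i then 0 else 1 / (eig j - eig i))" for j
  have rb: "cmod (r j) \<le> 1 / g" for j
    using g(1) g(2)[of j] by (cases "j = i") (auto simp: r_def norm_divide frac_le)
  define R where "R = diag_op r"
  have cR: "coord (app R x) j = r j * coord x j" for x j
    unfolding R_def by (rule coord_diag_op[OF rb])
  have "\<And>j. j \<noteq> i \<Longrightarrow> eig j - eig i \<noteq> 0" using distinct_b by auto
  then have R1: "R * (b - scal (eig i)) = 1 - proj i" and R2: "(b - scal (eig i)) * R = 1 - proj i"
    by (intro cop_eqI coord_inject_ext;
        simp add: cR coord_app_diag[OF diag_b] r_def divide_simps; simp add: algebra_simps)+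
  have "\<exists>R'. norm R' \<le> 1 / g \<and>
      R' * (u * b * adj u - scal (eig i)) = 1 - spec_proj (u * b * adj u) i \<and>
      (u * b * adj u - scal (eig i)) * R' = 1 - spec_proj (u * b * adj u) i" if u: "unitary u" for u
  proof (intro exI conjI)
    have sc: "u * scal (eig i) * adj u = scal (eig i)"
      using u by (simp add: scal_commute mult.assoc unitary_cancel)
    have c: "u * b * adj u - scal (eig i) = u * (b - scal (eig i)) * adj u"
      by (simp add: right_diff_distrib left_diff_distrib sc)
    have 1: "1 - spec_proj (u * b * adj u) i = u * (1 - proj i) * adj u"
      using u by (simp add: spec_proj_unitary_conj right_diff_distrib left_diff_distrib unitary_cancel)
    show "norm (u * R * adj u) \<le> 1 / g"
      using norm_unitary_conj_le[OF u, of R] norm_diag_op_le[of r, OF rb] unfolding R_def by linarith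
    have "u * R * adj u * (u * (b - scal (eig i)) * adj u) = u * (R * (b - scal (eig i))) * adj u"
      using u by (simp add: mult.assoc unitary_cancel)
    then show "u * R * adj u * (u * b * adj u - scal (eig i)) = 1 - spec_proj (u * b * adj u) i"
      unfolding c 1 R1 .
    have "(u * (b - scal (eig i)) * adj u) * (u * R * adj u) = u * ((b - scal (eig i)) * R) * adj u"
      using u by (simp add: mult.assoc unitary_cancel)
    then show "(u * b * adj u - scal (eig i)) * (u * R * adj u) = 1 - spec_proj (u * b * adj u) i"
      unfolding c 1 R2 .
  qed
  then show thesis using g(1) by (intro that[of "1 / g"]) auto
qed

lemma spec_proj_algebra:
  assumes "unitary u" and c: "c = u * b * adj u"
  shows "spec_proj c i * spec_proj c i = spec_proj c i" "norm (spec_proj c i) \<le> 1"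
    "(c - scal (eig i)) * spec_proj c i = 0" "spec_proj c i * (c - scal (eig i)) = 0"
proof -
  have P: "spec_proj c i = u * proj i * adj u" unfolding c by (rule spec_proj_unitary_conj) fact
  show "spec_proj c i * spec_proj c i = spec_proj c i"
    unfolding P using assms(1) by (simp add: mult.assoc unitary_cancel) (simp add: mult.assoc[symmetric] proj_proj)
  have "norm (proj i) \<le> 1" unfolding proj_def by (rule norm_diag_op_le) auto
  then show "norm (spec_proj c i) \<le> 1" using norm_unitary_conj_le[OF assms(1), of "proj i"] unfolding P by linarith
  have bP: "b * proj i = scal (eig i) * proj i" "proj i * b = proj i * scal (eig i)"
    by (intro cop_eqI coord_inject_ext; simp add: coord_app_diag[OF diag_b])+
  have "c * spec_proj c i = u * (b * proj i) * adj u" "spec_proj c i * c = u * (proj i * b) * adj u"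
    unfolding P unfolding c using assms(1) by (simp_all add: mult.assoc unitary_cancel)
  then show "(c - scal (eig i)) * spec_proj c i = 0" "spec_proj c i * (c - scal (eig i)) = 0"
    unfolding bP P by (simp_all add: left_diff_distrib right_diff_distrib scal_commute_left scal_commute mult.assoc)
qed

text \<open>The commutator equation for \<open>B\<close> is inherited by its spectral projections.
  Nothing is known about continuity of the reduced resolvents along the curve, only their uniform
  bound, which dictates the use of the asymmetric second identity.\<close>

lemma spec_proj_derivative:
  fixes B :: "real \<Rightarrow> cop"
  assumes B: "\<And>s. s \<in> S \<Longrightarrow> \<exists>u. unitary u \<and> B s = u * b * adj u" and t: "t \<in> S"
    and D: "((\<lambda>s. (1 / (s - t)) *\<^sub>R (B s - B t)) \<longlongrightarrow> Y * B t - B t * Y) (at t within S)"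
    and i: "eig i \<noteq> 0"
  shows "((\<lambda>s. (1 / (s - t)) *\<^sub>R (spec_proj (B s) i - spec_proj (B t) i)) \<longlongrightarrow>
      Y * spec_proj (B t) i - spec_proj (B t) i * Y) (at t within S)"
proof -
  obtain C where C: "0 \<le> C" and ex: "\<And>u. unitary u \<Longrightarrow> \<exists>R. norm R \<le> C \<and>
      R * (u * b * adj u - scal (eig i)) = 1 - spec_proj (u * b * adj u) i \<and>
      (u * b * adj u - scal (eig i)) * R = 1 - spec_proj (u * b * adj u) i"
    using reduced_resolvent[OF i] by blast
  define P where "P s = spec_proj (B s) i" for s
  define l where "l = scal (eig i)"
  have "\<exists>R. norm R \<le> C \<and> R * (B s - l) = 1 - P s \<and> (B s - l) * R = 1 - P s" if "s \<in> S" for s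
    using B[OF that] ex unfolding P_def l_def by auto
  then obtain R where R: "\<And>s. s \<in> S \<Longrightarrow> norm (R s) \<le> C \<and> R s * (B s - l) = 1 - P s \<and> (B s - l) * R s = 1 - P s"
    by metis
  have P: "P s * P s = P s \<and> norm (P s) \<le> 1 \<and> (B s - l) * P s = 0 \<and> P s * (B s - l) = 0" if "s \<in> S" for s
    using B[OF that] spec_proj_algebra unfolding P_def l_def by metis
  define \<Delta> where "\<Delta> s = (1 / (s - t)) *\<^sub>R (B s - B t)" for s
  define c where "c = B t"
  define D0 where "D0 = Y * c - c * Y"
  have in_S: "\<forall>\<^sub>F s in at t within S. s \<in> S \<and> s \<noteq> t"
    by (auto simp: eventually_at_filter)
  have \<Delta>: "(\<Delta> \<longlongrightarrow> D0) (at t within S)" using D by (simp add: \<Delta>_def[abs_def] D0_def c_def)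
  have diff: "B s - B t = (s - t) *\<^sub>R \<Delta> s" if "s \<noteq> t" for s using that by (simp add: \<Delta>_def)
  have "((\<lambda>s. (s - t) *\<^sub>R \<Delta> s) \<longlongrightarrow> (t - t) *\<^sub>R D0) (at t within S)"
    by (intro tendsto_intros \<Delta>)
  then have "((\<lambda>s. (s - t) *\<^sub>R \<Delta> s) \<longlongrightarrow> 0) (at t within S)" by simp
  then have "((\<lambda>s. B s - B t) \<longlongrightarrow> 0) (at t within S)"
    by (rule Lim_transform_eventually) (rule eventually_mono[OF in_S], simp add: diff)
  then have B0: "((\<lambda>s. norm (B s - B t)) \<longlongrightarrow> 0) (at t within S)"
    by (rule tendsto_norm_zero)
  have bound3: "norm (x * y * z) \<le> norm x * norm y * norm z" for x y z :: cop
    by (rule order_trans[OF norm_mult_ineq mult_right_mono[OF norm_mult_ineq norm_ge_zero]])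
  \<comment> \<open>Lipschitz dependence on \<open>B\<close> gives the continuity of
    \<open>P\<close> at \<open>t\<close>, which the linear terms of the difference quotient
    require.\<close>
  have Pb: "norm (P s - P t) \<le> 2 * C * norm (B s - B t)" if s: "s \<in> S" for s
  proof -
    have "P s - P t = P s * (c - B s) * R t - R s * (B s - c) * P t"
      using P[OF s] P[OF t] R[OF s] R[OF t] unfolding c_def
      by (intro idempotent_difference_resolvent(1)[where l = l]) auto
    also have "norm \<dots> \<le> norm (P s * (c - B s) * R t) + norm (R s * (B s - c) * P t)"
      by (rule norm_triangle_ineq4)
    also have "\<dots> \<le> norm (P s) * norm (c - B s) * norm (R t) + norm (R s) * norm (B s - c) * norm (P t)"
      by (intro add_mono bound3)
    also have "\<dots> \<le> 1 * norm (c - B s) * C + C * norm (B s - c) * 1"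
      using P[OF s] P[OF t] R[OF s] R[OF t] C by (intro add_mono mult_mono) auto
    finally show ?thesis by (simp add: c_def norm_minus_commute)
  qed
  have "((\<lambda>s. P s - P t) \<longlongrightarrow> 0) (at t within S)"
  proof (rule Lim_null_comparison)
    show "\<forall>\<^sub>F s in at t within S. norm (P s - P t) \<le> 2 * C * norm (B s - B t)"
      using in_S by (rule eventually_mono) (use Pb in blast)
    show "((\<lambda>s. 2 * C * norm (B s - B t)) \<longlongrightarrow> 0) (at t within S)"
      using tendsto_mult[OF tendsto_const B0] by simp
  qed
  then have Pt: "(P \<longlongrightarrow> P t) (at t within S)" by (rule LIM_zero_cancel)
  \<comment> \<open>The quadratic term after division by \<open>s - t\<close>: one difference has
    become the convergent quotient, the other still tends to 0, and \<open>R s\<close> enters only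
    through its bound.\<close>
  define rest where "rest s = P t * \<Delta> s * R s * R s * (B s - c) * P t" for s
  have rb: "norm (rest s) \<le> norm (\<Delta> s) * (C * C) * norm (B s - B t)" if s: "s \<in> S" for s
  proof -
    have "rest s = P t * (\<Delta> s * (R s * R s) * (B s - c)) * P t" by (simp add: rest_def mult.assoc)
    also have "norm \<dots> \<le> norm (P t) * norm (\<Delta> s * (R s * R s) * (B s - c)) * norm (P t)"
      by (rule bound3)
    also have "\<dots> \<le> 1 * norm (\<Delta> s * (R s * R s) * (B s - c)) * 1"
      using P[OF t] by (intro mult_mono) auto
    also have "\<dots> \<le> norm (\<Delta> s) * norm (R s * R s) * norm (B s - c)"
      using bound3[of "\<Delta> s" "R s * R s" "B s - c"] by simp
    also have "\<dots> \<le> norm (\<Delta> s) * (norm (R s) * norm (R s)) * norm (B s - c)"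
      by (intro mult_right_mono mult_left_mono norm_mult_ineq) auto
    also have "\<dots> \<le> norm (\<Delta> s) * (C * C) * norm (B s - c)"
      using R[OF s] C by (intro mult_right_mono mult_left_mono mult_mono) auto
    finally show ?thesis by (simp add: c_def)
  qed
  have rest: "(rest \<longlongrightarrow> 0) (at t within S)"
  proof (rule Lim_null_comparison)
    show "\<forall>\<^sub>F s in at t within S. norm (rest s) \<le> norm (\<Delta> s) * (C * C) * norm (B s - B t)"
      using in_S by (rule eventually_mono) (use rb in blast)
    show "((\<lambda>s. norm (\<Delta> s) * (C * C) * norm (B s - B t)) \<longlongrightarrow> 0) (at t within S)"
      using tendsto_mult[OF tendsto_mult[OF tendsto_norm[OF \<Delta>] tendsto_const] B0] by simp
  qed
  have eq: "(1 / (s - t)) *\<^sub>R (P s - P t) = - (P s * \<Delta> s * R t) - R t * \<Delta> s * P s * P t - rest s"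
    if s: "s \<in> S" "s \<noteq> t" for s
  proof -
    have "P s - P t = P s * (c - B s) * R t + R t * (c - B s) * P s * P t
        - P t * (B s - c) * R s * R s * (B s - c) * P t"
      using P[OF s(1)] P[OF t] R[OF s(1)] R[OF t] unfolding c_def
      by (intro idempotent_difference_resolvent(2)[where l = l]) auto
    moreover have "c - B s = - ((s - t) *\<^sub>R \<Delta> s)" using diff[OF s(2)] by (simp add: c_def flip: minus_diff_eq[of "B s" "B t"])
    moreover have "P t * (B s - c) * R s * R s * (B s - c) * P t = (s - t) *\<^sub>R rest s"
      using diff[OF s(2)] by (simp add: rest_def c_def)
    ultimately have "P s - P t = (s - t) *\<^sub>R (- (P s * \<Delta> s * R t) - R t * \<Delta> s * P s * P t - rest s)"
      by (simp add: scaleR_right_diff_distrib)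
    then show ?thesis using s(2) by simp
  qed
  have "((\<lambda>s. - (P s * \<Delta> s * R t) - R t * \<Delta> s * P s * P t - rest s) \<longlongrightarrow>
      - (P t * D0 * R t) - R t * D0 * P t * P t - 0) (at t within S)"
    by (intro tendsto_intros Pt \<Delta> rest)
  moreover have "- (P t * D0 * R t) - R t * D0 * P t * P t - 0 = Y * P t - P t * Y"
  proof -
    \<comment> \<open>Scalars are central, so \<open>c\<close> may be replaced by
      \<open>c - l\<close> in the commutator; the reduced resolvent then cancels it.\<close>
    have lc: "l * x = x * l" "x * (l * y) = l * (x * y)" for x y
      by (simp_all add: l_def scal_commute scal_commute_left)
    have D0: "D0 = Y * (c - l) - (c - l) * Y" by (simp add: D0_def algebra_simps lc)
    have "P t * D0 * R t = P t * Y * ((c - l) * R t) - (P t * (c - l)) * Y * R t"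
      unfolding D0 by (simp add: right_diff_distrib left_diff_distrib mult.assoc)
    also have "\<dots> = P t * Y * (1 - P t)" using P[OF t] R[OF t] by (simp add: c_def)
    finally have 1: "P t * D0 * R t = P t * Y * (1 - P t)" .
    have "R t * D0 * P t = R t * Y * ((c - l) * P t) - (R t * (c - l)) * Y * P t"
      unfolding D0 by (simp add: right_diff_distrib left_diff_distrib mult.assoc)
    also have "\<dots> = - ((1 - P t) * Y * P t)" using P[OF t] R[OF t] by (simp add: c_def)
    finally have 2: "R t * D0 * P t * P t = - ((1 - P t) * Y * P t)"
      using P[OF t] by (simp add: mult.assoc)
    show ?thesis unfolding 1 2 by (simp add: algebra_simps)
  qed
  ultimately have "((\<lambda>s. - (P s * \<Delta> s * R t) - R t * \<Delta> s * P s * P t - rest s) \<longlongrightarrow> Y * P t - P t * Y) (at t within S)"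
    by simp
  then have "((\<lambda>s. (1 / (s - t)) *\<^sub>R (P s - P t)) \<longlongrightarrow> Y * P t - P t * Y) (at t within S)"
    by (rule Lim_transform_eventually) (rule eventually_mono[OF in_S], simp add: eq)
  then show ?thesis by (simp add: P_def)
qed

end

section \<open>Projection-valued matrices and their angles\<close>

text \<open>Tuples \<open>w 0, ..., w (m - 1)\<close> are vectors of the \<open>m\<close>-fold
  direct sum, and \<open>q\<close> is an operator on it in block form.\<close>

definition op_mat_app :: "nat \<Rightarrow> (nat \<Rightarrow> nat \<Rightarrow> cop) \<Rightarrow> (nat \<Rightarrow> ell2) \<Rightarrow> nat \<Rightarrow> ell2" where
  "op_mat_app m q w k = (\<Sum>l<m. app (q k l) (w l))"

definition op_mat_form :: "nat \<Rightarrow> (nat \<Rightarrow> nat \<Rightarrow> cop) \<Rightarrow> (nat \<Rightarrow> ell2) \<Rightarrow> real" where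
  "op_mat_form m q w = (\<Sum>k<m. w k \<bullet> op_mat_app m q w k)"

definition proj_mat :: "nat \<Rightarrow> (nat \<Rightarrow> nat \<Rightarrow> cop) \<Rightarrow> bool" where
  "proj_mat m q \<longleftrightarrow> (\<forall>k<m. \<forall>l<m. adj (q k l) = q l k) \<and>
     (\<forall>k<m. \<forall>r<m. (\<Sum>l<m. q k l * q l r) = q k r)"

lemma op_mat_app_linear:
  "op_mat_app m q (\<lambda>k. x k + y k) k = op_mat_app m q x k + op_mat_app m q y k"
  "op_mat_app m q (\<lambda>k. r *\<^sub>R x k) k = r *\<^sub>R op_mat_app m q x k"
  by (simp_all add: op_mat_app_def sum.distrib scaleR_sum_right)

lemma inner_op_mat_app_swap:
  assumes "proj_mat m q"
  shows "(\<Sum>k<m. op_mat_app m q x k \<bullet> y k) = (\<Sum>k<m. x k \<bullet> op_mat_app m q y k)"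
proof -
  have "(\<Sum>k<m. op_mat_app m q x k \<bullet> y k) = (\<Sum>k<m. \<Sum>l<m. x l \<bullet> app (q l k) (y k))"
    using assms by (intro sum.cong) (auto simp: op_mat_app_def inner_sum_left inner_app_adj proj_mat_def)
  also have "\<dots> = (\<Sum>l<m. \<Sum>k<m. x l \<bullet> app (q l k) (y k))" by (rule sum.swap)
  finally show ?thesis by (simp add: op_mat_app_def inner_sum_right)
qed

lemma op_mat_app_idem:
  assumes q: "proj_mat m q" and k: "k < m"
  shows "op_mat_app m q (op_mat_app m q w) k = op_mat_app m q w k"
proof -
  have "op_mat_app m q (op_mat_app m q w) k = (\<Sum>l<m. \<Sum>r<m. app (q k l * q l r) (w r))"
    by (simp add: op_mat_app_def app_sum_right)
  also have "\<dots> = (\<Sum>r<m. \<Sum>l<m. app (q k l * q l r) (w r))" by (rule sum.swap)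
  also have "\<dots> = (\<Sum>r<m. app (\<Sum>l<m. q k l * q l r) (w r))"
    by (simp only: app_sum_left)
  also have "\<dots> = op_mat_app m q w k" using q k by (simp add: proj_mat_def op_mat_app_def)
  finally show ?thesis .
qed

lemma op_mat_form_eq_norm:
  assumes q: "proj_mat m q"
  shows "(\<Sum>k<m. (norm (op_mat_app m q w k))\<^sup>2) = op_mat_form m q w"
    and "(\<Sum>k<m. (norm (w k - op_mat_app m q w k))\<^sup>2) = (\<Sum>k<m. (norm (w k))\<^sup>2) - op_mat_form m q w"
proof -
  define x where "x = op_mat_app m q w"
  have "(\<Sum>k<m. x k \<bullet> x k) = (\<Sum>k<m. w k \<bullet> op_mat_app m q x k)"
    using inner_op_mat_app_swap[OF q, of w x] by (simp add: x_def)
  also have "\<dots> = (\<Sum>k<m. w k \<bullet> x k)"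
    using op_mat_app_idem[OF q] by (simp add: x_def)
  finally have xx: "(\<Sum>k<m. x k \<bullet> x k) = (\<Sum>k<m. w k \<bullet> x k)" .
  then show "(\<Sum>k<m. (norm (op_mat_app m q w k))\<^sup>2) = op_mat_form m q w"
    by (simp add: op_mat_form_def x_def power2_norm_eq_inner)
  have "(\<Sum>k<m. (norm (w k - x k))\<^sup>2) = (\<Sum>k<m. (norm (w k))\<^sup>2) - 2 * (\<Sum>k<m. w k \<bullet> x k) + (\<Sum>k<m. x k \<bullet> x k)"
    by (simp add: power2_norm_eq_inner inner_diff_left inner_diff_right inner_commute[of "x _" "w _"]
        sum_subtractf sum.distrib sum_distrib_left algebra_simps)
  then show "(\<Sum>k<m. (norm (w k - op_mat_app m q w k))\<^sup>2) = (\<Sum>k<m. (norm (w k))\<^sup>2) - op_mat_form m q w"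
    using xx by (simp add: op_mat_form_def x_def)
qed

lemma op_mat_form_bounds:
  assumes q: "proj_mat m q"
  shows "0 \<le> op_mat_form m q w" and "op_mat_form m q w \<le> (\<Sum>k<m. (norm (w k))\<^sup>2)"
  using op_mat_form_eq_norm[OF q, of w] sum_nonneg[of "{..<m}" "\<lambda>k. (norm (op_mat_app m q w k))\<^sup>2"]
    sum_nonneg[of "{..<m}" "\<lambda>k. (norm (w k - op_mat_app m q w k))\<^sup>2"] by simp_all

lemma L2_op_mat_app_le:
  assumes q: "proj_mat m q"
  shows "L2_set (\<lambda>k. norm (op_mat_app m q w k)) {..<m} \<le> L2_set (\<lambda>k. norm (w k)) {..<m}"
  using op_mat_form_eq_norm(1)[OF q, of w] op_mat_form_bounds(2)[OF q, of w]
  by (simp add: L2_set_def)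

text \<open>Since \<open>Y\<close> is skew, only the off-diagonal blocks with respect to the range
  of \<open>q\<close> survive: the form is twice the pairing of \<open>(1 - q) w\<close> with
  \<open>Y q w\<close>. Cauchy-Schwarz then produces the product of the lengths of the two
  components of \<open>w\<close>.\<close>

lemma op_mat_form_commutator_le:
  assumes q: "proj_mat m q" and Y: "adj Y = - Y"
  shows "\<bar>op_mat_form m (\<lambda>k l. Y * q k l - q k l * Y) w\<bar>
    \<le> 2 * norm Y * sqrt (op_mat_form m q w * ((\<Sum>k<m. (norm (w k))\<^sup>2) - op_mat_form m q w))"
proof -
  define x where "x = op_mat_app m q w"
  define y where "y k = w k - x k" for k
  have skew: "u \<bullet> app Y v = - (app Y u \<bullet> v)" for u v
    using inner_app_adj[of Y u v] Y by simp
  have "op_mat_form m (\<lambda>k l. Y * q k l - q k l * Y) w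
      = (\<Sum>k<m. w k \<bullet> app Y (x k)) - (\<Sum>k<m. w k \<bullet> op_mat_app m q (\<lambda>l. app Y (w l)) k)"
    by (simp add: op_mat_form_def op_mat_app_def x_def app_sum_right sum_subtractf inner_diff_right)
  also have "(\<Sum>k<m. w k \<bullet> op_mat_app m q (\<lambda>l. app Y (w l)) k) = (\<Sum>k<m. x k \<bullet> app Y (w k))"
    using inner_op_mat_app_swap[OF q, of w "\<lambda>l. app Y (w l)"] by (simp add: x_def)
  also have "(\<Sum>k<m. w k \<bullet> app Y (x k)) - (\<Sum>k<m. x k \<bullet> app Y (w k)) = (\<Sum>k<m. 2 * (y k \<bullet> app Y (x k)))"
    unfolding sum_subtractf[symmetric]
  proof (rule sum.cong)
    fix k
    have w: "w k = x k + y k" by (simp add: y_def)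
    have "x k \<bullet> app Y (y k) = - (y k \<bullet> app Y (x k))"
      using skew[of "x k" "y k"] by (simp add: inner_commute)
    then show "w k \<bullet> app Y (x k) - x k \<bullet> app Y (w k) = 2 * (y k \<bullet> app Y (x k))"
      unfolding w by (simp add: inner_add_left inner_add_right)
  qed simp
  finally have "\<bar>op_mat_form m (\<lambda>k l. Y * q k l - q k l * Y) w\<bar> \<le> (\<Sum>k<m. \<bar>2 * (y k \<bullet> app Y (x k))\<bar>)"
    by (simp only: sum_abs)
  also have "\<dots> \<le> (\<Sum>k<m. 2 * norm Y * (\<bar>norm (x k)\<bar> * \<bar>norm (y k)\<bar>))"
  proof (rule sum_mono)
    fix k
    have "\<bar>y k \<bullet> app Y (x k)\<bar> \<le> norm (y k) * (norm Y * norm (x k))"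
      by (rule order_trans[OF Cauchy_Schwarz_ineq2 mult_left_mono[OF norm_app_le norm_ge_zero]])
    then show "\<bar>2 * (y k \<bullet> app Y (x k))\<bar> \<le> 2 * norm Y * (\<bar>norm (x k)\<bar> * \<bar>norm (y k)\<bar>)"
      by (simp add: abs_mult mult_ac)
  qed
  also have "\<dots> = 2 * norm Y * (\<Sum>k<m. \<bar>norm (x k)\<bar> * \<bar>norm (y k)\<bar>)" by (simp only: sum_distrib_left)
  also have "\<dots> \<le> 2 * norm Y * (L2_set (\<lambda>k. norm (x k)) {..<m} * L2_set (\<lambda>k. norm (y k)) {..<m})"
    by (intro mult_left_mono L2_set_mult_ineq) simp
  also have "L2_set (\<lambda>k. norm (x k)) {..<m} * L2_set (\<lambda>k. norm (y k)) {..<m}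
      = sqrt (op_mat_form m q w * ((\<Sum>k<m. (norm (w k))\<^sup>2) - op_mat_form m q w))"
    using op_mat_form_eq_norm[OF q, of w] by (simp add: L2_set_def x_def y_def real_sqrt_mult)
  finally show ?thesis .
qed

lemma tendsto_op_mat_form:
  assumes "\<And>k l. k < m \<Longrightarrow> l < m \<Longrightarrow> ((\<lambda>s. Q s k l) \<longlongrightarrow> q k l) F"
  shows "((\<lambda>s. op_mat_form m (Q s) w) \<longlongrightarrow> op_mat_form m q w) F"
  unfolding op_mat_form_def op_mat_app_def
  by (intro tendsto_sum tendsto_inner tendsto_const bounded_linear.tendsto[OF bounded_linear_app_left] assms) auto

lemma op_mat_form_diff_scaleR:
  "op_mat_form m (\<lambda>k l. r *\<^sub>R (p k l - q k l)) w = r * (op_mat_form m p w - op_mat_form m q w)"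
  by (simp add: op_mat_form_def op_mat_app_def scaleR_sum_right[symmetric] sum_subtractf inner_diff_right
      scaleR_diff_right[symmetric] sum_distrib_left[symmetric] del: scaleR_diff_right)

text \<open>Comparison with the circle: \<open>\<bar>f'\<bar> \<le> 2 F sqrt (f (1 - f))\<close> says that the angle \<open>arcsin (2 f - 1)\<close> moves with
  speed at most \<open>2 F\<close>. The factor \<open>\<rho> < 1\<close> keeps it differentiable where \<open>f\<close> is \<open>0\<close> or \<open>1\<close>.\<close>

lemma arcsin_increase_le:
  fixes f F :: "real \<Rightarrow> real"
  assumes ab: "a \<le> b" and \<rho>: "0 < \<rho>" "\<rho> < 1"
    and f01: "\<And>t. t \<in> {a..b} \<Longrightarrow> 0 \<le> f t \<and> f t \<le> 1"
    and deriv: "\<And>t. t \<in> {a..b} \<Longrightarrow> \<exists>d. (f has_real_derivative d) (at t within {a..b}) \<and>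
      \<bar>d\<bar> \<le> 2 * F t * sqrt (f t * (1 - f t))"
    and F0: "\<And>t. t \<in> {a..b} \<Longrightarrow> 0 \<le> F t" and F: "(F has_integral l) {a..b}"
  shows "arcsin (\<rho> * (2 * f b - 1)) - arcsin (\<rho> * (2 * f a - 1)) \<le> 2 * l"
proof -
  obtain d where d: "\<And>t. t \<in> {a..b} \<Longrightarrow> (f has_real_derivative d t) (at t within {a..b}) \<and>
      \<bar>d t\<bar> \<le> 2 * F t * sqrt (f t * (1 - f t))" using deriv by metis
  define x where "x t = \<rho> * (2 * f t - 1)" for t
  \<comment> \<open>The last conjunct uses that \<open>4 f (1 - f)\<close> is
    \<open>1 - (2 f - 1)\<^sup>2\<close>, and \<rho> only shrinks the square.\<close>
  have x: "- 1 < x t \<and> x t < 1 \<and> 4 * (f t * (1 - f t)) \<le> 1 - (x t)\<^sup>2" if "t \<in> {a..b}" for t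
  proof -
    have "\<bar>2 * f t - 1\<bar> \<le> 1" using f01[OF that] by auto
    then have "\<bar>x t\<bar> \<le> \<rho> * 1" unfolding x_def abs_mult using \<rho> by (intro mult_mono) auto
    moreover have "(x t)\<^sup>2 \<le> (2 * f t - 1)\<^sup>2"
      unfolding x_def using \<rho> by (simp add: power_mult_distrib mult_left_le_one_le power_le_one)
    ultimately show ?thesis using \<rho> by (auto simp: power2_eq_square algebra_simps)
  qed
  define h' where "h' t = inverse (sqrt (1 - (x t)\<^sup>2)) * (\<rho> * (2 * d t))" for t
  have "((\<lambda>t. arcsin (x t)) has_vector_derivative h' t) (at t within {a..b})" if t: "t \<in> {a..b}" for t
  proof -
    have dx: "(x has_real_derivative \<rho> * (2 * d t)) (at t within {a..b})"
      unfolding x_def[abs_def] using d[OF t] by (auto intro!: derivative_eq_intros)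
    have "DERIV arcsin (x t) :> inverse (sqrt (1 - (x t)\<^sup>2))" using x[OF t] by (intro DERIV_arcsin) auto
    from DERIV_chain2[OF this dx] have "((\<lambda>t. arcsin (x t)) has_real_derivative h' t) (at t within {a..b})"
      unfolding h'_def .
    then show ?thesis by (simp add: has_real_derivative_iff_has_vector_derivative)
  qed
  then have "(h' has_integral arcsin (x b) - arcsin (x a)) {a..b}"
    by (intro fundamental_theorem_of_calculus ab) auto
  moreover have "((\<lambda>t. 2 * F t) has_integral 2 * l) {a..b}" using F by (rule has_integral_mult_right)
  moreover have "h' t \<le> 2 * F t" if t: "t \<in> {a..b}" for t
  proof -
    have x2: "0 < 1 - (x t)\<^sup>2" using x[OF t] by (simp add: abs_square_less_1 abs_less_iff)
    define S where "S = sqrt (1 - (x t)\<^sup>2)"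
    have S: "0 < S" using x2 by (simp add: S_def)
    have Q: "2 * sqrt (f t * (1 - f t)) \<le> S"
    proof -
      have "2 * sqrt (f t * (1 - f t)) = sqrt (4 * (f t * (1 - f t)))" by (simp add: real_sqrt_mult)
      also have "\<dots> \<le> S" unfolding S_def using x[OF t] by (intro real_sqrt_le_mono) simp
      finally show ?thesis .
    qed
    have "\<bar>h' t\<bar> \<le> \<bar>d t\<bar> * 2 / S"
      using S \<rho> by (simp add: h'_def S_def[symmetric] abs_mult field_simps mult_left_le_one_le)
    moreover have "\<bar>d t\<bar> * 2 \<le> 2 * F t * (2 * sqrt (f t * (1 - f t)))"
      using d[OF t] by simp
    then have "\<bar>d t\<bar> * 2 \<le> 2 * F t * S"
      using mult_left_mono[OF Q, of "2 * F t"] F0[OF t] by linarith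
    then have "\<bar>d t\<bar> * 2 / S \<le> 2 * F t" using S by (simp add: divide_le_eq)
    ultimately show ?thesis by linarith
  qed
  ultimately have "arcsin (x b) - arcsin (x a) \<le> 2 * l" by (rule has_integral_le)
  then show ?thesis by (simp add: x_def)
qed

section \<open>The exponential flow on approximate eigenvectors\<close>

lemma exp_scal: "exp (scal c) = scal (exp c)"
proof -
  have sc: "scal (c + d) = scal c + scal d" "scal (r *\<^sub>R c) = r *\<^sub>R scal c" for c d r
    by (intro cop_eqI coord_inject_ext,
        simp add: algebra_simps scaleR_conv_of_real[where 'a = complex])+
  have "norm (scal c) \<le> norm c" for c using norm_scal[of c 1] by simp
  then have "bounded_linear scal" by (intro bounded_linear_intro[of _ 1]) (auto simp: sc)
  from bounded_linear.sums[OF this exp_converges[of c]]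
  have "(\<lambda>n. scal (c ^ n /\<^sub>R fact n)) sums scal (exp c)" .
  moreover have "scal (c ^ n) = scal c ^ n" for n
    by (induction n) (simp_all flip: scal_algebra(3))
  ultimately have "(\<lambda>n. scal c ^ n /\<^sub>R fact n) sums scal (exp c)" by (simp add: sc)
  then show ?thesis using exp_converges[of "scal c"] sums_unique2 by blast
qed

text \<open>The velocity of the orbit of \<open>v\<close> has constant norm, because the exponential
  of a skew operator is an isometry; the mean value inequality does the rest. Negative times are
  handled by replacing \<open>W\<close> with \<open>- W\<close>.\<close>

lemma norm_exp_app_diff_le:
  assumes W: "adj W = - W"
  shows "norm (app (exp (t *\<^sub>R W)) v - v) \<le> \<bar>t\<bar> * norm (app W v)"
proof -
  have pos: "norm (app (exp (t *\<^sub>R W)) v - v) \<le> t * norm (app W v)"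
    if t: "0 < t" and W: "adj W = - W" for t W
  proof -
    have der: "((\<lambda>t. app (exp (t *\<^sub>R W)) v) has_vector_derivative app (exp (s *\<^sub>R W) * W) v) (at s)" for s
      by (rule bounded_linear.has_vector_derivative[OF bounded_linear_app_left
            exp_scaleR_has_vector_derivative_right])
    have cont: "continuous_on {0..t} (\<lambda>t. app (exp (t *\<^sub>R W)) v)"
      by (intro continuous_at_imp_continuous_on ballI has_vector_derivative_continuous[OF der])
    obtain s where "norm (app (exp (t *\<^sub>R W)) v - app (exp (0 *\<^sub>R W)) v)
        \<le> norm ((t - 0) *\<^sub>R app (exp (s *\<^sub>R W) * W) v)"
      using mvt_general[OF t cont, of "\<lambda>s h. h *\<^sub>R app (exp (s *\<^sub>R W) * W) v"]
        der[unfolded has_vector_derivative_def] by blast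
    also have "\<dots> = t * norm (app (exp (s *\<^sub>R W)) (app W v))" using t by simp
    also have "norm (app (exp (s *\<^sub>R W)) (app W v)) = norm (app W v)"
      using W by (intro norm_app_isometry adj_exp_anti) simp
    finally show ?thesis by simp
  qed
  consider "t = 0" | "0 < t" | "0 < - t" by linarith
  then show ?thesis
  proof cases
    case 3
    then show ?thesis using pos[of "- t" "- W"] W by simp
  qed (use pos W in auto)
qed

text \<open>The scalar part of \<open>Z\<close> is central and factors out of the exponential as a
  phase. What remains is the flow of the skew operator \<open>Z - \<i> a\<close>, which is small on
  vectors that almost satisfy the eigenvalue equation.\<close>

lemma norm_exp_app_diff_phase_le:
  assumes Z: "adj Z = - Z"
  shows "norm (app (exp (t *\<^sub>R Z)) v - cmul (cis (t * a)) v) \<le> \<bar>t\<bar> * norm (app Z v - cmul (\<i> * of_real a) v)"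
proof -
  define W where "W = Z - scal (\<i> * of_real a)"
  have "scal (- (\<i> * of_real a)) = - scal (\<i> * of_real a)"
    by (intro cop_eqI coord_inject_ext) simp
  then have W: "adj W = - W" using Z by (simp add: W_def)
  have tZ: "t *\<^sub>R Z = scal (\<i> * of_real (t * a)) + t *\<^sub>R W"
    unfolding W_def by (intro cop_eqI coord_inject_ext) (simp add: algebra_simps)
  have "exp (t *\<^sub>R Z) = exp (scal (\<i> * of_real (t * a))) * exp (t *\<^sub>R W)"
    unfolding tZ by (rule exp_add_commuting) (simp only: scal_commute)
  also have "exp (scal (\<i> * of_real (t * a))) = scal (cis (t * a))"
    unfolding exp_scal by (simp only: cis_conv_exp)
  finally have "app (exp (t *\<^sub>R Z)) v - cmul (cis (t * a)) v = cmul (cis (t * a)) (app (exp (t *\<^sub>R W)) v - v)"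
    by simp
  then have "norm (app (exp (t *\<^sub>R Z)) v - cmul (cis (t * a)) v) = norm (app (exp (t *\<^sub>R W)) v - v)"
    by (simp only: norm_cmul norm_cis mult_1)
  also have "\<dots> \<le> \<bar>t\<bar> * norm (app W v)" by (rule norm_exp_app_diff_le[OF W])
  finally show ?thesis by (simp add: W_def)
qed

section \<open>Curves in the orbit\<close>

text \<open>Entry (k, l) of the block diagonal operator whose block over the \<open>i\<close>-th
  eigenspace is the rank one matrix of \<open>\<alpha> i\<close>. Outside \<open>J\<close> all
  blocks equal that of \<open>\<alpha>0\<close>, attached to
  \<open>1 - (\<Sum>i\<in>J. P i)\<close>, so that only finitely many projections occur.\<close>

definition fibre_op :: "(nat \<Rightarrow> nat \<Rightarrow> complex) \<Rightarrow> (nat \<Rightarrow> complex) \<Rightarrow> nat set \<Rightarrow> (nat \<Rightarrow> cop) \<Rightarrow> nat \<Rightarrow> nat \<Rightarrow> cop"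
  where "fibre_op \<alpha> \<alpha>0 J P k l =
    (\<Sum>i\<in>J. scal (\<alpha> i k * cnj (\<alpha> i l) - \<alpha>0 k * cnj (\<alpha>0 l)) * P i) + scal (\<alpha>0 k * cnj (\<alpha>0 l))"

lemma coord_fibre_op:
  assumes "finite J" "\<And>i. i \<notin> J \<Longrightarrow> \<alpha> i = \<alpha>0"
  shows "coord (app (fibre_op \<alpha> \<alpha>0 J proj k l) x) i = \<alpha> i k * cnj (\<alpha> i l) * coord x i"
  using assms
  by (cases "i \<in> J")
     (simp_all add: fibre_op_def app_sum_left if_distrib[of "(*) _"] flip: distrib_right cong: if_cong)

lemma fibre_op_conj:
  assumes u: "unitary u"
  shows "fibre_op \<alpha> \<alpha>0 J (\<lambda>i. u * P i * adj u) k l = u * fibre_op \<alpha> \<alpha>0 J P k l * adj u"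
proof -
  have "u * scal c * adj u = scal c" for c
    using u by (simp add: scal_commute mult.assoc unitary_cancel)
  then show ?thesis
    by (simp add: fibre_op_def distrib_left distrib_right sum_distrib_left sum_distrib_right
        scal_commute_left mult.assoc)
qed

lemma adj_sum: "adj (\<Sum>i\<in>A. f i) = (\<Sum>i\<in>A. adj (f i))"
  by (induction A rule: infinite_finite_induct) auto

text \<open>Over each coordinate the block is the projection onto the line of a unit vector, or
  zero.\<close>

lemma proj_mat_fibre_op:
  assumes J: "finite J" "\<And>i. i \<notin> J \<Longrightarrow> \<alpha> i = \<alpha>0"
    and fib: "\<And>i. (\<Sum>k<m. (cmod (\<alpha> i k))\<^sup>2) = 1 \<or> (\<forall>k<m. \<alpha> i k = 0)"
  shows "proj_mat m (fibre_op \<alpha> \<alpha>0 J proj)"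
  unfolding proj_mat_def
proof (intro conjI allI impI)
  fix k l
  show "adj (fibre_op \<alpha> \<alpha>0 J proj k l) = fibre_op \<alpha> \<alpha>0 J proj l k"
    by (simp add: fibre_op_def adj_sum scal_commute mult.commute[of "cnj _"])
next
  fix k r assume "k < m" "r < m"
  show "(\<Sum>l<m. fibre_op \<alpha> \<alpha>0 J proj k l * fibre_op \<alpha> \<alpha>0 J proj l r) = fibre_op \<alpha> \<alpha>0 J proj k r"
  proof (intro cop_eqI coord_inject_ext)
    fix x i
    have "coord (app (\<Sum>l<m. fibre_op \<alpha> \<alpha>0 J proj k l * fibre_op \<alpha> \<alpha>0 J proj l r) x) i
        = (\<Sum>l<m. \<alpha> i k * cnj (\<alpha> i r) * coord x i * (\<alpha> i l * cnj (\<alpha> i l)))"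
      by (simp add: app_sum_left coord_fibre_op[OF J] mult_ac)
    also have "\<dots> = \<alpha> i k * cnj (\<alpha> i r) * coord x i * of_real (\<Sum>l<m. (cmod (\<alpha> i l))\<^sup>2)"
      by (simp add: sum_distrib_left complex_norm_square[symmetric])
    also have "\<dots> = \<alpha> i k * cnj (\<alpha> i r) * coord x i"
    proof (cases "\<alpha> i k = 0")
      case False
      then have "(\<Sum>l<m. (cmod (\<alpha> i l))\<^sup>2) = 1" using fib[of i] \<open>k < m\<close> by blast
      then show ?thesis by (simp only: of_real_1 mult_1_right)
    qed simp
    finally show "coord (app (\<Sum>l<m. fibre_op \<alpha> \<alpha>0 J proj k l * fibre_op \<alpha> \<alpha>0 J proj l r) x) i
        = coord (app (fibre_op \<alpha> \<alpha>0 J proj k r) x) i"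
      by (simp add: coord_fibre_op[OF J])
  qed
qed

lemma proj_mat_conj:
  assumes u: "unitary u" and q: "proj_mat m q"
  shows "proj_mat m (\<lambda>k l. u * q k l * adj u)"
proof -
  have "u * q k l * adj u * (u * q l r * adj u) = u * (q k l * q l r) * adj u" for k l r
    using u by (simp add: mult.assoc unitary_cancel)
  moreover have "(\<Sum>l<m. u * (q k l * q l r) * adj u) = u * (\<Sum>l<m. q k l * q l r) * adj u" for k r
    by (simp add: sum_distrib_left sum_distrib_right)
  ultimately show ?thesis using q by (simp add: proj_mat_def mult.assoc[symmetric])
qed

lemma L2_set_norm_add:
  "L2_set (\<lambda>k. norm (x k + y k)) A \<le> L2_set (\<lambda>k. norm (x k)) A + L2_set (\<lambda>k. norm (y k)) A"
  by (rule order_trans[OF L2_set_mono L2_set_triangle_ineq]) (auto intro: norm_triangle_ineq)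

lemma L2_set_norm_scaleR:
  "L2_set (\<lambda>k. norm (r *\<^sub>R x k)) A = \<bar>r\<bar> * L2_set (\<lambda>k. norm (x k)) A"
  by (simp add: L2_set_right_distrib)

lemma sum_list_pair_nth:
  fixes \<phi> :: "'a \<Rightarrow> 'b \<Rightarrow> real"
  shows "(\<Sum>(s, v)\<leftarrow>L. \<phi> s v) = (\<Sum>k<length L. \<phi> (fst (L ! k)) (snd (L ! k)))"
  by (simp add: sum_list_sum_nth atLeast0LessThan case_prod_unfold)

definition speed_le :: "(real \<Rightarrow> cop) \<Rightarrow> real set \<Rightarrow> real \<Rightarrow> real \<Rightarrow> bool" where
  "speed_le B S t r \<longleftrightarrow> (\<forall>\<epsilon>>0. \<exists>Y. adj Y = - Y \<and> norm Y \<le> r + \<epsilon> \<and>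
     ((\<lambda>s. (1 / (s - t)) *\<^sub>R (B s - B t)) \<longlongrightarrow> Y * B t - B t * Y) (at t within S))"

context simple_compact_diag
begin

lemma fibre_op_spec_proj:
  assumes "unitary u" "c = u * b * adj u"
  shows "fibre_op \<alpha> \<alpha>0 J (spec_proj c) = (\<lambda>k l. u * fibre_op \<alpha> \<alpha>0 J proj k l * adj u)"
proof -
  have "spec_proj c = (\<lambda>i. u * proj i * adj u)" using assms spec_proj_unitary_conj by auto
  then show ?thesis using fibre_op_conj[OF assms(1), of \<alpha> \<alpha>0 J proj] by (intro ext) simp
qed

lemma fibre_op_derivative:
  fixes \<alpha> :: "nat \<Rightarrow> nat \<Rightarrow> complex" and \<alpha>0 :: "nat \<Rightarrow> complex"
  assumes B: "\<And>s. s \<in> S \<Longrightarrow> \<exists>u. unitary u \<and> B s = u * b * adj u" and t: "t \<in> S"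
    and D: "((\<lambda>s. (1 / (s - t)) *\<^sub>R (B s - B t)) \<longlongrightarrow> Y * B t - B t * Y) (at t within S)"
    and J: "\<And>i. i \<in> J \<Longrightarrow> eig i \<noteq> 0"
  defines "q s \<equiv> fibre_op \<alpha> \<alpha>0 J (spec_proj (B s))"
  shows "((\<lambda>s. (1 / (s - t)) *\<^sub>R (q s k l - q t k l)) \<longlongrightarrow> Y * q t k l - q t k l * Y) (at t within S)"
proof -
  define c where "c i = scal (\<alpha> i k * cnj (\<alpha> i l) - \<alpha>0 k * cnj (\<alpha>0 l))" for i
  have "((\<lambda>s. \<Sum>i\<in>J. c i * ((1 / (s - t)) *\<^sub>R (spec_proj (B s) i - spec_proj (B t) i))) \<longlongrightarrow>
      (\<Sum>i\<in>J. c i * (Y * spec_proj (B t) i - spec_proj (B t) i * Y))) (at t within S)"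
    by (intro tendsto_sum tendsto_mult tendsto_const spec_proj_derivative[OF B t D] J)
  moreover have "(\<Sum>i\<in>J. c i * ((1 / (s - t)) *\<^sub>R (spec_proj (B s) i - spec_proj (B t) i)))
      = (1 / (s - t)) *\<^sub>R (q s k l - q t k l)" for s
    by (simp add: q_def fibre_op_def c_def scaleR_sum_right[symmetric] sum_subtractf right_diff_distrib
        del: scaleR_right_diff_distrib)
  moreover have "(\<Sum>i\<in>J. c i * (Y * spec_proj (B t) i - spec_proj (B t) i * Y)) = Y * q t k l - q t k l * Y"
  proof -
    have "c i * (Y * P - P * Y) = Y * (c i * P) - c i * P * Y" for i P
      by (simp add: c_def right_diff_distrib scal_commute_left mult.assoc)
    then show ?thesis
      by (simp add: q_def fibre_op_def c_def[symmetric] sum_subtractf sum_distrib_left sum_distrib_right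
          distrib_left distrib_right scal_commute)
  qed
  ultimately show ?thesis by simp
qed

lemma fibre_form_derivative:
  assumes B: "\<And>s. s \<in> {a..a'} \<Longrightarrow> \<exists>u. unitary u \<and> B s = u * b * adj u"
    and t: "t \<in> {a..a'}" and aa': "a < a'" and speed: "speed_le B {a..a'} t r" and r: "0 \<le> r"
    and J: "\<And>i. i \<in> J \<Longrightarrow> eig i \<noteq> 0" and pm: "proj_mat m (fibre_op \<alpha> \<alpha>0 J proj)"
    and w: "(\<Sum>k<m. (norm (w k))\<^sup>2) = 1"
  defines "f s \<equiv> op_mat_form m (fibre_op \<alpha> \<alpha>0 J (spec_proj (B s))) w"
  shows "\<exists>d. (f has_real_derivative d) (at t within {a..a'}) \<and> \<bar>d\<bar> \<le> 2 * r * sqrt (f t * (1 - f t))"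
proof -
  define q where "q s = fibre_op \<alpha> \<alpha>0 J (spec_proj (B s))" for s
  have pq: "proj_mat m (q s)" if "s \<in> {a..a'}" for s
    using B[OF that] fibre_op_spec_proj proj_mat_conj[OF _ pm] unfolding q_def by metis
  have f01: "0 \<le> f t" "f t \<le> 1"
    using op_mat_form_bounds[OF pq[OF t], of w] w by (simp_all add: f_def q_def)
  have ex: "\<exists>d. (f has_real_derivative d) (at t within {a..a'}) \<and> \<bar>d\<bar> \<le> 2 * (r + \<epsilon>) * sqrt (f t * (1 - f t))"
    if "0 < \<epsilon>" for \<epsilon>
  proof -
    obtain Y where Y: "adj Y = - Y" "norm Y \<le> r + \<epsilon>"
      "((\<lambda>s. (1 / (s - t)) *\<^sub>R (B s - B t)) \<longlongrightarrow> Y * B t - B t * Y) (at t within {a..a'})"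
      using speed \<open>0 < \<epsilon>\<close> unfolding speed_le_def by blast
    define d where "d = op_mat_form m (\<lambda>k l. Y * q t k l - q t k l * Y) w"
    have "((\<lambda>s. op_mat_form m (\<lambda>k l. (1 / (s - t)) *\<^sub>R (q s k l - q t k l)) w) \<longlongrightarrow> d) (at t within {a..a'})"
      unfolding d_def q_def by (intro tendsto_op_mat_form fibre_op_derivative[OF B t Y(3) J])
    then have "(f has_real_derivative d) (at t within {a..a'})"
      unfolding has_field_derivative_iff by (simp add: op_mat_form_diff_scaleR f_def q_def)
    moreover have "\<bar>d\<bar> \<le> 2 * norm Y * sqrt (f t * (1 - f t))"
      using op_mat_form_commutator_le[OF pq[OF t] Y(1), of w] by (simp add: d_def w f_def q_def)
    then have "\<bar>d\<bar> \<le> 2 * (r + \<epsilon>) * sqrt (f t * (1 - f t))"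
      using Y(2) f01 by (elim order_trans) (intro mult_right_mono; simp)
    ultimately show ?thesis by blast
  qed
  \<comment> \<open>The lift depends on \<epsilon> but the derivative does not: on a nondegenerate
    interval it is unique, so all the bounds concern the same \<open>d\<close>.\<close>
  obtain d where d: "(f has_real_derivative d) (at t within {a..a'})" using ex[of 1] by auto
  have "at t within {a..a'} \<noteq> bot" using t aa' by (simp add: trivial_limit_within)
  then have uniq: "d' = d" if "(f has_real_derivative d') (at t within {a..a'})" for d'
    using that d unfolding has_field_derivative_iff by (rule tendsto_unique)
  have "\<bar>d\<bar> \<le> 2 * r * sqrt (f t * (1 - f t)) + \<epsilon>" if "0 < \<epsilon>" for \<epsilon>
  proof -
    have "\<bar>d\<bar> \<le> 2 * (r + \<epsilon> / 2) * sqrt (f t * (1 - f t))" using ex[of "\<epsilon> / 2"] uniq that by auto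
    also have "\<dots> = 2 * r * sqrt (f t * (1 - f t)) + \<epsilon> * sqrt (f t * (1 - f t))" by (simp add: algebra_simps)
    also have "\<dots> \<le> 2 * r * sqrt (f t * (1 - f t)) + \<epsilon> * 1"
      using f01 that by (intro add_left_mono mult_left_mono) (auto simp: mult_le_one)
    finally show ?thesis by simp
  qed
  then have "\<bar>d\<bar> \<le> 2 * r * sqrt (f t * (1 - f t))" by (rule field_le_epsilon)
  with d show ?thesis by blast
qed

definition orbit_curve :: "(real \<Rightarrow> cop) \<Rightarrow> nat \<Rightarrow> (nat \<Rightarrow> real) \<Rightarrow> (nat \<Rightarrow> real) \<Rightarrow> bool" where
  "orbit_curve B N s ls \<longleftrightarrow> (\<forall>j<N. s j < s (Suc j) \<and>
     (\<forall>t\<in>{s j..s (Suc j)}. \<exists>u. unitary u \<and> B t = u * b * adj u) \<and>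
     (\<exists>F. (F has_integral ls j) {s j..s (Suc j)} \<and>
        (\<forall>t\<in>{s j..s (Suc j)}. 0 \<le> F t \<and> speed_le B {s j..s (Suc j)} t (F t))))"

text \<open>The one-sided derivatives may disagree at the break points, but \<open>f\<close> is one
  function along the whole curve, so the angle increments telescope.\<close>

lemma fibre_form_angle_le:
  assumes curve: "orbit_curve B N s ls" and \<rho>: "0 < \<rho>" "\<rho> < 1"
    and J: "\<And>i. i \<in> J \<Longrightarrow> eig i \<noteq> 0" and pm: "proj_mat m (fibre_op \<alpha> \<alpha>0 J proj)"
    and w: "(\<Sum>k<m. (norm (w k))\<^sup>2) = 1"
  defines "f t \<equiv> op_mat_form m (fibre_op \<alpha> \<alpha>0 J (spec_proj (B t))) w"
  shows "arcsin (\<rho> * (2 * f (s N) - 1)) - arcsin (\<rho> * (2 * f (s 0) - 1)) \<le> 2 * (\<Sum>j<N. ls j)"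
proof -
  define h where "h j = arcsin (\<rho> * (2 * f (s j) - 1))" for j
  have "h (Suc j) - h j \<le> 2 * ls j" if "j < N" for j
  proof -
    have c: "s j < s (Suc j)" "\<And>t. t \<in> {s j..s (Suc j)} \<Longrightarrow> \<exists>u. unitary u \<and> B t = u * b * adj u"
      using curve that unfolding orbit_curve_def by blast+
    obtain F where F: "(F has_integral ls j) {s j..s (Suc j)}"
      "\<And>t. t \<in> {s j..s (Suc j)} \<Longrightarrow> 0 \<le> F t" "\<And>t. t \<in> {s j..s (Suc j)} \<Longrightarrow> speed_le B {s j..s (Suc j)} t (F t)"
    proof -
      have "\<exists>F. (F has_integral ls j) {s j..s (Suc j)} \<and>
        (\<forall>t\<in>{s j..s (Suc j)}. 0 \<le> F t \<and> speed_le B {s j..s (Suc j)} t (F t))"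
        using curve \<open>j < N\<close> by (simp add: orbit_curve_def)
      then show thesis using that by (elim exE conjE) simp
    qed
    have "0 \<le> f t \<and> f t \<le> 1" if t: "t \<in> {s j..s (Suc j)}" for t
    proof -
      have "proj_mat m (fibre_op \<alpha> \<alpha>0 J (spec_proj (B t)))"
        using c(2)[OF t] fibre_op_spec_proj proj_mat_conj[OF _ pm] by metis
      from op_mat_form_bounds[OF this, of w] show ?thesis using w by (simp add: f_def)
    qed
    then show ?thesis
      unfolding h_def f_def using c \<rho> F
      by (intro arcsin_increase_le[of "s j" "s (Suc j)" _ _ F] fibre_form_derivative J pm w) auto
  qed
  then have "(\<Sum>j<N. h (Suc j) - h j) \<le> (\<Sum>j<N. 2 * ls j)" by (intro sum_mono) auto
  then show ?thesis unfolding sum_lessThan_telescope sum_distrib_left[symmetric] by (simp add: h_def)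
qed

end

section \<open>Lower bound for the length\<close>

text \<open>The fibre data \<open>\<alpha>\<close> of a family of vectors \<open>v\<close>: \<open>\<alpha> i\<close> is the normalised vector of \<open>i\<close>-th coordinates
  (zero if they all vanish), so that the projection matrix built from \<open>\<alpha>\<close> fixes \<open>v\<close> and is block diagonal.\<close>

definition fibre_vec :: "nat \<Rightarrow> (nat \<Rightarrow> ell2) \<Rightarrow> nat \<Rightarrow> nat \<Rightarrow> complex" where
  "fibre_vec m v i k = coord (v k) i / of_real (sqrt (\<Sum>l<m. (cmod (coord (v l) i))\<^sup>2))"

lemma fibre_vec_unit_or_zero:
  "(\<Sum>k<m. (cmod (fibre_vec m v i k))\<^sup>2) = 1 \<or> (\<forall>k<m. fibre_vec m v i k = 0)"
proof (cases "(\<Sum>l<m. (cmod (coord (v l) i))\<^sup>2) = 0")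
  case False
  moreover have "0 \<le> (\<Sum>l<m. (cmod (coord (v l) i))\<^sup>2)" by (intro sum_nonneg) auto
  ultimately show ?thesis
    by (simp add: fibre_vec_def norm_divide power_divide sum_divide_distrib[symmetric])
qed (simp add: fibre_vec_def)

lemma fibre_vec_expand:
  assumes "k < m"
  shows "fibre_vec m v i k * (\<Sum>l<m. cnj (fibre_vec m v i l) * coord (v l) i) = coord (v k) i"
proof -
  define r where "r = (\<Sum>l<m. (cmod (coord (v l) i))\<^sup>2)"
  have r: "0 \<le> r" unfolding r_def by (intro sum_nonneg) auto
  have "(\<Sum>l<m. cnj (fibre_vec m v i l) * coord (v l) i) = of_real r / of_real (sqrt r)"
    by (simp add: fibre_vec_def r_def[symmetric] sum_divide_distrib[symmetric])
       (simp add: r_def mult.commute[of "cnj _"] flip: complex_norm_square)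
  also have "\<dots> = of_real (sqrt r)" using r by (simp add: real_div_sqrt flip: of_real_divide)
  finally have *: "(\<Sum>l<m. cnj (fibre_vec m v i l) * coord (v l) i) = of_real (sqrt r)" .
  show ?thesis
  proof (cases "r = 0")
    case True
    then have "(cmod (coord (v k) i))\<^sup>2 = 0"
      using assms unfolding r_def by (subst (asm) sum_nonneg_eq_0_iff) auto
    then show ?thesis by (simp add: fibre_vec_def)
  next
    case False
    then show ?thesis unfolding * by (simp add: fibre_vec_def r_def[symmetric])
  qed
qed

lemma power2_norm_diff:
  fixes x y :: "'a::real_inner"
  shows "(norm (x - y))\<^sup>2 = (norm x)\<^sup>2 + (norm y)\<^sup>2 - 2 * (y \<bullet> x)"
  by (simp add: power2_norm_eq_inner inner_diff_left inner_diff_right inner_commute)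

text \<open>The signed coordinate vector projects onto the fibre line with length
  \<open>\<bar>c\<bar> / sqrt r\<close>, where \<open>c\<close> is the signed and \<open>r\<close>
  the unsigned sum of squares. As \<open>\<bar>c\<bar> \<le> r\<close>, its square is at most
  \<open>\<bar>c\<bar>\<close>: a small diagonal of the family means near orthogonality to the
  fibres.\<close>

lemma fibre_vec_signed:
  assumes sg: "\<And>k. k < m \<Longrightarrow> \<bar>sg k\<bar> = (1::real)"
  shows "(\<Sum>k<m. (cmod (fibre_vec m v i k * (\<Sum>l<m. cnj (fibre_vec m v i l) * (\<i> * of_real (sg l) * coord (v l) i))))\<^sup>2)
    \<le> \<bar>\<Sum>l<m. sg l * (cmod (coord (v l) i))\<^sup>2\<bar>"
proof -
  define r where "r = (\<Sum>l<m. (cmod (coord (v l) i))\<^sup>2)"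
  define c where "c = (\<Sum>l<m. sg l * (cmod (coord (v l) i))\<^sup>2)"
  have r: "0 \<le> r" unfolding r_def by (intro sum_nonneg) auto
  have "\<bar>c\<bar> \<le> (\<Sum>l<m. \<bar>sg l * (cmod (coord (v l) i))\<^sup>2\<bar>)" unfolding c_def by (rule sum_abs)
  also have "\<dots> = r" unfolding r_def using sg by (intro sum.cong) (auto simp: abs_mult)
  finally have cr: "\<bar>c\<bar> \<le> r" .
  have "cnj (fibre_vec m v i l) * (\<i> * of_real (sg l) * coord (v l) i)
      = \<i> * of_real (sg l * (cmod (coord (v l) i))\<^sup>2) / of_real (sqrt r)" for l
    by (simp add: fibre_vec_def r_def[symmetric] mult_ac flip: complex_norm_square)
  then have "(\<Sum>l<m. cnj (fibre_vec m v i l) * (\<i> * of_real (sg l) * coord (v l) i))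
      = \<i> * of_real c / of_real (sqrt r)"
    by (simp add: c_def sum_divide_distrib sum_distrib_left)
  then have "(\<Sum>k<m. (cmod (fibre_vec m v i k * (\<Sum>l<m. cnj (fibre_vec m v i l) * (\<i> * of_real (sg l) * coord (v l) i))))\<^sup>2)
      = (\<Sum>k<m. (cmod (fibre_vec m v i k))\<^sup>2 * (c\<^sup>2 / r))"
    using r by (simp add: norm_mult norm_divide power_mult_distrib power_divide)
  also have "\<dots> = (\<Sum>k<m. (cmod (fibre_vec m v i k))\<^sup>2) * (c\<^sup>2 / r)" by (rule sum_distrib_right[symmetric])
  also have "\<dots> \<le> 1 * (c\<^sup>2 / r)"
    using fibre_vec_unit_or_zero[of m v i] r by (intro mult_right_mono) auto
  also have "\<dots> \<le> \<bar>c\<bar>"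
  proof (cases "r = 0")
    case False
    have "c\<^sup>2 = \<bar>c\<bar> * \<bar>c\<bar>" by (simp add: power2_eq_square)
    also have "\<dots> \<le> \<bar>c\<bar> * r" using cr by (intro mult_left_mono) auto
    finally show ?thesis using r False by (simp add: divide_le_eq)
  qed simp
  finally show ?thesis by (simp add: c_def)
qed

context simple_compact_diag
begin

text \<open>A possible zero eigenvalue is not isolated, so its spectral projection need not move continuously along a
  curve. Its fibre \<open>\<alpha>0\<close> is therefore attached to the complement of the other finitely many spectral
  projections, which is harmless because the vectors of the family have support below \<open>n\<close>.\<close>

lemma ex_adapted_fibre_op:
  assumes supp: "\<And>k. k < m \<Longrightarrow> app (trunc n) (v k) = v k"
    and sg: "\<And>k. k < m \<Longrightarrow> \<bar>sg k\<bar> = (1::real)"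
  shows "\<exists>\<alpha> \<alpha>0 J. (\<forall>i\<in>J. eig i \<noteq> 0) \<and> proj_mat m (fibre_op \<alpha> \<alpha>0 J proj) \<and>
    (\<forall>k<m. op_mat_app m (fibre_op \<alpha> \<alpha>0 J proj) v k = v k) \<and>
    (\<Sum>k<m. (norm (op_mat_app m (fibre_op \<alpha> \<alpha>0 J proj) (\<lambda>l. cmul (\<i> * of_real (sg l)) (v l)) k))\<^sup>2)
       \<le> (\<Sum>i<n. \<bar>\<Sum>l<m. sg l * (cmod (coord (v l) i))\<^sup>2\<bar>)"
proof -
  define J where "J = {i. i < n \<and> eig i \<noteq> 0}"
  \<comment> \<open>Distinctness allows at most one zero eigenvalue, so the chosen index is the only
    candidate; if none lies below \<open>n\<close>, the remaining fibre is zero.\<close>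
  define \<alpha>0 where "\<alpha>0 = (if \<exists>z<n. eig z = 0 then fibre_vec m v (SOME z. z < n \<and> eig z = 0) else (\<lambda>_. 0))"
  define \<alpha> where "\<alpha> i = (if i \<in> J then fibre_vec m v i else \<alpha>0)" for i
  have \<alpha>: "\<alpha> i = fibre_vec m v i" if "i < n" for i
  proof (cases "eig i = 0")
    case True
    then have "\<exists>z. z < n \<and> eig z = 0" using that by blast
    then have "eig (SOME z. z < n \<and> eig z = 0) = 0" by (rule someI2_ex) simp
    then have "(SOME z. z < n \<and> eig z = 0) = i" using True distinct_b[of "SOME z. z < n \<and> eig z = 0" i] by auto
    then show ?thesis using that True by (auto simp: \<alpha>_def \<alpha>0_def J_def)
  qed (simp add: \<alpha>_def J_def that)
  have fib: "(\<Sum>k<m. (cmod (\<alpha> i k))\<^sup>2) = 1 \<or> (\<forall>k<m. \<alpha> i k = 0)" for i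
    using fibre_vec_unit_or_zero[of m v] by (simp add: \<alpha>_def \<alpha>0_def)
  have J: "finite J" "\<And>i. i \<notin> J \<Longrightarrow> \<alpha> i = \<alpha>0" by (auto simp: J_def \<alpha>_def)
  define q where "q = fibre_op \<alpha> \<alpha>0 J proj"
  have cq: "coord (op_mat_app m q x k) i = \<alpha> i k * (\<Sum>l<m. cnj (\<alpha> i l) * coord (x l) i)" for x k i
    by (simp add: op_mat_app_def q_def coord_fibre_op[OF J] sum_distrib_left mult_ac)
  have v0: "coord (v l) i = 0" if "l < m" "n \<le> i" for l i
    using coord_beyond_trunc[OF supp[OF that(1)] that(2)] .
  have fix_v: "op_mat_app m q v k = v k" if "k < m" for k
  proof (rule coord_inject_ext)
    fix i
    show "coord (op_mat_app m q v k) i = coord (v k) i"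
      using v0 that fibre_vec_expand[OF that, of v i] by (cases "i < n") (simp_all add: cq \<alpha>)
  qed
  define y where "y l = cmul (\<i> * of_real (sg l)) (v l)" for l
  have "app (trunc n) (op_mat_app m q y k) = op_mat_app m q y k" for k
    using v0 by (intro coord_inject_ext) (simp add: cq y_def)
  then have "(\<Sum>k<m. (norm (op_mat_app m q y k))\<^sup>2) = (\<Sum>k<m. \<Sum>i<n. (cmod (coord (op_mat_app m q y k) i))\<^sup>2)"
    by (intro sum.cong refl norm_sq_supported)
  also have "\<dots> = (\<Sum>i<n. \<Sum>k<m. (cmod (coord (op_mat_app m q y k) i))\<^sup>2)" by (rule sum.swap)
  also have "\<dots> \<le> (\<Sum>i<n. \<bar>\<Sum>l<m. sg l * (cmod (coord (v l) i))\<^sup>2\<bar>)"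
    using fibre_vec_signed[OF sg] by (intro sum_mono) (simp add: cq \<alpha> y_def)
  finally have y_small: "(\<Sum>k<m. (norm (op_mat_app m q y k))\<^sup>2)
      \<le> (\<Sum>i<n. \<bar>\<Sum>l<m. sg l * (cmod (coord (v l) i))\<^sup>2\<bar>)" .
  show ?thesis
  proof (intro exI conjI allI impI ballI)
    show "proj_mat m (fibre_op \<alpha> \<alpha>0 J proj)" by (rule proj_mat_fibre_op[OF J fib])
  qed (use fix_v y_small in \<open>simp_all add: q_def y_def[abs_def] J_def\<close>)
qed

text \<open>The tuple \<open>w\<close>, obtained by moving \<open>v\<close> with the flow, lies in
  the range of the projection at the end of the curve. At the start it is nearly
  \<open>cos \<theta> v + sin \<theta> y\<close>, with \<open>v\<close> fixed by \<open>q\<close>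
  and \<open>q y\<close> small, so its projection has length at most about
  \<open>cos \<theta>\<close>. The angle estimate bounds that length below by the cosine of the
  length of the curve.\<close>

lemma cos_length_le:
  assumes Z: "adj Z = - Z" and fam: "signed_family n L" and e: "0 \<le> e"
    and near: "norm Z - e \<le> form_sum (scal (- \<i>) * Z) L" and small: "(\<Sum>i<n. \<bar>diag_sum L i\<bar>) \<le> e"
    and \<theta>: "\<bar>t0\<bar> * norm Z \<le> pi / 2"
    and curve: "orbit_curve B N s ls" and start: "B (s 0) = b"
    and stop: "B (s N) = exp (t0 *\<^sub>R Z) * b * adj (exp (t0 *\<^sub>R Z))"
    and len: "(\<Sum>j<N. ls j) < pi / 2"
  shows "0 \<le> (\<Sum>j<N. ls j)"
    and "cos (\<Sum>j<N. ls j) \<le> cos (\<bar>t0\<bar> * norm Z) + sqrt e + \<bar>t0\<bar> * sqrt (2 * norm Z * e)"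
proof -
  define m where "m = length L"
  define sg where "sg k = fst (L ! k)" for k
  define v where "v k = snd (L ! k)" for k
  define \<mu> where "\<mu> = norm Z"
  define U where "U = exp (t0 *\<^sub>R Z)"
  define w where "w k = app U (v k)" for k
  define l where "l = (\<Sum>j<N. ls j)"
  have U: "unitary U" unfolding U_def unitary_def using Z by (intro conjI adj_exp_anti) simp_all
  have "(sg k = 1 \<or> sg k = -1) \<and> app (trunc n) (v k) = v k" if "k < m" for k
    using fam nth_mem[of k L] that by (auto simp: signed_family_def sg_def v_def m_def case_prod_unfold)
  then have sg: "\<And>k. k < m \<Longrightarrow> sg k = 1 \<or> sg k = -1" and supp: "\<And>k. k < m \<Longrightarrow> app (trunc n) (v k) = v k"
    by auto
  have v1: "(\<Sum>k<m. (norm (v k))\<^sup>2) = 1"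
    using fam sum_list_pair_nth[of "\<lambda>s v. (norm v)\<^sup>2" L] by (simp add: signed_family_def v_def m_def)
  have dsum: "diag_sum L i = (\<Sum>k<m. sg k * (cmod (coord (v k) i))\<^sup>2)" for i
    unfolding diag_sum_def sum_list_pair_nth by (simp add: sg_def v_def m_def)
  have fsum: "form_sum (scal (- \<i>) * Z) L = (\<Sum>k<m. sg k * (v k \<bullet> app (scal (- \<i>) * Z) (v k)))"
    unfolding form_sum_def sum_list_pair_nth by (simp add: sg_def v_def m_def)
  have w1: "(\<Sum>k<m. (norm (w k))\<^sup>2) = 1"
    using v1 U by (simp add: w_def norm_app_isometry unitary_def)
  have sg1: "\<bar>sg k\<bar> = 1" if "k < m" for k using sg[OF that] by auto
  have "\<exists>\<alpha> \<alpha>0 J. (\<forall>i\<in>J. eig i \<noteq> 0) \<and> proj_mat m (fibre_op \<alpha> \<alpha>0 J proj) \<and>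
    (\<forall>k<m. op_mat_app m (fibre_op \<alpha> \<alpha>0 J proj) v k = v k) \<and>
    (\<Sum>k<m. (norm (op_mat_app m (fibre_op \<alpha> \<alpha>0 J proj) (\<lambda>l. cmul (\<i> * of_real (sg l)) (v l)) k))\<^sup>2)
       \<le> (\<Sum>i<n. \<bar>\<Sum>l<m. sg l * (cmod (coord (v l) i))\<^sup>2\<bar>)"
    by (rule ex_adapted_fibre_op) (fact supp, fact sg1)
  then obtain \<alpha> \<alpha>0 J where J': "\<forall>i\<in>J. eig i \<noteq> 0" and pm: "proj_mat m (fibre_op \<alpha> \<alpha>0 J proj)"
    and fix_v': "\<forall>k<m. op_mat_app m (fibre_op \<alpha> \<alpha>0 J proj) v k = v k"
    and y_small: "(\<Sum>k<m. (norm (op_mat_app m (fibre_op \<alpha> \<alpha>0 J proj) (\<lambda>l. cmul (\<i> * of_real (sg l)) (v l)) k))\<^sup>2)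
       \<le> (\<Sum>i<n. \<bar>\<Sum>l<m. sg l * (cmod (coord (v l) i))\<^sup>2\<bar>)" by (elim exE conjE) (rule that)
  have J: "\<And>i. i \<in> J \<Longrightarrow> eig i \<noteq> 0" using J' by blast
  have fix_v: "\<And>k. k < m \<Longrightarrow> op_mat_app m (fibre_op \<alpha> \<alpha>0 J proj) v k = v k" using fix_v' by blast
  define q where "q = fibre_op \<alpha> \<alpha>0 J proj"
  define f where "f t = op_mat_form m (fibre_op \<alpha> \<alpha>0 J (spec_proj (B t))) w" for t

  have "fibre_op \<alpha> \<alpha>0 J (spec_proj (B (s 0))) = q"
    using fibre_op_spec_proj[of 1 "B (s 0)" \<alpha> \<alpha>0 J] start by (simp add: unitary_def q_def)
  then have f0: "f (s 0) = (L2_set (\<lambda>k. norm (op_mat_app m q w k)) {..<m})\<^sup>2"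
    using op_mat_form_eq_norm(1)[OF pm, of w] op_mat_form_bounds(1)[OF pm, of w]
    by (simp add: f_def q_def L2_set_def)
  have q_stop: "fibre_op \<alpha> \<alpha>0 J (spec_proj (B (s N))) = (\<lambda>k l. U * q k l * adj U)"
    using fibre_op_spec_proj[OF U, of "B (s N)" \<alpha> \<alpha>0 J] stop by (simp add: q_def U_def)
  have "op_mat_app m (\<lambda>k l. U * q k l * adj U) w k = w k" if "k < m" for k
  proof -
    have "app (adj U) (app U x) = x" for x using U by (simp add: unitary_def flip: app_simps(7))
    then show ?thesis using fix_v[OF that] by (simp add: op_mat_app_def q_def w_def app_sum_right[symmetric])
  qed
  then have fN: "f (s N) = 1"
    using w1 by (simp add: f_def q_stop op_mat_form_def power2_norm_eq_inner)

  have f0_le: "f (s 0) \<le> 1" "0 \<le> f (s 0)"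
    using op_mat_form_bounds[OF pm, of w] w1 \<open>fibre_op \<alpha> \<alpha>0 J (spec_proj (B (s 0))) = q\<close>
    by (simp_all add: f_def q_def)
  have arc: "arcsin \<rho> - arcsin (\<rho> * (2 * f (s 0) - 1)) \<le> 2 * l" if "0 < \<rho>" "\<rho> < 1" for \<rho>
    using fibre_form_angle_le[OF curve that J pm w1] fN by (simp add: f_def l_def)
  have "arcsin 1 - arcsin (1 * (2 * f (s 0) - 1)) \<le> 2 * l"
  \<comment> \<open>The factor \<rho> < 1 was forced by differentiability of \<open>arcsin\<close>;
    continuity on the closed interval now lets it tend to 1.\<close>
  proof (rule LIMSEQ_le_const2)
    define \<rho> where "\<rho> n = 1 - inverse (real (Suc (Suc n)))" for n
    have \<rho>: "0 < \<rho> n" "\<rho> n < 1" for n by (simp_all add: \<rho>_def field_simps)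
    have lim: "\<rho> \<longlonglongrightarrow> 1"
      unfolding \<rho>_def using tendsto_diff[OF tendsto_const LIMSEQ_Suc[OF LIMSEQ_inverse_real_of_nat]] by simp
    have in1: "- 1 \<le> \<rho> n * x \<and> \<rho> n * x \<le> 1" if "- 1 \<le> x" "x \<le> 1" for n x
    proof -
      have "\<bar>\<rho> n * x\<bar> \<le> 1 * 1" unfolding abs_mult using \<rho>[of n] that by (intro mult_mono) auto
      then show ?thesis by auto
    qed
    have arc_lim: "(\<lambda>n. arcsin (\<rho> n * x)) \<longlonglongrightarrow> arcsin (1 * x)" if "- 1 \<le> x" "x \<le> 1" for x
      using in1[OF that] that
      by (intro continuous_on_tendsto_compose[OF continuous_on_arcsin'] tendsto_mult lim tendsto_const) auto
    show "(\<lambda>n. arcsin (\<rho> n) - arcsin (\<rho> n * (2 * f (s 0) - 1))) \<longlonglongrightarrow> arcsin 1 - arcsin (1 * (2 * f (s 0) - 1))"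
      using arc_lim[of 1] f0_le by (intro tendsto_diff arc_lim) simp_all
    show "\<exists>N. \<forall>n\<ge>N. arcsin (\<rho> n) - arcsin (\<rho> n * (2 * f (s 0) - 1)) \<le> 2 * l"
      using arc \<rho> by blast
  qed
  then have arc1: "pi / 2 - 2 * l \<le> arcsin (2 * f (s 0) - 1)" by simp
  then have l0: "0 \<le> l" using arcsin_ubound[of "2 * f (s 0) - 1"] f0_le by simp
  then show "0 \<le> (\<Sum>j<N. ls j)" by (simp add: l_def)
  \<comment> \<open>Monotonicity of \<open>sin\<close> needs \<open>pi / 2 - 2 * l\<close> to be at
    least \<open>- pi / 2\<close>, which is where the assumed length below \<open>pi / 2\<close>
    enters.\<close>
  have "sin (pi / 2 - 2 * l) \<le> sin (arcsin (2 * f (s 0) - 1))"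
    using arc1 l0 len f0_le arcsin_ubound[of "2 * f (s 0) - 1"]
    by (intro sin_monotone_2pi_le) (simp_all add: l_def)
  then have "cos (2 * l) \<le> 2 * f (s 0) - 1" using f0_le by (simp add: sin_diff)
  then have "(cos l)\<^sup>2 \<le> (L2_set (\<lambda>k. norm (op_mat_app m q w k)) {..<m})\<^sup>2"
    by (simp add: cos_double_cos f0)
  then have cos_le: "cos l \<le> L2_set (\<lambda>k. norm (op_mat_app m q w k)) {..<m}"
    by (rule power2_le_imp_le) simp

  define \<theta> where "\<theta> = t0 * \<mu>"
  define y where "y k = cmul (\<i> * of_real (sg k)) (v k)" for k
  define err where "err k = w k - cmul (cis (t0 * (sg k * \<mu>))) (v k)" for k
  have w_eq: "w k = cos \<theta> *\<^sub>R v k + (sin \<theta> *\<^sub>R y k + err k)" if "k < m" for k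
  proof -
    have "cis (t0 * (sg k * \<mu>)) = of_real (cos \<theta>) + of_real (sin \<theta>) * (\<i> * of_real (sg k))"
      using sg[OF that] by (auto simp: \<theta>_def complex_eq_iff)
    then show ?thesis
      by (intro coord_inject_ext) (simp add: err_def y_def algebra_simps)
  qed
  \<comment> \<open>Expanding the square turns the defect in the eigenvalue equation into the
    pairing with the family. In total it is at most
    \<open>2 \<mu>\<^sup>2 - 2 \<mu> (\<mu> - e) = 2 \<mu> e\<close>, times
    \<open>t0\<^sup>2\<close> from the flow estimate.\<close>
  have "(\<Sum>k<m. (norm (err k))\<^sup>2) \<le> (\<Sum>k<m. t0\<^sup>2 * ((norm (app Z (v k)))\<^sup>2 + \<mu>\<^sup>2 * (norm (v k))\<^sup>2
      - 2 * \<mu> * (sg k * (v k \<bullet> app (scal (- \<i>) * Z) (v k)))))"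
  proof (rule sum_mono)
    fix k assume "k \<in> {..<m}"
    then have sk: "sg k = 1 \<or> sg k = -1" using sg by simp
    have "(norm (err k))\<^sup>2 \<le> (\<bar>t0\<bar> * norm (app Z (v k) - cmul (\<i> * of_real (sg k * \<mu>)) (v k)))\<^sup>2"
      unfolding err_def w_def U_def by (intro power_mono norm_exp_app_diff_phase_le Z) simp
    also have "\<dots> = t0\<^sup>2 * (norm (app Z (v k) - cmul (\<i> * of_real (sg k * \<mu>)) (v k)))\<^sup>2"
      by (simp add: power_mult_distrib)
    also have "(norm (app Z (v k) - cmul (\<i> * of_real (sg k * \<mu>)) (v k)))\<^sup>2
        = (norm (app Z (v k)))\<^sup>2 + (norm (cmul (\<i> * of_real (sg k * \<mu>)) (v k)))\<^sup>2
          - 2 * (cmul (\<i> * of_real (sg k * \<mu>)) (v k) \<bullet> app Z (v k))"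
      by (rule power2_norm_diff)
    also have "(norm (cmul (\<i> * of_real (sg k * \<mu>)) (v k)))\<^sup>2 = \<mu>\<^sup>2 * (norm (v k))\<^sup>2"
      using sk by (auto simp: norm_mult power_mult_distrib)
    also have "cmul (\<i> * of_real (sg k * \<mu>)) (v k) \<bullet> app Z (v k) = \<mu> * (sg k * (v k \<bullet> app (scal (- \<i>) * Z) (v k)))"
    proof -
      have "cmul (cnj (\<i> * of_real (sg k * \<mu>))) (app Z (v k)) = (\<mu> * sg k) *\<^sub>R app (scal (- \<i>) * Z) (v k)"
        by (rule coord_inject_ext) simp
      then show ?thesis by (simp only: inner_cmul_left inner_scaleR_right mult.assoc)
    qed
    finally show "(norm (err k))\<^sup>2 \<le> t0\<^sup>2 * ((norm (app Z (v k)))\<^sup>2 + \<mu>\<^sup>2 * (norm (v k))\<^sup>2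
      - 2 * \<mu> * (sg k * (v k \<bullet> app (scal (- \<i>) * Z) (v k))))"
      by (simp only: mult.assoc)
  qed
  also have "\<dots> = t0\<^sup>2 * ((\<Sum>k<m. (norm (app Z (v k)))\<^sup>2) + \<mu>\<^sup>2 - 2 * \<mu> * form_sum (scal (- \<i>) * Z) L)"
    unfolding fsum using v1
    by (simp only: sum_distrib_left[symmetric] sum.distrib sum_subtractf mult_1_right)
  also have "\<dots> \<le> t0\<^sup>2 * (\<mu>\<^sup>2 + \<mu>\<^sup>2 - 2 * \<mu> * (\<mu> - e))"
  proof (intro mult_left_mono diff_mono add_right_mono)
    have "(\<Sum>k<m. (norm (app Z (v k)))\<^sup>2) \<le> (\<Sum>k<m. \<mu>\<^sup>2 * (norm (v k))\<^sup>2)"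
      unfolding power_mult_distrib[symmetric] by (intro sum_mono power_mono) (simp_all add: \<mu>_def norm_app_le)
    also have "\<dots> = \<mu>\<^sup>2" using v1 by (simp only: sum_distrib_left[symmetric] mult_1_right)
    finally show "(\<Sum>k<m. (norm (app Z (v k)))\<^sup>2) \<le> \<mu>\<^sup>2" .
    show "\<mu> - e \<le> form_sum (scal (- \<i>) * Z) L" using near by (simp add: \<mu>_def)
  qed (simp_all add: \<mu>_def)
  also have "\<dots> = (\<bar>t0\<bar> * sqrt (2 * \<mu> * e))\<^sup>2"
    using e by (simp add: power_mult_distrib \<mu>_def power2_eq_square algebra_simps)
  finally have err_le: "L2_set (\<lambda>k. norm (err k)) {..<m} \<le> \<bar>t0\<bar> * sqrt (2 * \<mu> * e)"
    unfolding L2_set_def by (intro real_le_lsqrt sum_nonneg) (use e in \<open>auto simp: \<mu>_def\<close>)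
  have y_le: "L2_set (\<lambda>k. norm (op_mat_app m q y k)) {..<m} \<le> sqrt e"
    using y_small small unfolding L2_set_def q_def y_def dsum by (intro real_sqrt_le_mono) simp
  have v_le: "L2_set (\<lambda>k. norm (op_mat_app m q v k)) {..<m} = 1"
    using fix_v v1 by (simp add: L2_set_def q_def)

  have "op_mat_app m q w k = op_mat_app m q (\<lambda>k. cos \<theta> *\<^sub>R v k + (sin \<theta> *\<^sub>R y k + err k)) k" for k
    unfolding op_mat_app_def using w_eq by (intro sum.cong) auto
  then have "op_mat_app m q w k = cos \<theta> *\<^sub>R op_mat_app m q v k
      + (sin \<theta> *\<^sub>R op_mat_app m q y k + op_mat_app m q err k)" for k
    by (simp add: op_mat_app_linear)
  then have "L2_set (\<lambda>k. norm (op_mat_app m q w k)) {..<m}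
      \<le> L2_set (\<lambda>k. norm (cos \<theta> *\<^sub>R op_mat_app m q v k)) {..<m}
        + (L2_set (\<lambda>k. norm (sin \<theta> *\<^sub>R op_mat_app m q y k)) {..<m} + L2_set (\<lambda>k. norm (op_mat_app m q err k)) {..<m})"
    by (simp only:) (intro order_trans[OF L2_set_norm_add] add_left_mono L2_set_norm_add)
  also have "\<dots> \<le> \<bar>cos \<theta>\<bar> + (1 * sqrt e + \<bar>t0\<bar> * sqrt (2 * \<mu> * e))"
    unfolding L2_set_norm_scaleR v_le using y_le e L2_op_mat_app_le[OF pm, of err] err_le
    by (intro add_mono mult_mono) (simp_all add: q_def)
  also have "\<bar>cos \<theta>\<bar> = cos (\<bar>t0\<bar> * norm Z)"
  proof -
    have "cos (\<bar>t0\<bar> * norm Z) = cos \<theta>" by (cases "0 \<le> t0") (simp_all add: \<theta>_def \<mu>_def)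
    moreover have "0 \<le> cos (\<bar>t0\<bar> * norm Z)"
      using \<open>\<bar>t0\<bar> * norm Z \<le> pi / 2\<close> by (intro cos_ge_zero) (auto intro: order_trans[of _ 0])
    ultimately show ?thesis by simp
  qed
  finally show "cos (\<Sum>j<N. ls j) \<le> cos (\<bar>t0\<bar> * norm Z) + sqrt e + \<bar>t0\<bar> * sqrt (2 * norm Z * e)"
    using cos_le by (simp add: l_def \<mu>_def)
qed

text \<open>Length at least \<pi> / 2 is already enough. Otherwise the family and the projection
  change with the error \<open>e\<close> while the curve stays fixed, so \<open>e\<close> may tend
  to 0, and the decrease of \<open>cos\<close> gives the claim.\<close>

lemma length_ge:
  assumes K: "cpt K" "adj K = - K" and D: "is_diag (mat_of D)" "adj D = - D" and Z: "Z = K + D"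
    and min: "\<And>D'. is_diag (mat_of D') \<Longrightarrow> adj D' = - D' \<Longrightarrow> norm Z \<le> norm (Z + D')"
    and \<theta>: "\<bar>t0\<bar> * norm Z \<le> pi / 2"
    and curve: "orbit_curve B N s ls" and start: "B (s 0) = b"
    and stop: "B (s N) = exp (t0 *\<^sub>R Z) * b * adj (exp (t0 *\<^sub>R Z))"
  shows "\<bar>t0\<bar> * norm Z \<le> (\<Sum>j<N. ls j)"
proof (cases "(\<Sum>j<N. ls j) < pi / 2")
  case True
  define l where "l = (\<Sum>j<N. ls j)"
  have Za: "adj Z = - Z" using K D Z by simp
  have step: "0 \<le> l \<and> cos l \<le> cos (\<bar>t0\<bar> * norm Z) + sqrt e + \<bar>t0\<bar> * sqrt (2 * norm Z * e)" if e: "0 < e" for e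
  proof -
    obtain n L where L: "signed_family n L" "norm (K + D) - e \<le> form_sum (scal (- \<i>) * (K + D)) L"
      "(\<Sum>i<n. \<bar>diag_sum L i\<bar>) \<le> e"
      using ex_dual_family_minimal[OF K D min[unfolded Z] e] by blast
    show ?thesis
      using cos_length_le[OF Za L(1) less_imp_le[OF e] _ L(3) \<theta> curve start stop True] L(2)
      by (simp add: Z l_def)
  qed
  have "cos l \<le> cos (\<bar>t0\<bar> * norm Z) + sqrt 0 + \<bar>t0\<bar> * sqrt (2 * norm Z * 0)"
  proof (rule LIMSEQ_le_const)
    show "(\<lambda>n. cos (\<bar>t0\<bar> * norm Z) + sqrt (inverse (real (Suc n))) + \<bar>t0\<bar> * sqrt (2 * norm Z * inverse (real (Suc n))))
        \<longlonglongrightarrow> cos (\<bar>t0\<bar> * norm Z) + sqrt 0 + \<bar>t0\<bar> * sqrt (2 * norm Z * 0)"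
      by (intro tendsto_intros LIMSEQ_inverse_real_of_nat)
    show "\<exists>N. \<forall>n\<ge>N. cos l \<le> cos (\<bar>t0\<bar> * norm Z) + sqrt (inverse (real (Suc n)))
        + \<bar>t0\<bar> * sqrt (2 * norm Z * inverse (real (Suc n)))"
      using step by (intro exI allI impI) simp
  qed
  then have "cos l \<le> cos (\<bar>t0\<bar> * norm Z)" by simp
  moreover have "0 \<le> l" using step[of 1] by simp
  ultimately have "\<bar>t0\<bar> * norm Z \<le> l"
    using \<theta> True cos_mono_le_eq[of l "\<bar>t0\<bar> * norm Z"] by (simp add: l_def)
  then show ?thesis by (simp add: l_def)
qed (use \<theta> in linarith)

end

section \<open>Minimality of the one-parameter curve\<close>

lemma in_KC_imp_mat_of: "in_KC A \<Longrightarrow> \<exists>T. A = mat_of T"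
  by (auto simp: in_KC_iff)

lemma partition_mono:
  fixes s :: "nat \<Rightarrow> real"
  assumes "\<forall>k<n. s k < s (Suc k)" "i \<le> j" "j \<le> n"
  shows "s i \<le> s j"
  using assms(2,3)
proof (induction j rule: dec_induct)
  case (step j)
  then show ?case using assms(1) by (meson Suc_leD Suc_le_lessD less_imp_le order_trans)
qed simp

text \<open>Tangency makes the set under the infimum nonempty, without which \<open>Inf\<close>
  would carry no information.\<close>

lemma finsler_witness:
  assumes "z \<in> tangent_space (mat_of c)"
  shows "0 \<le> finsler (mat_of c) z"
    and "0 < \<epsilon> \<Longrightarrow> \<exists>Y. adj Y = - Y \<and> norm Y \<le> finsler (mat_of c) z + \<epsilon> \<and> mat_of (Y * c - c * Y) = z"
proof -
  define A where "A = {opnorm Y | Y. in_KC Y \<and> anti_herm Y \<and> mat_mult Y (mat_of c) - mat_mult (mat_of c) Y = z}"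
  have A: "\<exists>Y. r = norm Y \<and> adj Y = - Y \<and> mat_of (Y * c - c * Y) = z" if r: "r \<in> A" for r
  proof -
    obtain Y' where Y': "in_KC Y'" "anti_herm Y'" "mat_mult Y' (mat_of c) - mat_mult (mat_of c) Y' = z" "r = opnorm Y'"
      using r by (auto simp: A_def)
    then obtain Y where "Y' = mat_of Y" using in_KC_imp_mat_of by blast
    with Y' show ?thesis by auto
  qed
  have ne: "A \<noteq> {}" using assms unfolding A_def tangent_space_def by blast
  have ge0: "0 \<le> r" if "r \<in> A" for r using A[OF that] by auto
  have fin: "finsler (mat_of c) z = Inf A" by (simp add: finsler_def A_def)
  show "0 \<le> finsler (mat_of c) z" unfolding fin using ne ge0 by (rule cInf_greatest)
  assume "0 < \<epsilon>"
  then have "\<exists>r\<in>A. r < Inf A + \<epsilon>" using cInf_lessD[OF ne, of "Inf A + \<epsilon>"] by simp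
  then show "\<exists>Y. adj Y = - Y \<and> norm Y \<le> finsler (mat_of c) z + \<epsilon> \<and> mat_of (Y * c - c * Y) = z"
    unfolding fin using A by (metis less_imp_le)
qed

context simple_compact_diag
begin

lemma orbit_imp_unitary:
  assumes "c \<in> orbit (mat_of b)"
  shows "\<exists>u. unitary u \<and> c = mat_of (u * b * adj u)"
proof -
  obtain U where U: "unitary_KC U" "c = mat_mult (mat_mult U (mat_of b)) (mat_adj U)"
    using assms by (auto simp: orbit_def)
  then obtain u where "U = mat_of u" using in_KC_imp_mat_of by (auto simp: unitary_KC_def)
  with U show ?thesis by (auto simp: unitary_KC_def unitary_def mat_of_one)
qed

lemma curve_length_imp_orbit_curve:
  assumes "curve_length (mat_of b) \<beta> a a' l"
  shows "\<exists>B N s ls. orbit_curve B N s ls \<and> s 0 = a \<and> s N = a' \<and> l = (\<Sum>j<N. ls j) \<and>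
    \<beta> a = mat_of (B a) \<and> \<beta> a' = mat_of (B a')"
proof -
  have aa': "a \<le> a'" and orb: "\<And>t. t \<in> {a..a'} \<Longrightarrow> \<beta> t \<in> orbit (mat_of b)"
    using assms by (auto simp: curve_length_def)
  obtain n s Df ls where s: "s 0 = a" "s n = a'" "\<forall>k<n. s k < s (Suc k)" "l = (\<Sum>k<n. ls k)"
    and pieces: "\<forall>k<n. (\<forall>t\<in>{s k..s (Suc k)}. op_has_deriv \<beta> (Df k t) t {s k..s (Suc k)}
                                      \<and> Df k t \<in> tangent_space (\<beta> t))
              \<and> op_continuous_on {s k..s (Suc k)} (Df k)
              \<and> ((\<lambda>t. finsler (\<beta> t) (Df k t)) has_integral ls k) {s k..s (Suc k)}"
    using assms unfolding curve_length_def by (elim conjE exE) (rule that)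
  \<comment> \<open>An arbitrary choice outside the interval; on it, points of the orbit are
    matrices of operators and \<open>B t\<close> represents \<open>\<beta> t\<close>.\<close>
  define B where "B t = (SOME T. \<beta> t = mat_of T)" for t
  have \<beta>: "\<beta> t = mat_of (B t)" if "t \<in> {a..a'}" for t
    unfolding B_def using orbit_imp_unitary[OF orb[OF that]] by (intro someI_ex[of "\<lambda>T. \<beta> t = mat_of T"]) blast
  have "orbit_curve B n s ls"
    unfolding orbit_curve_def
  proof (intro allI impI conjI ballI)
    fix k assume k: "k < n"
    define S where "S = {s k..s (Suc k)}"
    have sub: "S \<subseteq> {a..a'}"
      using partition_mono[OF s(3), of 0 k] partition_mono[OF s(3), of "Suc k" n] k s(1,2) by (auto simp: S_def)
    show "s k < s (Suc k)" using s k by blast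
    show "\<exists>u. unitary u \<and> B t = u * b * adj u" if "t \<in> {s k..s (Suc k)}" for t
      using orbit_imp_unitary[OF orb, of t] \<beta>[of t] sub that by (auto simp: S_def)
    show "\<exists>F. (F has_integral ls k) {s k..s (Suc k)} \<and>
        (\<forall>t\<in>{s k..s (Suc k)}. 0 \<le> F t \<and> speed_le B {s k..s (Suc k)} t (F t))"
      unfolding S_def[symmetric]
    proof (intro exI conjI ballI)
      show "((\<lambda>t. finsler (\<beta> t) (Df k t)) has_integral ls k) S"
        using pieces k by (simp add: S_def)
      fix t assume t: "t \<in> S"
      then have bt: "\<beta> t = mat_of (B t)" using \<beta> sub by blast
      have deriv: "op_has_deriv \<beta> (Df k t) t S" and tan: "Df k t \<in> tangent_space (mat_of (B t))"
        using pieces k t by (auto simp: S_def bt[symmetric])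
      show "0 \<le> finsler (\<beta> t) (Df k t)" unfolding bt by (rule finsler_witness(1)[OF tan])
      show "speed_le B S t (finsler (\<beta> t) (Df k t))"
        unfolding speed_le_def bt
      proof (intro allI impI)
        fix \<epsilon> :: real assume "0 < \<epsilon>"
        then obtain Y where Y: "adj Y = - Y" "norm Y \<le> finsler (mat_of (B t)) (Df k t) + \<epsilon>"
          "mat_of (Y * B t - B t * Y) = Df k t"
          using finsler_witness(2)[OF tan] by blast
        have "((\<lambda>r. norm ((1 / (r - t)) *\<^sub>R (B r - B t) - (Y * B t - B t * Y))) \<longlongrightarrow> 0) (at t within S)"
        proof (rule Lim_transform_eventually)
          show "((\<lambda>r. opnorm (msmult (of_real (1 / (r - t))) (\<beta> r - \<beta> t) - Df k t)) \<longlongrightarrow> 0) (at t within S)"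
            using deriv unfolding op_has_deriv_def .
          have eq: "opnorm (msmult (of_real (1 / (r - t))) (\<beta> r - \<beta> t) - Df k t)
              = norm ((1 / (r - t)) *\<^sub>R (B r - B t) - (Y * B t - B t * Y))" if "r \<in> S" for r
          proof -
            have br: "\<beta> r = mat_of (B r)" using \<beta> sub that by blast
            show ?thesis unfolding br bt Y(3)[symmetric]
              by (simp only: mat_of_diff msmult_mat_of opnorm_mat_of scal_algebra(1)) simp
          qed
          show "\<forall>\<^sub>F r in at t within S. opnorm (msmult (of_real (1 / (r - t))) (\<beta> r - \<beta> t) - Df k t)
              = norm ((1 / (r - t)) *\<^sub>R (B r - B t) - (Y * B t - B t * Y))"
            unfolding eventually_at_filter using eq by (intro always_eventually) simp
        qed
        then have "((\<lambda>r. (1 / (r - t)) *\<^sub>R (B r - B t)) \<longlongrightarrow> Y * B t - B t * Y) (at t within S)"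
          by (rule LIM_zero_cancel[OF tendsto_norm_zero_cancel])
        with Y show "\<exists>Y. adj Y = - Y \<and> norm Y \<le> finsler (mat_of (B t)) (Df k t) + \<epsilon> \<and>
          ((\<lambda>r. (1 / (r - t)) *\<^sub>R (B r - B t)) \<longlongrightarrow> Y * B t - B t * Y) (at t within S)" by blast
      qed
    qed
  qed
  moreover have "\<beta> a = mat_of (B a)" "\<beta> a' = mat_of (B a')" using \<beta> aa' by simp_all
  ultimately show ?thesis
    using s by (intro exI[of _ B] exI[of _ n] exI[of _ s] exI[of _ ls] conjI) simp_all
qed

end

section \<open>The flow of a minimal operator\<close>

locale minimal_direction = simple_compact_diag +
  fixes K D Z :: cop
  assumes cpt_K: "cpt K" and adj_K: "adj K = - K" and diag_D: "is_diag (mat_of D)" and adj_D: "adj D = - D"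
    and Z_eq: "Z = K + D"
    and minimal: "\<And>D'. is_diag (mat_of D') \<Longrightarrow> adj D' = - D' \<Longrightarrow> norm Z \<le> norm (Z + D')"
begin

lemma adj_Z: "adj Z = - Z"
  by (simp add: Z_eq adj_K adj_D)

text \<open>Serves negative times: the curve for \<open>Z\<close> on an interval ending at 0 arrives
  at \<open>b\<close>, whereas the one for \<open>- Z\<close> starts there.\<close>

lemma minimal_direction_uminus: "minimal_direction b (- K) (- D) (- Z)"
proof
  have neg: "is_diag (mat_of T) \<Longrightarrow> is_diag (mat_of (- T))" for T
    using is_diag_scaleR[of T "- 1"] by simp
  show "cpt (- K)" using cpt_simps(4)[OF cpt_K, of "- 1"] by simp
  show "is_diag (mat_of (- D))" using neg diag_D .
  fix D' assume D': "is_diag (mat_of D')" "adj D' = - D'"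
  have "norm Z \<le> norm (Z + - D')" using D' by (intro minimal neg) auto
  also have "\<dots> = norm (- Z + D')" using norm_minus_cancel[of "Z + - D'"] by simp
  finally show "norm (- Z) \<le> norm (- Z + D')" by simp
qed (simp_all add: adj_K adj_D Z_eq)

definition flow :: "real \<Rightarrow> cop" where
  "flow t = exp (t *\<^sub>R Z)"

definition geod :: "real \<Rightarrow> cop" where
  "geod t = flow t * b * flow (- t)"

definition velocity :: "real \<Rightarrow> cop" where
  "velocity t = flow t * (Z * b - b * Z) * flow (- t)"

lemma adj_flow: "adj (flow t) = flow (- t)"
  by (simp add: flow_def adj_exp adj_Z)

lemma flow_inverse: "flow t * flow (- t) = 1" "flow (- t) * flow t = 1"
  using exp_minus_inverse[of "t *\<^sub>R Z"] exp_minus_inverse[of "- (t *\<^sub>R Z)"] by (simp_all add: flow_def)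

lemma unitary_flow: "unitary (flow t)"
  by (simp add: unitary_def adj_flow flow_inverse)

lemma flow_cancel: "flow t * (flow (- t) * x) = x" "flow (- t) * (flow t * x) = x"
  by (simp_all add: mult.assoc[symmetric] flow_inverse)

lemma cpt_flow_diff: "cpt (flow t - exp (t *\<^sub>R D))"
  using cpt_exp_diff[OF cpt_simps(4)[OF cpt_K] is_diag_scaleR[OF diag_D], of t t]
  unfolding flow_def by (simp add: Z_eq scaleR_add_right)

lemma cpt_flow_conj:
  assumes "cpt T" shows "cpt (flow t * T * flow (- t))"
proof -
  have "flow t * T = (flow t - exp (t *\<^sub>R D)) * T + exp (t *\<^sub>R D) * T" by (simp add: algebra_simps)
  also have "cpt \<dots>"
    by (intro cpt_simps(2) cpt_simps(5) cpt_flow_diff cpt_diag_mult is_diag_exp is_diag_scaleR diag_D assms)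
  finally show ?thesis by (rule cpt_simps(5))
qed

text \<open>The flow itself may leave the group. Multiplied by the inverse of
  \<open>exp (t D)\<close> it becomes identity plus compact, and this diagonal factor commutes with
  \<open>b\<close>, so the conjugate is unchanged.\<close>

lemma geod_in_orbit: "mat_of (geod t) \<in> orbit (mat_of b)"
proof -
  define E where "E = exp (t *\<^sub>R D)"
  define u where "u = flow t * adj E"
  have E: "adj E * E = 1" "E * adj E = 1"
    unfolding E_def by (intro adj_exp_anti; simp add: adj_D)+
  have "unitary u"
    unfolding unitary_def u_def using E unitary_cancel[OF unitary_flow[of t]]
    by (simp add: mult.assoc) (simp add: mult.assoc[symmetric])
  moreover have "in_KC (mat_of u)"
  proof -
    have "u = (flow t - E) * adj E + scal 1" by (simp add: u_def left_diff_distrib E)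
    moreover have "cpt ((flow t - E) * adj E)" unfolding E_def by (intro cpt_simps(5) cpt_flow_diff)
    ultimately show ?thesis unfolding in_KC_iff by metis
  qed
  ultimately have "unitary_KC (mat_of u)" by (simp add: unitary_KC_def unitary_def mat_of_one)
  moreover have "geod t = u * b * adj u"
  proof -
    have "E * b = b * E"
      unfolding E_def by (intro diag_commute is_diag_exp is_diag_scaleR diag_D diag_b)
    then have "adj E * b * E = adj E * (E * b)" by (simp add: mult.assoc)
    also have "\<dots> = b" by (simp add: mult.assoc[symmetric] E)
    finally have "adj E * b * E = b" .
    moreover have "u * b * adj u = flow t * (adj E * b * E) * flow (- t)"
      by (simp add: u_def adj_flow mult.assoc)
    ultimately show ?thesis by (simp add: geod_def)
  qed
  ultimately show ?thesis unfolding orbit_def by (auto intro!: exI[of _ "mat_of u"])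
qed

lemma geod_commutator: "Y * geod t - geod t * Y = flow t * ((flow (- t) * Y * flow t) * b - b * (flow (- t) * Y * flow t)) * flow (- t)"
  by (simp add: geod_def right_diff_distrib left_diff_distrib mult.assoc flow_cancel flow_inverse)

text \<open>\<open>K + trunc n * D\<close> is compact and differs from \<open>Z\<close> by a
  diagonal operator, so it has the same commutator with \<open>b\<close>. Its norm exceeds that of
  the compression of \<open>Z\<close> by at most the truncation error of \<open>K\<close>. The flow
  carries it to time \<open>t\<close>.\<close>

lemma near_optimal_lift:
  assumes "0 < \<epsilon>"
  shows "\<exists>Y. cpt Y \<and> adj Y = - Y \<and> norm Y \<le> norm Z + \<epsilon> \<and> Y * geod t - geod t * Y = velocity t"
proof -
  obtain n where n: "norm (trunc n * K * trunc n - K) < \<epsilon>"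
    using LIMSEQ_D[OF cpt_truncate_both[OF cpt_K adj_K] assms] by blast
  define Y where "Y = K + trunc n * D"
  have comm: "trunc n * D = D * trunc n" by (intro diag_commute is_diag_trunc diag_D)
  have "trunc n * D * trunc n = trunc n * D"
    unfolding comm by (intro cop_eqI coord_inject_ext) (simp add: coord_app_diag[OF diag_D])
  then have "Y = trunc n * Z * trunc n - (trunc n * K * trunc n - K)"
    by (simp add: Y_def Z_eq distrib_left distrib_right)
  also have "norm \<dots> \<le> norm (trunc n * Z * trunc n) + norm (trunc n * K * trunc n - K)"
    by (rule norm_triangle_ineq4)
  also have "norm (trunc n * Z * trunc n) \<le> norm Z"
    by (rule order_trans[OF norm_mult_trunc_le norm_trunc_mult_le])
  finally have norm_Y: "norm Y \<le> norm Z + \<epsilon>" using n by simp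
  have cpt_Y: "cpt Y" unfolding Y_def by (intro cpt_simps(2) cpt_K cpt_trunc_mult)
  have adj_Y: "adj Y = - Y" unfolding Y_def by (simp add: adj_K adj_D comm)
  have "(Y - Z) * b = b * (Y - Z)"
    unfolding Y_def Z_eq
    by (intro diag_commute[OF _ diag_b]) (simp add: is_diag_diff is_diag_mult is_diag_trunc diag_D)
  then have Yb: "Y * b - b * Y = Z * b - b * Z" by (simp add: algebra_simps)
  show ?thesis
  proof (intro exI conjI)
    show "cpt (flow t * Y * flow (- t))" by (rule cpt_flow_conj[OF cpt_Y])
    show "adj (flow t * Y * flow (- t)) = - (flow t * Y * flow (- t))"
      using adj_flow[of t] adj_flow[of "- t"] by (simp add: adj_Y mult.assoc)
    show "norm (flow t * Y * flow (- t)) \<le> norm Z + \<epsilon>"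
      using norm_unitary_conj_le[OF unitary_flow, of t Y] norm_Y by (simp add: adj_flow)
    have "flow (- t) * (flow t * Y * flow (- t)) * flow t = Y"
      by (simp add: mult.assoc flow_cancel flow_inverse)
    then show "flow t * Y * flow (- t) * geod t - geod t * (flow t * Y * flow (- t)) = velocity t"
      unfolding geod_commutator by (simp only: Yb velocity_def)
  qed
qed

text \<open>Moved back to time 0, any other lift differs from \<open>Z\<close> by an operator
  commuting with \<open>b\<close>, hence by a skew diagonal one, and minimality compares the
  norms.\<close>

lemma norm_Z_le_lift:
  assumes "adj Y = - Y" "Y * geod t - geod t * Y = velocity t"
  shows "norm Z \<le> norm Y"
proof -
  define V where "V = flow (- t) * Y * flow t"
  have "flow t * (V * b - b * V) * flow (- t) = flow t * (Z * b - b * Z) * flow (- t)"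
    using assms(2) unfolding geod_commutator velocity_def V_def .
  then have "flow (- t) * (flow t * (V * b - b * V) * flow (- t)) * flow t
      = flow (- t) * (flow t * (Z * b - b * Z) * flow (- t)) * flow t" by simp
  then have "V * b - b * V = Z * b - b * Z" by (simp add: mult.assoc flow_cancel flow_inverse)
  then have "(V - Z) * b = b * (V - Z)" by (simp add: algebra_simps)
  then have "is_diag (mat_of (V - Z))" by (rule commute_imp_diag)
  moreover have "adj (V - Z) = - (V - Z)"
    using adj_flow[of t] adj_flow[of "- t"] assms(1) by (simp add: V_def adj_Z mult.assoc)
  ultimately have "norm Z \<le> norm (Z + (V - Z))" by (rule minimal)
  also have "\<dots> \<le> norm Y"
    using norm_conjugate_le(2)[of "flow t" Y] unitary_flow[of t] by (simp add: V_def adj_flow unitary_def)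
  finally show ?thesis .
qed

lemma velocity_tangent: "mat_of (velocity t) \<in> tangent_space (mat_of (geod t))"
  and finsler_velocity: "finsler (mat_of (geod t)) (mat_of (velocity t)) = norm Z"
proof -
  have KC: "in_KC (mat_of Y)" if "cpt Y" for Y
    using that unfolding in_KC_iff by (intro exI[of _ Y] exI[of _ 0]) (simp add: cop_eqI)
  define A where "A = {opnorm Y | Y. in_KC Y \<and> anti_herm Y \<and>
    mat_mult Y (mat_of (geod t)) - mat_mult (mat_of (geod t)) Y = mat_of (velocity t)}"
  have near: "\<exists>r\<in>A. r \<le> norm Z + \<epsilon>" if \<epsilon>: "0 < \<epsilon>" for \<epsilon>
  proof -
    obtain Y where "cpt Y" "adj Y = - Y" "norm Y \<le> norm Z + \<epsilon>" "Y * geod t - geod t * Y = velocity t"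
      using near_optimal_lift[OF \<epsilon>] by blast
    then show ?thesis unfolding A_def using KC by (intro bexI[of _ "norm Y"]) (auto intro!: exI[of _ "mat_of Y"])
  qed
  have ge: "norm Z \<le> r" if r: "r \<in> A" for r
  proof -
    obtain Y' where Y': "in_KC Y'" "anti_herm Y'" "r = opnorm Y'"
      "mat_mult Y' (mat_of (geod t)) - mat_mult (mat_of (geod t)) Y' = mat_of (velocity t)"
      using r by (auto simp: A_def)
    then obtain Y where "Y' = mat_of Y" using in_KC_imp_mat_of by blast
    with Y' show ?thesis using norm_Z_le_lift by simp
  qed
  have ne: "A \<noteq> {}" using near[of 1] by auto
  have bdd: "bdd_below A" using ge by (rule bdd_belowI)
  have "Inf A \<le> norm Z + \<epsilon>" if "0 < \<epsilon>" for \<epsilon>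
    using near[OF that] cInf_lower[OF _ bdd] order_trans by blast
  then have "Inf A \<le> norm Z" by (rule field_le_epsilon)
  moreover have "norm Z \<le> Inf A" using ne ge by (rule cInf_greatest)
  ultimately show "finsler (mat_of (geod t)) (mat_of (velocity t)) = norm Z"
    by (simp add: finsler_def A_def)
  obtain Y where "cpt Y" "adj Y = - Y" "Y * geod t - geod t * Y = velocity t"
    using near_optimal_lift[of 1] by auto
  then show "mat_of (velocity t) \<in> tangent_space (mat_of (geod t))"
    unfolding tangent_space_def using KC by (auto intro!: exI[of _ "mat_of Y"])
qed

lemma geod_has_derivative: "(geod has_vector_derivative velocity t) (at t within S)"
proof -
  have "(flow has_vector_derivative flow t * Z) (at t within S)"
    unfolding flow_def[abs_def] by (rule has_vector_derivative_at_within[OF exp_scaleR_has_vector_derivative_right])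
  moreover have "((\<lambda>t. flow (- t)) has_vector_derivative - Z * flow (- t)) (at t within S)"
    using exp_scaleR_has_vector_derivative_left[of "- Z" t]
    by (simp add: flow_def has_vector_derivative_at_within)
  ultimately have "((\<lambda>t. flow t * b * flow (- t)) has_vector_derivative
      flow t * b * (- Z * flow (- t)) + flow t * Z * b * flow (- t)) (at t within S)"
    by (intro has_vector_derivative_mult) (auto intro!: derivative_eq_intros)
  moreover have "flow t * b * (- Z * flow (- t)) + flow t * Z * b * flow (- t) = velocity t"
    by (simp add: velocity_def right_diff_distrib left_diff_distrib mult.assoc)
  ultimately show ?thesis unfolding geod_def[abs_def] by simp
qed

lemma op_has_deriv_geod: "op_has_deriv (\<lambda>t. mat_of (geod t)) (mat_of (velocity t)) t S"
proof -
  have "((\<lambda>s. (1 / norm (s - t)) *\<^sub>R (geod s - (geod t + (s - t) *\<^sub>R velocity t))) \<longlongrightarrow> 0) (at t within S)"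
    using geod_has_derivative[of t S] by (simp add: has_vector_derivative_def has_derivative_within)
  then have "((\<lambda>s. norm ((1 / norm (s - t)) *\<^sub>R (geod s - (geod t + (s - t) *\<^sub>R velocity t)))) \<longlongrightarrow> 0) (at t within S)"
    by (rule tendsto_norm_zero)
  moreover have "norm ((1 / norm (s - t)) *\<^sub>R (geod s - (geod t + (s - t) *\<^sub>R velocity t)))
      = norm ((1 / (s - t)) *\<^sub>R (geod s - geod t) - velocity t)" if "s \<noteq> t" for s
  proof -
    have "(1 / (s - t)) *\<^sub>R (geod s - geod t) - velocity t
        = (1 / (s - t)) *\<^sub>R (geod s - (geod t + (s - t) *\<^sub>R velocity t))"
      using that by (simp add: scaleR_diff_right scaleR_add_right)
    then show ?thesis by simp
  qed
  then have "\<forall>\<^sub>F s in at t within S. norm ((1 / norm (s - t)) *\<^sub>R (geod s - (geod t + (s - t) *\<^sub>R velocity t)))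
      = norm ((1 / (s - t)) *\<^sub>R (geod s - geod t) - velocity t)"
    unfolding eventually_at_filter by (intro always_eventually) simp
  ultimately have "((\<lambda>s. norm ((1 / (s - t)) *\<^sub>R (geod s - geod t) - velocity t)) \<longlongrightarrow> 0) (at t within S)"
    by (rule Lim_transform_eventually)
  moreover have "opnorm (msmult (of_real (1 / (s - t))) (mat_of (geod s) - mat_of (geod t)) - mat_of (velocity t))
      = norm ((1 / (s - t)) *\<^sub>R (geod s - geod t) - velocity t)" for s
    by (simp only: mat_of_diff msmult_mat_of opnorm_mat_of scal_algebra(1)) simp
  ultimately show ?thesis by (simp only: op_has_deriv_def)
qed

lemma continuous_on_flow [continuous_intros]:
  assumes "continuous_on S f" shows "continuous_on S (\<lambda>t. flow (f t))"
proof -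
  have "continuous_on UNIV flow"
    unfolding flow_def[abs_def]
    by (intro continuous_at_imp_continuous_on ballI
        has_vector_derivative_continuous[OF exp_scaleR_has_vector_derivative_right])
  then show ?thesis using assms by (rule continuous_on_compose2) simp
qed

lemma op_continuous_on_velocity: "op_continuous_on S (\<lambda>t. mat_of (velocity t))"
proof -
  have "continuous_on S (\<lambda>t. velocity t)"
    unfolding velocity_def by (intro continuous_intros)
  then have "((\<lambda>s. norm (velocity s - velocity t)) \<longlongrightarrow> 0) (at t within S)" if "t \<in> S" for t
    using that by (intro tendsto_norm_zero LIM_zero) (simp add: continuous_on)
  then show ?thesis by (simp add: op_continuous_on_def)
qed

lemma curve_length_geod:
  assumes "a \<le> a'"
  shows "curve_length (mat_of b) (\<lambda>t. mat_of (geod t)) a a' ((a' - a) * norm Z)"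
  unfolding curve_length_def
proof (intro conjI ballI assms geod_in_orbit)
  \<comment> \<open>Pieces of a curve must have positive length, so a degenerate interval gets the
    empty partition.\<close>
  define n :: nat where "n = (if a = a' then 0 else 1)"
  define s :: "nat \<Rightarrow> real" where "s k = (if k = 0 then a else a')" for k
  show "\<exists>(n::nat) s D ls. s 0 = a \<and> s n = a' \<and> (\<forall>k<n. s k < s (Suc k)) \<and> (a' - a) * norm Z = (\<Sum>k<n. ls k) \<and>
      (\<forall>k<n. (\<forall>t\<in>{s k..s (Suc k)}. op_has_deriv (\<lambda>t. mat_of (geod t)) (D k t) t {s k..s (Suc k)} \<and>
          D k t \<in> tangent_space (mat_of (geod t))) \<and>
        op_continuous_on {s k..s (Suc k)} (D k) \<and>
        ((\<lambda>t. finsler (mat_of (geod t)) (D k t)) has_integral ls k) {s k..s (Suc k)})"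
  proof (rule exI[of _ n], rule exI[of _ s], rule exI[of _ "\<lambda>_ t. mat_of (velocity t)"],
      rule exI[of _ "\<lambda>_. (a' - a) * norm Z"], intro conjI allI impI ballI)
    fix k assume k: "k < n"
    then have "s k = a" "s (Suc k) = a'" by (auto simp: n_def s_def split: if_splits)
    then show "((\<lambda>t. finsler (mat_of (geod t)) (mat_of (velocity t))) has_integral (a' - a) * norm Z) {s k..s (Suc k)}"
      using has_integral_const_real[of "norm Z" a a'] assms by (simp add: finsler_velocity)
    show "s k < s (Suc k)" using k assms by (auto simp: n_def s_def split: if_splits)
  qed (auto simp: n_def s_def op_has_deriv_geod velocity_tangent op_continuous_on_velocity)
qed

lemma geod_0: "geod 0 = b"
  by (simp add: geod_def flow_def)

lemma curve_length_ge:
  assumes "\<bar>t0\<bar> * norm Z \<le> pi / 2" "curve_length (mat_of b) \<beta> a a' l" "\<beta> a = mat_of b" "\<beta> a' = mat_of (geod t0)"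
  shows "\<bar>t0\<bar> * norm Z \<le> l"
proof -
  obtain B N s ls where B: "orbit_curve B N s ls" "s 0 = a" "s N = a'" "l = (\<Sum>j<N. ls j)"
    "\<beta> a = mat_of (B a)" "\<beta> a' = mat_of (B a')"
    using curve_length_imp_orbit_curve[OF assms(2)] by (elim exE conjE) (rule that)
  have "B (s N) = geod t0" using B assms(4) by simp
  then have "B (s N) = exp (t0 *\<^sub>R Z) * b * adj (exp (t0 *\<^sub>R Z))"
    using adj_flow[of t0] by (simp add: geod_def flow_def)
  moreover have "B (s 0) = b" using B assms(3) by simp
  ultimately show ?thesis
    unfolding B(4) using length_ge[OF cpt_K adj_K diag_D adj_D Z_eq minimal assms(1) B(1)] by blast
qed

end

theorem theorem4p1:
  fixes b Z :: mat
  assumes b_diag: "is_diag b" and b_cpt: "compact_op b" and b_sa: "mat_adj b = b"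
    and b_dist: "\<forall>i j. i \<noteq> j \<longrightarrow> b i i \<noteq> b j j"
    and Z_KD: "\<exists>K D. compact_op K \<and> anti_herm K \<and> bounded_op D \<and> is_diag D \<and> anti_herm D \<and> Z = K + D"
    and Z_nz: "Z \<noteq> 0"
    and Z_min: "minimal_op Z"
  defines "x \<equiv> mat_mult Z b - mat_mult b Z"
    and "\<gamma> \<equiv> (\<lambda>t::real. mat_mult (mat_mult (mat_exp (msmult (of_real t) Z)) b)
                                   (mat_exp (msmult (of_real (- t)) Z)))"
  shows "(\<forall>t. \<gamma> t \<in> orbit b) \<and> x \<in> tangent_space b \<and> finsler b x = opnorm Z \<and>
         (\<forall>t0. \<bar>t0\<bar> \<le> pi / (2 * opnorm Z) \<longrightarrow>
            curve_length b \<gamma> (min 0 t0) (max 0 t0) (\<bar>t0\<bar> * opnorm Z) \<and>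
            orbit_dist b b (\<gamma> t0) = \<bar>t0\<bar> * opnorm Z)"
proof -
  obtain b' where b': "b = mat_of b'" using b_cpt by (auto simp: compact_op_def bounded_op_iff)
  obtain Km Dm where KD: "compact_op Km" "anti_herm Km" "bounded_op Dm" "is_diag Dm" "anti_herm Dm" "Z = Km + Dm"
    using Z_KD by blast
  obtain K where K: "Km = mat_of K" using KD(1) by (auto simp: compact_op_def bounded_op_iff)
  obtain D where D: "Dm = mat_of D" using KD(3) by (auto simp: bounded_op_iff)
  define Z' where "Z' = K + D"
  have Z': "Z = mat_of Z'" by (simp add: KD K D Z'_def)
  interpret minimal_direction b' K D Z'
  proof
    show "is_diag (mat_of b')" "cpt b'" using b_diag b_cpt by (simp_all add: b')
    show "\<And>i j. i \<noteq> j \<Longrightarrow> mat_of b' i i \<noteq> mat_of b' j j" using b_dist by (simp add: b')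
    show "cpt K" "adj K = - K" "is_diag (mat_of D)" "adj D = - D" using KD by (simp_all add: K D)
    show "norm Z' \<le> norm (Z' + D')" if "is_diag (mat_of D')" "adj D' = - D'" for D'
    proof -
      have "bounded_op (mat_of D') \<and> is_diag (mat_of D') \<and> anti_herm (mat_of D')" using that by simp
      then have "opnorm Z \<le> opnorm (Z + mat_of D')" using Z_min unfolding minimal_op_def by blast
      then show ?thesis by (simp add: Z')
    qed
  qed (simp add: Z'_def)
  interpret neg: minimal_direction b' "- K" "- D" "- Z'" by (rule minimal_direction_uminus)
  have "msmult (of_real r) Z = mat_of (r *\<^sub>R Z')" for r by (simp add: Z')
  then have \<gamma>: "\<gamma> t = mat_of (geod t)" for t
    unfolding \<gamma>_def geod_def flow_def b' by (simp only: mat_exp_mat_of mat_mult_mat_of)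
  have neg_geod: "neg.geod t = geod (- t)" for t
    by (simp add: geod_def neg.geod_def flow_def neg.flow_def)
  have x: "x = mat_of (velocity 0)" by (simp add: x_def Z' b' velocity_def flow_def)
  have normZ: "opnorm Z = norm Z'" by (simp add: Z')
  have "Z' \<noteq> 0" using Z_nz by (auto simp: Z' mat_of_zero)
  then have pos: "0 < norm Z'" by simp
  have "curve_length b \<gamma> (min 0 t0) (max 0 t0) (\<bar>t0\<bar> * norm Z') \<and>
      orbit_dist b b (\<gamma> t0) = \<bar>t0\<bar> * norm Z'" if t0: "\<bar>t0\<bar> \<le> pi / (2 * norm Z')" for t0
  proof
    have "max 0 t0 - min 0 t0 = \<bar>t0\<bar>" by simp
    then show "curve_length b \<gamma> (min 0 t0) (max 0 t0) (\<bar>t0\<bar> * norm Z')"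
      using curve_length_geod[of "min 0 t0" "max 0 t0"] by (simp add: \<gamma>[abs_def] b')
    have "\<bar>t0\<bar> * norm Z' \<le> pi / 2" using t0 pos by (simp add: field_simps)
    then have lower: "\<bar>t0\<bar> * norm Z' \<le> l"
      if "\<exists>\<beta> a a'. curve_length b \<beta> a a' l \<and> \<beta> a = b \<and> \<beta> a' = \<gamma> t0" for l
      using that curve_length_ge by (auto simp: \<gamma> b')
    \<comment> \<open>A competitor must start at \<open>b\<close> with increasing parameter; for
      negative \<open>t0\<close> this is the flow of \<open>- Z\<close>, which traverses the same
      points.\<close>
    have "\<exists>\<beta> a a'. curve_length b \<beta> a a' (\<bar>t0\<bar> * norm Z') \<and> \<beta> a = b \<and> \<beta> a' = \<gamma> t0"
    proof (cases "0 \<le> t0")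
      case True
      then show ?thesis using curve_length_geod[OF True]
        by (intro exI[of _ "\<lambda>t. mat_of (geod t)"] exI[of _ 0] exI[of _ t0]) (simp add: \<gamma> b' geod_0)
    next
      case False
      then show ?thesis using neg.curve_length_geod[of 0 "- t0"]
        by (intro exI[of _ "\<lambda>t. mat_of (neg.geod t)"] exI[of _ 0] exI[of _ "- t0"])
           (simp add: \<gamma> b' neg_geod geod_0)
    qed
    then show "orbit_dist b b (\<gamma> t0) = \<bar>t0\<bar> * norm Z'"
      unfolding orbit_dist_def by (intro cInf_eq_minimum) (use lower in auto)
  qed
  then show ?thesis
    using geod_in_orbit velocity_tangent[of 0] finsler_velocity[of 0]
    by (simp add: \<gamma> x normZ b' geod_0)
qed

end
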